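(* Let $J$ and $J'$ be two-sided Jacobi matrices such that $\delta J=J-J'$ is in the trace class, that is, $\sum_{n\in\mathbb Z}|\delta a_n|+|\delta b_n|<\infty$. Let $E=\sigma(J')$, with gaps $(\alpha_k,\beta_k)$, $k\ge0$. In addition, suppose there exist non-negative constants $\{C_k\}_{k\ge0}$ such that for some $1/2<p<1$, $$\sum_{k\ge1}C_k(\beta_k-\alpha_k)^{p-1/2}<\infty,$$ and such that the spectral measures $d\rho_n$ of $(J',\delta_n)$ satisfy $$\sup_{n\in\mathbb Z}\int_E\frac{d\rho_n(t)}{|t-x|}\le\begin{cases}\dfrac{C_0}{|x-\alpha_0|^{1/2}|x-\beta_0|^{1/2}}, & x\in(\alpha_0,\beta_0),\\[3mm]\dfrac{C_k}{\operatorname{dist}(x,E)^{1/2}}, & x\in(\alpha_k,\beta_k),\ k\ge1.\end{cases}$$ Then $\sigma_{ess}(J)=E$ and the discrete eigenvalues of $J$ satisfy $$\sum_{\lambda\in\sigma(J)\setminus E}\operatorname{dist}(\lambda,E)^p\le L_{p,J'}\sum_{n\in\mathbb Z}4|\delta a_n|+|\delta b_n|,$$ where the constant $L_{p,J'}$ is independent of $\delta J$ and explicitly given by $$L_{p,J'}=\frac{p}{2p-1}\left(\frac{C_0}{(1-p)(\alpha_0-\beta_0)^{1-p}}+2\sum_{k\ge1}C_k\Bigl(\frac{\beta_k-\alpha_k}{2}\Bigr)^{p-1/2}\right).$$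
   Context: A two-sided Jacobi matrix is the operator on $\ell^2(\mathbb Z)$ given by the tridiagonal real symmetric matrix with bounded parameters $\{a_n,b_n\}_{n\in\mathbb Z}$, $a_n>0$, $b_n\in\mathbb R$, with diagonal entries $b_n$ and off-diagonal entries $a_n$ in positions $(n,n+1)$ and $(n+1,n)$. If $J=\{a_n,b_n\}$, $J'=\{a_n',b_n'\}$, then $\delta a_n=a_n-a_n'$ and $\delta b_n=b_n-b_n'$. $\{\delta_n\}$ is the standard basis of $\ell^2(\mathbb Z)$, and the spectral measure $d\rho_n$ of $(J',\delta_n)$ is defined by $\langle\delta_n,(J'-z)^{-1}\delta_n\rangle=\int_E\frac{d\rho_n(t)}{t-z}$, $z\in\mathbb C\setminus E$. For a compact set $E\subset\mathbb R$, $\beta_0=\inf E$, $\alpha_0=\sup E$, and $[\beta_0,\alpha_0]\setminus E=\bigcup_{j\ge1}(\alpha_j,\beta_j)$ as a (finite or countable) disjoint union of open intervals (inner gaps); the outer gap is $(\alpha_0,\beta_0):=(-\infty,\beta_0)\cup(\alpha_0,\infty)$. Sums over eigenvalues count multiplicity. *)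

theory Defs
  imports "HOL-Analysis.Analysis" "HOL-Library.Function_Algebras"
begin

section \<open>The complex Hilbert space of square-summable two-sided sequences\<close>

text \<open>
  Operators are represented by maps on all two-sided sequences; every notion below only
  looks at their action on the carrier \<open>ell2\<close>.
\<close>

definition ell2 :: "(int \<Rightarrow> complex) set" where
  "ell2 = {u. (\<lambda>n. (cmod (u n))\<^sup>2) summable_on UNIV}"

definition ell2_norm :: "(int \<Rightarrow> complex) \<Rightarrow> real" where
  "ell2_norm u = sqrt (\<Sum>\<^sub>\<infinity>n. (cmod (u n))\<^sup>2)"

definition ell2_inner :: "(int \<Rightarrow> complex) \<Rightarrow> (int \<Rightarrow> complex) \<Rightarrow> complex" where
  "ell2_inner u v = (\<Sum>\<^sub>\<infinity>n. cnj (u n) * v n)"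

definition ell2_basis :: "int \<Rightarrow> int \<Rightarrow> complex" where
  "ell2_basis n = (\<lambda>m. if m = n then 1 else 0)"

global_interpretation cseq: vector_space "\<lambda>(c::complex) (u::int \<Rightarrow> complex) n. c * u n"
  defines cseq_span = cseq.span and cseq_dim = cseq.dim
  by unfold_locales (auto simp: fun_eq_iff algebra_simps)


section \<open>Spectral notions\<close>

definition shifted ::
  "((int \<Rightarrow> complex) \<Rightarrow> (int \<Rightarrow> complex)) \<Rightarrow> complex \<Rightarrow> (int \<Rightarrow> complex) \<Rightarrow> (int \<Rightarrow> complex)" where
  "shifted T z u = (\<lambda>n. T u n - z * u n)"

definition resolvent ::
  "((int \<Rightarrow> complex) \<Rightarrow> (int \<Rightarrow> complex)) \<Rightarrow> complex \<Rightarrow> (int \<Rightarrow> complex) \<Rightarrow> (int \<Rightarrow> complex)" where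
  "resolvent T z = inv_into ell2 (shifted T z)"

definition spectrum :: "((int \<Rightarrow> complex) \<Rightarrow> (int \<Rightarrow> complex)) \<Rightarrow> complex set" where
  "spectrum T = {z. \<not> (bij_betw (shifted T z) ell2 ell2 \<and>
                      (\<exists>B. \<forall>v\<in>ell2. ell2_norm (resolvent T z v) \<le> B * ell2_norm v))}"

definition eigenspace ::
  "((int \<Rightarrow> complex) \<Rightarrow> (int \<Rightarrow> complex)) \<Rightarrow> complex \<Rightarrow> (int \<Rightarrow> complex) set" where
  "eigenspace T z = {u \<in> ell2. \<forall>n. T u n = z * u n}"

text \<open>
  The dimension function of the library is 0 on infinite-dimensional spaces; the multiplicity
  is only used for points of the discrete spectrum.
\<close>

definition eigenvalue_multiplicity ::
  "((int \<Rightarrow> complex) \<Rightarrow> (int \<Rightarrow> complex)) \<Rightarrow> complex \<Rightarrow> nat" where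
  "eigenvalue_multiplicity T z = cseq_dim (eigenspace T z)"

text \<open>
  Discrete and essential spectrum are those of a self-adjoint operator: the discrete spectrum
  consists of the isolated points of the spectrum that are eigenvalues of finite multiplicity.
\<close>

definition discrete_spectrum :: "((int \<Rightarrow> complex) \<Rightarrow> (int \<Rightarrow> complex)) \<Rightarrow> complex set" where
  "discrete_spectrum T = {z. z isolated_in spectrum T \<and> eigenspace T z \<noteq> {0} \<and>
                             (\<exists>B. finite B \<and> eigenspace T z \<subseteq> cseq_span B)}"

definition ess_spectrum :: "((int \<Rightarrow> complex) \<Rightarrow> (int \<Rightarrow> complex)) \<Rightarrow> complex set" where
  "ess_spectrum T = spectrum T - discrete_spectrum T"

text \<open>
  For self-adjoint \<open>T\<close> and \<open>v \<in> ell2\<close> the spectral measure exists and is the only measure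
  with this property, by Stieltjes inversion.
\<close>

definition is_spectral_measure ::
  "((int \<Rightarrow> complex) \<Rightarrow> (int \<Rightarrow> complex)) \<Rightarrow> (int \<Rightarrow> complex) \<Rightarrow> real measure \<Rightarrow> bool" where
  "is_spectral_measure T v \<rho> \<longleftrightarrow>
     (let E = {t. complex_of_real t \<in> spectrum T} in
        sets \<rho> = sets borel \<and> finite_measure \<rho> \<and> emeasure \<rho> (- E) = 0 \<and>
        (\<forall>z. z \<notin> complex_of_real ` E \<longrightarrow>
           ell2_inner v (resolvent T z v) = (LINT t:E|\<rho>. 1 / (complex_of_real t - z))))"


section \<open>Two-sided Jacobi matrices\<close>

definition jacobi_parameters :: "(int \<Rightarrow> real) \<Rightarrow> (int \<Rightarrow> real) \<Rightarrow> bool" where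
  "jacobi_parameters a b \<longleftrightarrow> (\<forall>n. a n > 0) \<and> bounded (range a) \<and> bounded (range b)"

definition jacobi ::
  "(int \<Rightarrow> real) \<Rightarrow> (int \<Rightarrow> real) \<Rightarrow> (int \<Rightarrow> complex) \<Rightarrow> (int \<Rightarrow> complex)" where
  "jacobi a b u = (\<lambda>n. complex_of_real (a (n - 1)) * u (n - 1) + complex_of_real (b n) * u n
                       + complex_of_real (a n) * u (n + 1))"


section \<open>Gaps of a compact subset of the real line\<close>

text \<open>
  The inner gaps are indexed by a set \<open>K\<close> of positive integers, finite, infinite or empty.
  Index 0 belongs to the outer gap, where \<open>\<alpha> 0\<close> is the right end point of the
  convex hull of the set and \<open>\<beta> 0\<close> the left one.
\<close>

definition gap_enumeration ::
  "real set \<Rightarrow> nat set \<Rightarrow> (nat \<Rightarrow> real) \<Rightarrow> (nat \<Rightarrow> real) \<Rightarrow> bool" where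
  "gap_enumeration E K \<alpha> \<beta> \<longleftrightarrow>
     0 \<notin> K \<and> \<beta> 0 = Inf E \<and> \<alpha> 0 = Sup E \<and>
     (\<forall>k\<in>K. \<alpha> k < \<beta> k) \<and>
     disjoint_family_on (\<lambda>k. {\<alpha> k<..<\<beta> k}) K \<and>
     {\<beta> 0..\<alpha> 0} - E = (\<Union>k\<in>K. {\<alpha> k<..<\<beta> k})"

definition LT_const ::
  "real \<Rightarrow> nat set \<Rightarrow> (nat \<Rightarrow> real) \<Rightarrow> (nat \<Rightarrow> real) \<Rightarrow> (nat \<Rightarrow> real) \<Rightarrow> real" where
  "LT_const p K \<alpha> \<beta> C =
     p / (2 * p - 1) *
       (C 0 / ((1 - p) * (\<alpha> 0 - \<beta> 0) powr (1 - p))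
        + 2 * (\<Sum>\<^sub>\<infinity>k\<in>K. C k * ((\<beta> k - \<alpha> k) / 2) powr (p - 1 / 2)))"

end

theory Submission
  imports Defs
begin

text \<open>
  Write \<open>T\<close> for the unperturbed and \<open>A\<close> for the perturbed operator.  The perturbation is squeezed
  between two diagonal operators: \<open>- W' \<le> A - T \<le> W\<close>, where \<open>W\<close> collects the positive part of
  \<open>\<delta>b\<^sub>n\<close> and \<open>W'\<close> its negative part, each increased by \<open>\<bar>\<delta>a\<^sub>n\<^sub>-\<^sub>1\<bar> + \<bar>\<delta>a\<^sub>n\<bar>\<close>.  The two traces add up
  to the sum on the right-hand side of the inequality (\<open>trace_weight_total\<close>).

  The heart of the matter is a bound on the number of eigenvalues of \<open>A\<close> in an interval \<open>[x, y]\<close>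
  inside a gap of \<open>T\<close> (\<open>eigenvalue_count_le\<close>):
  \<open>N \<le> tr (W \<bar>T - x\<bar>\<^sup>-\<^sup>1) + tr (W' \<bar>T - y\<bar>\<^sup>-\<^sup>1)\<close>.
  The Hilbert space splits into the part where \<open>T \<le> x\<close> and the part where \<open>T \<ge> y\<close>.  On the first,
  \<open>T + W\<close>, and with it \<open>A\<close>, stays below \<open>x\<close> off a subspace whose dimension is at most the first
  trace; this is the Birman-Schwinger principle, proved here variationally by taking a maximal
  family orthonormal for the form of \<open>\<bar>T - x\<bar>\<close> and applying Bessel's inequality.  On the second,
  \<open>A\<close> stays above \<open>y\<close> off a subspace controlled by the second trace.  With more
  eigenvectors than these two dimensions allow, some combination of them would have both
  components in the good subspaces, which is impossible because the form of \<open>A\<close> lies between \<open>x\<close>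
  and \<open>y\<close> on the span of the eigenvectors.  Both traces are bounded by the
  integrals of the spectral measures, as \<open>\<langle>\<delta>\<^sub>n, \<bar>T - x\<bar>\<^sup>-\<^sup>1 \<delta>\<^sub>n\<rangle> \<le> \<integral> d\<rho>\<^sub>n(t) / \<bar>t - x\<bar>\<close>
  (\<open>abs_resolvent_diagonal_le\<close>).  Taking \<open>x\<close> and \<open>y\<close> at distance \<open>s\<close> from the ends of a gap gives
  at most \<open>C\<^sub>k * \<tau> / sqrt s\<close> eigenvalues at distance at least \<open>s\<close>, with \<open>\<tau>\<close> the total trace, and
  integration against \<open>p * s powr (p - 1)\<close> produces the terms of the constant.

  The splitting comes from an explicit sign.  For a symmetric \<open>M = T - x\<close> that is bounded below,
  \<open>\<bar>M\<bar>\<^sup>-\<^sup>1\<close> is the sum of the binomial series of \<open>(1 - X) powr (-1/2)\<close> at \<open>X = 1 - M\<^sup>2 / K\<^sup>2\<close>, and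
  \<open>S = M \<bar>M\<bar>\<^sup>-\<^sup>1\<close> is a symmetric involution, the sign of \<open>M\<close>.  The partial sums of the series
  are polynomials in \<open>T\<close>, whose diagonal entries are integrals against \<open>\<rho>\<^sub>n\<close>.  The sign does not change as \<open>x\<close> moves
  inside a gap (\<open>sign_op_constant_on_connected\<close>), which makes the splitting independent of \<open>x\<close>.

  For the essential spectrum, a compact perturbation turns points of a gap at most into isolated
  eigenvalues (\<open>perturbed_gap_isolated_eigenvalue\<close>).  Applied in both directions this leaves only
  the possibility that \<open>E\<close> has isolated points; such a point would be an eigenvalue of \<open>T\<close>, and
  then the integrals would grow like \<open>1 / \<bar>x - l\<bar>\<close> near it, faster than the assumed bound permits
  (\<open>no_isolated_point\<close>).  Finally, constancy of the Wronskian makes every eigenvalue simple, so that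
  counting eigenvalues and counting with multiplicity agree.
\<close>

section \<open>Square-summable sequences as a real Hilbert space\<close>

typedef l2 = ell2
  morphisms coord to_l2
proof
  show "(\<lambda>_. 0) \<in> ell2" by (simp add: ell2_def)
qed

setup_lifting type_definition_l2

lemma coord_sq_summable: "(\<lambda>n. (cmod (coord u n))\<^sup>2) summable_on UNIV"
  using coord[of u] by (simp add: ell2_def)

lemma l2_eqI: "(\<And>n. coord u n = coord v n) \<Longrightarrow> u = v"
  by (metis coord_inject ext)

lemma ell2_add:
  assumes "u \<in> ell2" "v \<in> ell2"
  shows "(\<lambda>n. u n + v n) \<in> ell2"
proof -
  have "(\<lambda>n. 2 * (cmod (u n))\<^sup>2 + 2 * (cmod (v n))\<^sup>2) summable_on UNIV"
    using assms by (intro summable_on_add summable_on_cmult_right) (auto simp: ell2_def)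
  moreover have "(cmod (u n + v n))\<^sup>2 \<le> 2 * (cmod (u n))\<^sup>2 + 2 * (cmod (v n))\<^sup>2" for n
  proof -
    have "(cmod (u n + v n))\<^sup>2 \<le> (cmod (u n) + cmod (v n))\<^sup>2"
      by (intro power_mono norm_triangle_ineq) auto
    also have "\<dots> \<le> 2 * (cmod (u n))\<^sup>2 + 2 * (cmod (v n))\<^sup>2"
      using sum_squares_bound[of "cmod (u n)" "cmod (v n)"] by (simp add: power2_sum)
    finally show ?thesis .
  qed
  ultimately show ?thesis
    unfolding ell2_def by (auto intro: summable_on_comparison_test)
qed

lemma ell2_mult_bounded:
  assumes "u \<in> ell2" and "\<And>n. cmod (c n) \<le> K"
  shows "(\<lambda>n. c n * u n) \<in> ell2"
proof -
  have "(\<lambda>n. K\<^sup>2 * (cmod (u n))\<^sup>2) summable_on UNIV"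
    using assms by (intro summable_on_cmult_right) (auto simp: ell2_def)
  moreover have "(cmod (c n * u n))\<^sup>2 \<le> K\<^sup>2 * (cmod (u n))\<^sup>2" for n
    using assms(2)[of n] by (auto simp: norm_mult power_mult_distrib intro!: mult_right_mono power_mono)
  ultimately show ?thesis
    unfolding ell2_def by (auto intro: summable_on_comparison_test)
qed

lemma ell2_scale: "u \<in> ell2 \<Longrightarrow> (\<lambda>n. c * u n) \<in> ell2"
  by (rule ell2_mult_bounded[where K = "cmod c"]) auto

instantiation l2 :: real_vector
begin

lift_definition zero_l2 :: l2 is "\<lambda>_. 0"
  by (simp add: ell2_def)
lift_definition plus_l2 :: "l2 \<Rightarrow> l2 \<Rightarrow> l2" is "\<lambda>u v n. u n + v n"
  by (rule ell2_add)
lift_definition uminus_l2 :: "l2 \<Rightarrow> l2" is "\<lambda>u n. - u n"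
  by (simp add: ell2_def)
lift_definition minus_l2 :: "l2 \<Rightarrow> l2 \<Rightarrow> l2" is "\<lambda>u v n. u n - v n"
  subgoal for u v using ell2_add[of u "\<lambda>n. - v n"] by (simp add: ell2_def)
  done
lift_definition scaleR_l2 :: "real \<Rightarrow> l2 \<Rightarrow> l2" is "\<lambda>r u n. r *\<^sub>R u n"
  subgoal for r u using ell2_scale[of u "complex_of_real r"] by (simp add: scaleR_conv_of_real)
  done

instance
  by standard (transfer; simp add: fun_eq_iff algebra_simps)+

end

lemma coord_simps [simp]:
  "coord 0 n = 0" "coord (u + v) n = coord u n + coord v n" "coord (- u) n = - coord u n"
  "coord (u - v) n = coord u n - coord v n" "coord (r *\<^sub>R u) n = r *\<^sub>R coord u n"
  by (transfer; simp)+

lemma coord_inner_abs_summable: "(\<lambda>n. norm (coord u n \<bullet> coord v n)) summable_on UNIV"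
proof (rule summable_on_comparison_test)
  show "(\<lambda>n. (1/2) * ((cmod (coord u n))\<^sup>2 + (cmod (coord v n))\<^sup>2)) summable_on UNIV"
    by (intro summable_on_cmult_right summable_on_add coord_sq_summable)
  fix n
  have "\<bar>coord u n \<bullet> coord v n\<bar> \<le> cmod (coord u n) * cmod (coord v n)"
    by (rule Cauchy_Schwarz_ineq2)
  also have "\<dots> \<le> (1/2) * ((cmod (coord u n))\<^sup>2 + (cmod (coord v n))\<^sup>2)"
    using sum_squares_bound[of "cmod (coord u n)" "cmod (coord v n)"] by simp
  finally show "norm (coord u n \<bullet> coord v n) \<le> (1/2) * ((cmod (coord u n))\<^sup>2 + (cmod (coord v n))\<^sup>2)"
    by simp
qed simp

lemma coord_inner_summable: "(\<lambda>n. coord u n \<bullet> coord v n) summable_on UNIV"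
  using coord_inner_abs_summable by (rule abs_summable_summable)

text \<open>
  Taking the real part of the complex inner product keeps the norm and makes multiplication by
  \<open>\<i>\<close> a skew-symmetric isometry.
\<close>

instantiation l2 :: real_inner
begin

definition inner_l2 :: "l2 \<Rightarrow> l2 \<Rightarrow> real" where
  "inner_l2 u v = (\<Sum>\<^sub>\<infinity>n. coord u n \<bullet> coord v n)"
definition norm_l2 :: "l2 \<Rightarrow> real" where
  "norm_l2 u = sqrt (u \<bullet> u)"
definition sgn_l2 :: "l2 \<Rightarrow> l2" where
  "sgn_l2 u = u /\<^sub>R norm u"
definition dist_l2 :: "l2 \<Rightarrow> l2 \<Rightarrow> real" where
  "dist_l2 u v = norm (u - v)"
definition uniformity_l2 :: "(l2 \<times> l2) filter" where
  "uniformity_l2 = (INF e\<in>{0 <..}. principal {(u, v). dist u v < e})"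
definition open_l2 :: "l2 set \<Rightarrow> bool" where
  "open_l2 U = (\<forall>u\<in>U. eventually (\<lambda>(u', v). u' = u \<longrightarrow> v \<in> U) uniformity)"

instance
proof
  fix u v w :: l2 and r :: real
  show "u \<bullet> v = v \<bullet> u"
    by (simp add: inner_l2_def inner_commute)
  show "(u + v) \<bullet> w = u \<bullet> w + v \<bullet> w"
    by (simp add: inner_l2_def inner_add_left infsum_add coord_inner_summable)
  show "(r *\<^sub>R u) \<bullet> v = r * (u \<bullet> v)"
    by (simp add: inner_l2_def infsum_cmult_right')
  show pos: "0 \<le> u \<bullet> u"
    by (simp add: inner_l2_def infsum_nonneg)
  show "u \<bullet> u = 0 \<longleftrightarrow> u = 0"
  proof
    assume 0: "u \<bullet> u = 0"
    show "u = 0"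
    proof (rule l2_eqI)
      fix n
      have "coord u n \<bullet> coord u n = 0"
        using 0 unfolding inner_l2_def
        by (intro nonneg_infsum_le_0D[of _ UNIV] coord_inner_summable) auto
      then show "coord u n = coord 0 n" by simp
    qed
  qed (simp add: inner_l2_def)
qed (simp_all add: norm_l2_def sgn_l2_def dist_l2_def uniformity_l2_def open_l2_def)

end

lemma norm_l2_sq: "(norm (u::l2))\<^sup>2 = (\<Sum>\<^sub>\<infinity>n. (cmod (coord u n))\<^sup>2)"
  by (simp add: power2_norm_eq_inner inner_l2_def)

lemma norm_l2_ell2_norm: "norm u = ell2_norm (coord u)"
  unfolding ell2_norm_def norm_l2_sq[symmetric] by simp

lemma coord_sum_le_norm:
  assumes "finite F"
  shows "(\<Sum>n\<in>F. (cmod (coord u n))\<^sup>2) \<le> (norm u)\<^sup>2"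
  unfolding norm_l2_sq by (intro finite_sum_le_infsum coord_sq_summable assms) auto

lemma coord_le_norm: "cmod (coord u n) \<le> norm u"
  using coord_sum_le_norm[of "{n}" u] by (simp add: power2_le_iff_abs_le)

lemma norm_l2_leI:
  assumes "\<And>F. finite F \<Longrightarrow> (\<Sum>n\<in>F. (cmod (coord u n))\<^sup>2) \<le> c\<^sup>2" "0 \<le> c"
  shows "norm u \<le> c"
proof -
  have "(norm u)\<^sup>2 \<le> c\<^sup>2"
    unfolding norm_l2_sq by (intro infsum_le_finite_sums coord_sq_summable assms) auto
  then show ?thesis using assms(2) by (simp add: power2_le_iff_abs_le)
qed

lemma ell2I_bounded_sums:
  assumes "\<And>F. finite F \<Longrightarrow> (\<Sum>n\<in>F. (cmod (u n))\<^sup>2) \<le> c"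
  shows "u \<in> ell2"
  unfolding ell2_def mem_Collect_eq
  by (rule nonneg_bdd_above_summable_on) (auto intro!: bdd_aboveI[where M = c] assms)

text \<open>Fatou's lemma for sums carries the Cauchy estimate over to the coordinatewise limit.\<close>

instance l2 :: complete_space
proof
  fix X :: "nat \<Rightarrow> l2" assume X: "Cauchy X"
  have "\<exists>z. (\<lambda>k. coord (X k) n) \<longlonglongrightarrow> z" for n
  proof -
    have "Cauchy (\<lambda>k. coord (X k) n)"
      unfolding Cauchy_iff
    proof (intro allI impI)
      fix e :: real assume "e > 0"
      then obtain M where "\<And>j k. j \<ge> M \<Longrightarrow> k \<ge> M \<Longrightarrow> norm (X j - X k) < e"
        using X unfolding Cauchy_iff by blast
      then show "\<exists>M. \<forall>j\<ge>M. \<forall>k\<ge>M. norm (coord (X j) n - coord (X k) n) < e"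
        by (metis coord_le_norm coord_simps(4) le_less_trans)
    qed
    then show ?thesis by (simp add: Cauchy_convergent_iff convergent_def)
  qed
  then obtain L where L: "\<And>n. (\<lambda>k. coord (X k) n) \<longlonglongrightarrow> L n" by metis
  have tail: "\<exists>M. \<forall>k\<ge>M. \<forall>F. finite F \<longrightarrow> (\<Sum>n\<in>F. (cmod (coord (X k) n - L n))\<^sup>2) \<le> e\<^sup>2"
    if "e > 0" for e :: real
  proof -
    obtain M where M: "\<And>j k. j \<ge> M \<Longrightarrow> k \<ge> M \<Longrightarrow> norm (X j - X k) < e"
      using X \<open>e > 0\<close> unfolding Cauchy_iff by blast
    have "(\<Sum>n\<in>F. (cmod (coord (X k) n - L n))\<^sup>2) \<le> e\<^sup>2" if "k \<ge> M" "finite F" for k F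
    proof (rule tendsto_upperbound)
      show "(\<lambda>j. \<Sum>n\<in>F. (cmod (coord (X k) n - coord (X j) n))\<^sup>2)
              \<longlonglongrightarrow> (\<Sum>n\<in>F. (cmod (coord (X k) n - L n))\<^sup>2)"
        by (intro tendsto_intros L)
      have "(\<Sum>n\<in>F. (cmod (coord (X k) n - coord (X j) n))\<^sup>2) \<le> e\<^sup>2" if "j \<ge> M" for j
      proof -
        have "(\<Sum>n\<in>F. (cmod (coord (X k - X j) n))\<^sup>2) \<le> (norm (X k - X j))\<^sup>2"
          by (rule coord_sum_le_norm) fact
        also have "\<dots> \<le> e\<^sup>2"
          using M[OF \<open>k \<ge> M\<close> that] by (intro power_mono) auto
        finally show ?thesis by simp
      qed
      then show "\<forall>\<^sub>F j in sequentially. (\<Sum>n\<in>F. (cmod (coord (X k) n - coord (X j) n))\<^sup>2) \<le> e\<^sup>2"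
        by (auto simp: eventually_sequentially)
    qed simp
    then show ?thesis by blast
  qed
  obtain M where M: "\<And>F. finite F \<Longrightarrow> (\<Sum>n\<in>F. (cmod (coord (X M) n - L n))\<^sup>2) \<le> 1\<^sup>2"
    using tail[of 1] by auto
  have "(\<lambda>n. coord (X M) n - L n) \<in> ell2"
    using M by (intro ell2I_bounded_sums[where c = "1\<^sup>2"]) auto
  then have "(\<lambda>n. coord (X M) n + (-1) * (coord (X M) n - L n)) \<in> ell2"
    by (intro ell2_add coord ell2_scale)
  then have L2: "L \<in> ell2" by simp
  have "X \<longlonglongrightarrow> to_l2 L"
  proof (rule LIMSEQ_I)
    fix e :: real assume "e > 0"
    then obtain M where M: "\<And>k F. k \<ge> M \<Longrightarrow> finite F \<Longrightarrow> (\<Sum>n\<in>F. (cmod (coord (X k) n - L n))\<^sup>2) \<le> (e/2)\<^sup>2"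
      using tail[of "e/2"] by auto
    have "norm (X k - to_l2 L) < e" if "k \<ge> M" for k
    proof -
      have "norm (X k - to_l2 L) \<le> e / 2"
        using M[OF that] \<open>e > 0\<close> by (intro norm_l2_leI) (auto simp: to_l2_inverse L2)
      then show ?thesis using \<open>e > 0\<close> by simp
    qed
    then show "\<exists>M. \<forall>k\<ge>M. norm (X k - to_l2 L) < e" by blast
  qed
  then show "convergent X" by (auto simp: convergent_def)
qed

instance l2 :: banach ..

definition unit_vec :: "int \<Rightarrow> l2" where
  "unit_vec n = to_l2 (ell2_basis n)"

lemma ell2_basis_in_ell2: "ell2_basis n \<in> ell2"
proof -
  have "(\<lambda>m. (cmod (ell2_basis n m))\<^sup>2) summable_on UNIV
      \<longleftrightarrow> (\<lambda>m. (cmod (ell2_basis n m))\<^sup>2) summable_on {n}"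
    by (rule summable_on_cong_neutral) (auto simp: ell2_basis_def)
  then show ?thesis by (simp add: ell2_def)
qed

lemma coord_unit_vec: "coord (unit_vec n) m = (if m = n then 1 else 0)"
  by (simp add: unit_vec_def to_l2_inverse ell2_basis_in_ell2) (simp add: ell2_basis_def)

lemma unit_vec_inner: "unit_vec n \<bullet> u = Re (coord u n)"
proof -
  have "(\<Sum>\<^sub>\<infinity>m. coord (unit_vec n) m \<bullet> coord u m) = (\<Sum>\<^sub>\<infinity>m\<in>{n}. coord (unit_vec n) m \<bullet> coord u m)"
    by (rule infsum_cong_neutral) (auto simp: coord_unit_vec)
  then show ?thesis by (simp add: inner_l2_def coord_unit_vec inner_complex_def)
qed

lemma norm_unit_vec [simp]: "norm (unit_vec n) = 1"
  by (simp add: norm_eq_sqrt_inner unit_vec_inner coord_unit_vec)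

instance l2 :: perfect_space
proof
  fix x :: l2
  have "\<exists>y. y \<noteq> x \<and> dist y x < e" if "e > 0" for e
  proof (intro exI conjI)
    show "x + (e/2) *\<^sub>R unit_vec 0 \<noteq> x"
      using that norm_unit_vec[of 0] by (metis add_cancel_right_right div_by_0 half_gt_zero_iff norm_zero
          scaleR_eq_0_iff less_irrefl zero_neq_one)
    show "dist (x + (e/2) *\<^sub>R unit_vec 0) x < e"
      using that by (simp add: dist_norm)
  qed
  then show "\<not> open {x}"
    unfolding open_dist by auto
qed


section \<open>The Banach algebra of bounded operators\<close>

typedef (overloaded) 'a endo = "UNIV :: ('a::real_normed_vector \<Rightarrow>\<^sub>L 'a) set"
  morphisms blinfun_of to_endo ..

setup_lifting type_definition_endo

instantiation endo :: (real_normed_vector) real_vector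
begin

lift_definition zero_endo :: "'a endo" is 0 .
lift_definition plus_endo :: "'a endo \<Rightarrow> 'a endo \<Rightarrow> 'a endo" is "(+)" .
lift_definition uminus_endo :: "'a endo \<Rightarrow> 'a endo" is uminus .
lift_definition minus_endo :: "'a endo \<Rightarrow> 'a endo \<Rightarrow> 'a endo" is "(-)" .
lift_definition scaleR_endo :: "real \<Rightarrow> 'a endo \<Rightarrow> 'a endo" is scaleR .

instance by standard (transfer; simp add: algebra_simps)+

end

instantiation endo :: (real_normed_vector) real_normed_vector
begin

lift_definition norm_endo :: "'a endo \<Rightarrow> real" is norm .
definition sgn_endo :: "'a endo \<Rightarrow> 'a endo" where
  "sgn_endo u = u /\<^sub>R norm u"
definition dist_endo :: "'a endo \<Rightarrow> 'a endo \<Rightarrow> real" where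
  "dist_endo u v = norm (u - v)"
definition uniformity_endo :: "('a endo \<times> 'a endo) filter" where
  "uniformity_endo = (INF e\<in>{0 <..}. principal {(u, v). dist u v < e})"
definition open_endo :: "'a endo set \<Rightarrow> bool" where
  "open_endo U = (\<forall>u\<in>U. eventually (\<lambda>(u', v). u' = u \<longrightarrow> v \<in> U) uniformity)"

instance
proof
  fix A B :: "'a endo" and r :: real
  show "norm (A + B) \<le> norm A + norm B"
    by transfer (rule norm_triangle_ineq)
  show "norm A = 0 \<longleftrightarrow> A = 0" "norm (r *\<^sub>R A) = \<bar>r\<bar> * norm A"
    by (transfer; simp)+
qed (simp_all add: sgn_endo_def dist_endo_def uniformity_endo_def open_endo_def)

end

instantiation endo :: ("{real_normed_vector, perfect_space}") real_normed_algebra_1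
begin

lift_definition one_endo :: "'a endo" is id_blinfun .
lift_definition times_endo :: "'a endo \<Rightarrow> 'a endo \<Rightarrow> 'a endo" is blinfun_compose .

instance
proof
  fix A B C :: "'a endo" and r :: real
  show "norm (A * B) \<le> norm A * norm B"
    by transfer (rule norm_blinfun_compose)
  show "norm (1 :: 'a endo) = 1"
    by transfer (rule norm_blinfun_id)
  then show "(0 :: 'a endo) \<noteq> 1" by (metis norm_zero zero_neq_one)
qed (transfer; rule blinfun_eqI; simp add: blinfun.bilinear_simps)+

end

instance endo :: (banach) banach
proof
  fix X :: "nat \<Rightarrow> 'a endo" assume "Cauchy X"
  then have "Cauchy (\<lambda>n. blinfun_of (X n))"
    by (simp add: Cauchy_iff norm_endo.rep_eq minus_endo.rep_eq)
  then obtain L where "(\<lambda>n. blinfun_of (X n)) \<longlonglongrightarrow> L"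
    by (auto simp: Cauchy_convergent_iff convergent_def)
  then have "X \<longlonglongrightarrow> to_endo L"
    by (simp add: LIMSEQ_iff norm_endo.rep_eq minus_endo.rep_eq to_endo_inverse)
  then show "convergent X" by (auto simp: convergent_def)
qed

lift_definition endo_apply :: "'a::real_normed_vector endo \<Rightarrow> 'a \<Rightarrow> 'a" (infixr "\<cdot>" 75)
  is blinfun_apply .

lemma endo_eqI: "(\<And>u. A \<cdot> u = B \<cdot> u) \<Longrightarrow> A = B"
  by transfer (rule blinfun_eqI)

lemma endo_apply_simps [simp]:
  "0 \<cdot> u = 0" "(A + B) \<cdot> u = A \<cdot> u + B \<cdot> u" "(- A) \<cdot> u = - (A \<cdot> u)"
  "(A - B) \<cdot> u = A \<cdot> u - B \<cdot> u" "(r *\<^sub>R A) \<cdot> u = r *\<^sub>R (A \<cdot> u)"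
  "A \<cdot> 0 = 0" "A \<cdot> (u + v) = A \<cdot> u + A \<cdot> v" "A \<cdot> (- u) = - (A \<cdot> u)"
  "A \<cdot> (u - v) = A \<cdot> u - A \<cdot> v" "A \<cdot> (r *\<^sub>R u) = r *\<^sub>R (A \<cdot> u)"
  by (transfer; simp add: blinfun.bilinear_simps)+

lemma endo_apply_mult [simp]:
  fixes A :: "'a::{real_normed_vector, perfect_space} endo"
  shows "(A * B) \<cdot> u = A \<cdot> B \<cdot> u" "(1 :: 'a endo) \<cdot> u = u"
  by (transfer; simp)+

lemma endo_apply_sum: "A \<cdot> (\<Sum>i\<in>I. f i) = (\<Sum>i\<in>I. A \<cdot> f i)"
  by (induction I rule: infinite_finite_induct) auto

lemma norm_endo_apply: "norm (A \<cdot> u) \<le> norm A * norm u"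
  by transfer (rule norm_blinfun)

lemma norm_endo_bound: "(\<And>u. norm (A \<cdot> u) \<le> c * norm u) \<Longrightarrow> 0 \<le> c \<Longrightarrow> norm A \<le> c"
  by transfer (rule norm_blinfun_bound)

lemma bounded_linear_endo_apply: "bounded_linear ((\<cdot>) A)"
  by transfer (rule blinfun.bounded_linear_right)

lemma bounded_linear_endo_apply_left: "bounded_linear (\<lambda>A. A \<cdot> u)"
  by (rule bounded_linear_intro[where K = "norm u"]) (auto simp: norm_endo_apply mult.commute[of "norm u"])

section \<open>The inverse absolute value and the sign of an invertible symmetric operator\<close>

definition symmetric_op :: "'a::real_inner endo \<Rightarrow> bool" where
  "symmetric_op A \<longleftrightarrow> (\<forall>u v. (A \<cdot> u) \<bullet> v = u \<bullet> (A \<cdot> v))"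

lemma symmetric_opD: "symmetric_op A \<Longrightarrow> (A \<cdot> u) \<bullet> v = u \<bullet> (A \<cdot> v)"
  by (simp add: symmetric_op_def)

lemma symmetric_op_add: "symmetric_op A \<Longrightarrow> symmetric_op B \<Longrightarrow> symmetric_op (A + B)"
  and symmetric_op_diff: "symmetric_op A \<Longrightarrow> symmetric_op B \<Longrightarrow> symmetric_op (A - B)"
  and symmetric_op_scaleR: "symmetric_op A \<Longrightarrow> symmetric_op (r *\<^sub>R A)"
  by (auto simp: symmetric_op_def inner_add_left inner_add_right inner_diff_left inner_diff_right)

lemma symmetric_op_one: "symmetric_op (1 :: 'a::{real_inner, perfect_space} endo)"
  by (simp add: symmetric_op_def)

lemma symmetric_op_mult:
  fixes A B :: "'a::{real_inner, perfect_space} endo"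
  assumes "symmetric_op A" "symmetric_op B" "A * B = B * A"
  shows "symmetric_op (A * B)"
proof -
  have "((A * B) \<cdot> u) \<bullet> v = u \<bullet> ((B * A) \<cdot> v)" for u v
    using assms(1,2) by (simp add: symmetric_op_def)
  then show ?thesis
    using assms(3) by (simp add: symmetric_op_def)
qed

lemma symmetric_op_power:
  fixes A :: "'a::{real_inner, perfect_space} endo"
  assumes "symmetric_op A"
  shows "symmetric_op (A ^ k)"
  by (induction k) (auto simp: symmetric_op_one power_commutes intro!: symmetric_op_mult assms)

lemma symmetric_op_sum: "(\<And>i. i \<in> I \<Longrightarrow> symmetric_op (A i)) \<Longrightarrow> symmetric_op (\<Sum>i\<in>I. A i)"
  by (induction I rule: infinite_finite_induct) (auto intro: symmetric_op_add simp: symmetric_op_def inner_add_left inner_add_right)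

lemma symmetric_op_limit:
  assumes "A \<longlonglongrightarrow> B" "\<And>n. symmetric_op (A n)"
  shows "symmetric_op B"
  unfolding symmetric_op_def
proof (intro allI)
  fix u v
  have "(\<lambda>n. (A n \<cdot> u) \<bullet> v) \<longlonglongrightarrow> (B \<cdot> u) \<bullet> v" "(\<lambda>n. u \<bullet> (A n \<cdot> v)) \<longlonglongrightarrow> u \<bullet> (B \<cdot> v)"
    by (intro tendsto_intros bounded_linear.tendsto[OF bounded_linear_endo_apply_left] assms(1))+
  moreover have "(\<lambda>n. (A n \<cdot> u) \<bullet> v) = (\<lambda>n. u \<bullet> (A n \<cdot> v))"
    using assms(2) by (simp add: symmetric_op_def)
  ultimately show "(B \<cdot> u) \<bullet> v = u \<bullet> (B \<cdot> v)"
    using LIMSEQ_unique by metis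
qed

text \<open>Taylor coefficients of \<open>(1 - y) powr (-1/2)\<close> at 0.\<close>

definition inv_sqrt_coeff :: "nat \<Rightarrow> real" where
  "inv_sqrt_coeff k = pochhammer (1/2) k / fact k"

lemma inv_sqrt_coeff_nonneg: "0 \<le> inv_sqrt_coeff k"
  by (simp add: inv_sqrt_coeff_def pochhammer_nonneg)

lemma inv_sqrt_coeff_convolution: "(\<Sum>i\<le>k. inv_sqrt_coeff i * inv_sqrt_coeff (k - i)) = 1"
proof -
  have "fact k * (\<Sum>i\<le>k. inv_sqrt_coeff i * inv_sqrt_coeff (k - i))
      = (\<Sum>i\<le>k. of_nat (k choose i) * pochhammer (1/2) i * pochhammer (1/2) (k - i))"
    unfolding sum_distrib_left
    by (intro sum.cong refl) (simp add: inv_sqrt_coeff_def binomial_fact field_simps)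
  also have "\<dots> = pochhammer (1/2 + 1/2) k"
    by (rule pochhammer_binomial_sum[symmetric])
  also have "\<dots> = (fact k :: real)"
    by (simp add: pochhammer_fact)
  finally show ?thesis by simp
qed

lemma inv_sqrt_coeff_le_1: "inv_sqrt_coeff k \<le> 1"
proof -
  have "inv_sqrt_coeff 0 * inv_sqrt_coeff (k - 0) \<le> (\<Sum>i\<le>k. inv_sqrt_coeff i * inv_sqrt_coeff (k - i))"
    by (rule member_le_sum[of 0]) (auto intro!: mult_nonneg_nonneg inv_sqrt_coeff_nonneg)
  then show ?thesis
    by (simp add: inv_sqrt_coeff_convolution) (simp add: inv_sqrt_coeff_def)
qed

lemma inv_sqrt_series_partial_sum_le:
  assumes "0 \<le> y" "y < 1"
  shows "(\<Sum>k<n. inv_sqrt_coeff k * y ^ k) \<le> 1 / sqrt (1 - y)"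
proof -
  have "(\<lambda>k. ((-1/2) gchoose k) * (- y) ^ k) sums (1 + (- y)) powr (-1/2)"
    using assms by (intro gen_binomial_real) auto
  moreover have "((-1/2) gchoose k) * (- y) ^ k = inv_sqrt_coeff k * y ^ k" for k
    by (simp add: inv_sqrt_coeff_def gbinomial_pochhammer power_mult_distrib[symmetric])
  ultimately have sums: "(\<lambda>k. inv_sqrt_coeff k * y ^ k) sums (1 + (- y)) powr (-1/2)"
    by simp
  then have "(\<Sum>k<n. inv_sqrt_coeff k * y ^ k) \<le> (1 + (- y)) powr (-1/2)"
    unfolding sums_unique[OF sums]
    by (intro sum_le_suminf sums_summable[OF sums])
      (use assms in \<open>auto intro!: mult_nonneg_nonneg inv_sqrt_coeff_nonneg\<close>)
  also have "\<dots> = 1 / sqrt (1 - y)"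
    using assms by (simp add: powr_minus_divide powr_half_sqrt)
  finally show ?thesis .
qed

context
  fixes X :: "'a::{banach, perfect_space} endo"
  assumes X: "norm X < 1"
begin

lemma inv_sqrt_series_summable_norm: "summable (\<lambda>k. norm (inv_sqrt_coeff k *\<^sub>R X ^ k))"
proof (rule summable_comparison_test')
  show "summable (\<lambda>k. norm X ^ k)"
    using X by (simp add: summable_geometric)
  show "norm (norm (inv_sqrt_coeff k *\<^sub>R X ^ k)) \<le> norm X ^ k" if "k \<ge> 0" for k
  proof -
    have "norm (inv_sqrt_coeff k *\<^sub>R X ^ k) \<le> 1 * norm X ^ k"
      unfolding norm_scaleR
      by (intro mult_mono norm_power_ineq)
        (auto simp: inv_sqrt_coeff_nonneg inv_sqrt_coeff_le_1)
    then show ?thesis by simp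
  qed
qed

text \<open>
  The Cauchy product of the series with itself is the geometric series, because its coefficients
  convolve to 1.
\<close>

lemma inv_sqrt_series_squared:
  "(\<Sum>k. inv_sqrt_coeff k *\<^sub>R X ^ k) * (\<Sum>k. inv_sqrt_coeff k *\<^sub>R X ^ k) * (1 - X) = 1"
proof -
  let ?c = "\<lambda>k. inv_sqrt_coeff k *\<^sub>R X ^ k"
  have "(\<Sum>i\<le>k. ?c i * ?c (k - i)) = X ^ k" for k
  proof -
    have "(\<Sum>i\<le>k. ?c i * ?c (k - i)) = (\<Sum>i\<le>k. (inv_sqrt_coeff i * inv_sqrt_coeff (k - i)) *\<^sub>R X ^ k)"
      by (intro sum.cong refl) (simp add: power_add[symmetric])
    then show ?thesis
      by (simp add: scaleR_sum_left[symmetric] inv_sqrt_coeff_convolution)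
  qed
  then have geo: "(\<lambda>k. X ^ k) sums (suminf ?c * suminf ?c)"
    using Cauchy_product_sums[OF inv_sqrt_series_summable_norm inv_sqrt_series_summable_norm] by simp
  have "(\<lambda>n. (\<Sum>k<n. X ^ k) * (1 - X)) \<longlonglongrightarrow> suminf ?c * suminf ?c * (1 - X)"
    using geo unfolding sums_def by (intro tendsto_intros)
  moreover have "(\<Sum>k<n. X ^ k) * (1 - X) = 1 - X ^ n" for n
  proof (induction n)
    case (Suc n)
    have "(\<Sum>k<Suc n. X ^ k) * (1 - X) = (\<Sum>k<n. X ^ k) * (1 - X) + X ^ n * (1 - X)"
      by (simp only: sum.lessThan_Suc distrib_right)
    then show ?case
      unfolding Suc by (simp add: right_diff_distrib power_commutes)
  qed simp
  moreover have "(\<lambda>n. 1 - X ^ n) \<longlonglongrightarrow> 1 - 0"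
    by (intro tendsto_intros LIMSEQ_power_zero X)
  ultimately show ?thesis
    using LIMSEQ_unique by fastforce
qed

end

definition shift_op :: "'a::{real_normed_vector, perfect_space} endo \<Rightarrow> real \<Rightarrow> 'a endo" where
  "shift_op T x = T - x *\<^sub>R 1"

definition norm_scale :: "'a::{real_normed_vector, perfect_space} endo \<Rightarrow> real \<Rightarrow> real" where
  "norm_scale T x = norm T + \<bar>x\<bar> + 1"

text \<open>
  The argument of the binomial series.  Dividing by a bound for the norm of \<open>T - x\<close> makes it
  non-negative, and of norm less than 1 when \<open>T - x\<close> is bounded below.
\<close>

definition scaled_defect :: "'a::{real_normed_vector, perfect_space} endo \<Rightarrow> real \<Rightarrow> 'a endo" where
  "scaled_defect T x = 1 - (1 / (norm_scale T x)\<^sup>2) *\<^sub>R (shift_op T x * shift_op T x)"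

definition abs_resolvent_sum :: "'a::{banach, perfect_space} endo \<Rightarrow> real \<Rightarrow> nat \<Rightarrow> 'a endo" where
  "abs_resolvent_sum T x n
     = (1 / norm_scale T x) *\<^sub>R (\<Sum>k<n. inv_sqrt_coeff k *\<^sub>R scaled_defect T x ^ k)"

text \<open>
  The operator \<open>\<bar>T - x\<bar>\<^sup>-\<^sup>1\<close>: with \<open>K\<close> the scale, \<open>\<bar>T - x\<bar>\<close> is \<open>K\<close> times the square root
  of \<open>1\<close> minus the scaled defect.
\<close>

definition abs_resolvent :: "'a::{banach, perfect_space} endo \<Rightarrow> real \<Rightarrow> 'a endo" where
  "abs_resolvent T x
     = (1 / norm_scale T x) *\<^sub>R (\<Sum>k. inv_sqrt_coeff k *\<^sub>R scaled_defect T x ^ k)"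

definition sign_op :: "'a::{banach, perfect_space} endo \<Rightarrow> real \<Rightarrow> 'a endo" where
  "sign_op T x = shift_op T x * abs_resolvent T x"

definition bounded_below :: "'a::real_normed_vector endo \<Rightarrow> bool" where
  "bounded_below A \<longleftrightarrow> (\<exists>\<eta>>0. \<forall>u. \<eta> * norm u \<le> norm (A \<cdot> u))"

lemma shift_op_apply [simp]: "shift_op T x \<cdot> u = T \<cdot> u - x *\<^sub>R u"
  by (simp add: shift_op_def)

lemma norm_scale_pos [simp]: "0 < norm_scale T x"
  by (simp add: norm_scale_def add_nonneg_pos)

lemma norm_scale_nonzero [simp]: "norm_scale T x \<noteq> 0"
  by (metis norm_scale_pos less_irrefl)

lemma norm_shift_op_le: "norm (shift_op T x) \<le> norm_scale T x"
proof -
  have "norm (shift_op T x) \<le> norm T + norm (x *\<^sub>R (1 :: 'a endo))"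
    unfolding shift_op_def by (rule norm_triangle_ineq4)
  then show ?thesis by (simp add: norm_scale_def)
qed

lemma symmetric_shift_op: "symmetric_op T \<Longrightarrow> symmetric_op (shift_op T x)"
  unfolding shift_op_def by (intro symmetric_op_diff symmetric_op_scaleR symmetric_op_one)

lemma shift_op_commute: "A * T = T * A \<Longrightarrow> A * shift_op T x = shift_op T x * A"
  by (simp add: shift_op_def algebra_simps)

lemma scaled_defect_commute: "A * T = T * A \<Longrightarrow> A * scaled_defect T x = scaled_defect T x * A"
  using shift_op_commute[of A T x]
  by (simp add: scaled_defect_def algebra_simps) (metis mult.assoc)

lemma abs_resolvent_sum_commute:
  assumes "A * T = T * A"
  shows "A * abs_resolvent_sum T x n = abs_resolvent_sum T x n * A"
proof -
  have "A * scaled_defect T x ^ k = scaled_defect T x ^ k * A" for k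
    using power_commuting_commutes[of "scaled_defect T x" A k] scaled_defect_commute[OF assms, of x]
    by metis
  then show ?thesis
    by (simp add: abs_resolvent_sum_def sum_distrib_left sum_distrib_right)
qed

context
  fixes T :: "'a::{real_inner, banach, perfect_space} endo" and x :: real
  assumes T: "symmetric_op T"
begin

lemma symmetric_scaled_defect: "symmetric_op (scaled_defect T x)"
  unfolding scaled_defect_def
  by (intro symmetric_op_diff symmetric_op_scaleR symmetric_op_one symmetric_op_mult
      symmetric_shift_op T refl)

lemma scaled_defect_form:
  "(scaled_defect T x \<cdot> u) \<bullet> u = (norm u)\<^sup>2 - (norm (shift_op T x \<cdot> u))\<^sup>2 / (norm_scale T x)\<^sup>2"
proof -
  have "(shift_op T x \<cdot> shift_op T x \<cdot> u) \<bullet> u = (norm (shift_op T x \<cdot> u))\<^sup>2"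
    using symmetric_opD[OF symmetric_shift_op[OF T], of x "shift_op T x \<cdot> u" u]
    by (simp only: power2_norm_eq_inner)
  then show ?thesis
    by (simp only: scaled_defect_def endo_apply_simps endo_apply_mult inner_diff_left inner_scaleR_left
        power2_norm_eq_inner) simp
qed

lemma scaled_defect_nonneg: "0 \<le> (scaled_defect T x \<cdot> u) \<bullet> u"
proof -
  have "norm (shift_op T x \<cdot> u) \<le> norm_scale T x * norm u"
    using norm_endo_apply[of "shift_op T x" u] norm_shift_op_le[of T x]
    by (meson mult_right_mono norm_ge_zero order_trans)
  then have "(norm (shift_op T x \<cdot> u))\<^sup>2 \<le> (norm_scale T x)\<^sup>2 * (norm u)\<^sup>2"
    unfolding power_mult_distrib[symmetric] by (intro power_mono) auto
  then show ?thesis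
    unfolding scaled_defect_form diff_ge_0_iff_ge
    by (subst pos_divide_le_eq) (auto simp: mult.commute intro!: zero_less_power)
qed

text \<open>Even powers are squares; in odd ones a single factor is left between two equal powers.\<close>

lemma scaled_defect_power_nonneg: "0 \<le> (scaled_defect T x ^ k \<cdot> u) \<bullet> u"
proof (induction k arbitrary: u rule: nat_induct2)
  case (step k)
  have "scaled_defect T x ^ (k + 2) = scaled_defect T x * (scaled_defect T x ^ k * scaled_defect T x)"
    by (simp add: power_commutes)
  then have "(scaled_defect T x ^ (k + 2) \<cdot> u) \<bullet> u
      = (scaled_defect T x ^ k \<cdot> scaled_defect T x \<cdot> u) \<bullet> (scaled_defect T x \<cdot> u)"
    by (simp add: symmetric_opD[OF symmetric_scaled_defect])
  then show ?case using step by metis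
qed (auto simp: scaled_defect_nonneg)

lemma symmetric_abs_resolvent_sum: "symmetric_op (abs_resolvent_sum T x n)"
  unfolding abs_resolvent_sum_def
  by (intro symmetric_op_scaleR symmetric_op_sum symmetric_op_power symmetric_scaled_defect)

lemma abs_resolvent_sum_nonneg: "0 \<le> (abs_resolvent_sum T x n \<cdot> u) \<bullet> u"
proof -
  have "(\<Sum>k<n. inv_sqrt_coeff k *\<^sub>R scaled_defect T x ^ k) \<cdot> u
      = (\<Sum>k<n. inv_sqrt_coeff k *\<^sub>R (scaled_defect T x ^ k \<cdot> u))"
    by (induction n) auto
  then show ?thesis
    by (simp add: abs_resolvent_sum_def inner_sum_left sum_nonneg inv_sqrt_coeff_nonneg
        scaled_defect_power_nonneg less_imp_le)
qed

end

context
  fixes T :: "'a::{real_inner, banach, perfect_space} endo" and x :: real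
  assumes T: "symmetric_op T" and below: "bounded_below (shift_op T x)"
begin

text \<open>
  With \<open>X = 1 - M\<^sup>2 / K\<^sup>2\<close>, expanding the square gives \<open>\<parallel>X u\<parallel>\<^sup>2 \<le> \<parallel>u\<parallel>\<^sup>2 - \<parallel>M u\<parallel>\<^sup>2 / K\<^sup>2\<close>, the
  term of fourth order being absorbed by \<open>\<parallel>M\<parallel> \<le> K\<close>.
\<close>

lemma norm_scaled_defect_less_1: "norm (scaled_defect T x) < 1"
proof -
  let ?M = "shift_op T x" and ?K = "norm_scale T x"
  obtain \<eta> where \<eta>: "\<eta> > 0" "\<And>u. \<eta> * norm u \<le> norm (?M \<cdot> u)"
    using below unfolding bounded_below_def by blast
  define q where "q = 1 - \<eta>\<^sup>2 / ?K\<^sup>2"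
  have *: "(norm (scaled_defect T x \<cdot> u))\<^sup>2 \<le> q * (norm u)\<^sup>2" for u
  proof -
    have X: "scaled_defect T x \<cdot> u = u - (1 / ?K\<^sup>2) *\<^sub>R (?M \<cdot> ?M \<cdot> u)"
      by (simp only: scaled_defect_def endo_apply_simps endo_apply_mult)
    have "(norm (scaled_defect T x \<cdot> u))\<^sup>2
        = (norm u)\<^sup>2 - 2 / ?K\<^sup>2 * (norm (?M \<cdot> u))\<^sup>2 + (norm (?M \<cdot> ?M \<cdot> u))\<^sup>2 / ?K ^ 4"
    proof -
      have "u \<bullet> (?M \<cdot> ?M \<cdot> u) = (norm (?M \<cdot> u))\<^sup>2"
        using symmetric_opD[OF symmetric_shift_op[OF T], of x u "?M \<cdot> u"]
        by (simp only: power2_norm_eq_inner)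
      moreover have "(norm (u - c *\<^sub>R b))\<^sup>2 = (norm u)\<^sup>2 - 2 * c * (u \<bullet> b) + c\<^sup>2 * (norm b)\<^sup>2" for c b
      proof -
        have "(norm (u - c *\<^sub>R b))\<^sup>2 = u \<bullet> u - c * (u \<bullet> b) - (c * (b \<bullet> u) - c * (c * (b \<bullet> b)))"
          by (simp only: power2_norm_eq_inner inner_diff_left inner_diff_right inner_scaleR_left
              inner_scaleR_right right_diff_distrib)
        also have "b \<bullet> u = u \<bullet> b" by (rule inner_commute)
        finally show ?thesis
          by (simp add: power2_norm_eq_inner power2_eq_square[of c])
      qed
      moreover have "(1 / ?K\<^sup>2)\<^sup>2 = 1 / ?K ^ 4"
        by (simp add: power_divide flip: power_mult)
      ultimately show ?thesis
        unfolding X by simp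
    qed
    also have "norm (?M \<cdot> ?M \<cdot> u) \<le> ?K * norm (?M \<cdot> u)"
      using norm_endo_apply[of ?M "?M \<cdot> u"] norm_shift_op_le[of T x]
      by (meson mult_right_mono norm_ge_zero order_trans)
    then have "(norm (?M \<cdot> ?M \<cdot> u))\<^sup>2 \<le> ?K\<^sup>2 * (norm (?M \<cdot> u))\<^sup>2"
      unfolding power_mult_distrib[symmetric] by (intro power_mono) auto
    then have "(norm (?M \<cdot> ?M \<cdot> u))\<^sup>2 / ?K ^ 4 \<le> ?K\<^sup>2 * (norm (?M \<cdot> u))\<^sup>2 / ?K ^ 4"
      by (intro divide_right_mono) auto
    also have "?K\<^sup>2 * (norm (?M \<cdot> u))\<^sup>2 / ?K ^ 4 = 1 / ?K\<^sup>2 * (norm (?M \<cdot> u))\<^sup>2"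
      by (simp add: power4_eq_xxxx power2_eq_square)
    finally have "(norm (scaled_defect T x \<cdot> u))\<^sup>2 \<le> (norm u)\<^sup>2 - (norm (?M \<cdot> u))\<^sup>2 / ?K\<^sup>2"
      by simp
    also have "(\<eta> * norm u)\<^sup>2 \<le> (norm (?M \<cdot> u))\<^sup>2"
      using \<eta> by (intro power_mono) auto
    then have "(norm u)\<^sup>2 - (norm (?M \<cdot> u))\<^sup>2 / ?K\<^sup>2 \<le> (norm u)\<^sup>2 - (\<eta> * norm u)\<^sup>2 / ?K\<^sup>2"
      by (intro diff_left_mono divide_right_mono) auto
    also have "\<dots> = q * (norm u)\<^sup>2"
      by (simp add: q_def field_simps power_mult_distrib)
    finally show ?thesis .
  qed
  have "\<exists>u::'a. u \<noteq> 0"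
    using UNIV_not_singleton[of "0::'a"] by auto
  then obtain u :: 'a where "u \<noteq> 0" by blast
  then have "0 \<le> q * (norm u)\<^sup>2" "(norm u)\<^sup>2 > 0"
    using *[of u] by (auto intro: order_trans[OF zero_le_power2])
  then have q: "0 \<le> q" "q < 1"
    using \<eta>(1) by (auto simp: q_def zero_le_mult_iff)
  have "norm (scaled_defect T x) \<le> sqrt q"
  proof (rule norm_endo_bound)
    show "norm (scaled_defect T x \<cdot> u) \<le> sqrt q * norm u" for u
    proof (rule power2_le_imp_le)
      show "(norm (scaled_defect T x \<cdot> u))\<^sup>2 \<le> (sqrt q * norm u)\<^sup>2"
        using *[of u] q by (simp add: power_mult_distrib)
    qed (use q in auto)
  qed (use q in auto)
  also have "\<dots> < 1" using q by simp
  finally show ?thesis .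
qed

lemma abs_resolvent_sum_tendsto: "abs_resolvent_sum T x \<longlonglongrightarrow> abs_resolvent T x"
  unfolding abs_resolvent_sum_def abs_resolvent_def
  by (intro tendsto_intros summable_LIMSEQ summable_norm_cancel[OF inv_sqrt_series_summable_norm]
      norm_scaled_defect_less_1)

lemma symmetric_abs_resolvent: "symmetric_op (abs_resolvent T x)"
  using abs_resolvent_sum_tendsto symmetric_abs_resolvent_sum[OF T] by (rule symmetric_op_limit)

lemma abs_resolvent_form_tendsto:
  "(\<lambda>n. (abs_resolvent_sum T x n \<cdot> u) \<bullet> v) \<longlonglongrightarrow> (abs_resolvent T x \<cdot> u) \<bullet> v"
  by (intro tendsto_intros bounded_linear.tendsto[OF bounded_linear_endo_apply_left]
      abs_resolvent_sum_tendsto)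

lemma abs_resolvent_nonneg: "0 \<le> (abs_resolvent T x \<cdot> u) \<bullet> u"
  by (rule tendsto_lowerbound[OF abs_resolvent_form_tendsto])
    (auto intro!: always_eventually abs_resolvent_sum_nonneg[OF T])

lemma abs_resolvent_commute:
  assumes "A * T = T * A"
  shows "A * abs_resolvent T x = abs_resolvent T x * A"
proof -
  have "(\<lambda>n. A * abs_resolvent_sum T x n) \<longlonglongrightarrow> A * abs_resolvent T x"
    "(\<lambda>n. abs_resolvent_sum T x n * A) \<longlonglongrightarrow> abs_resolvent T x * A"
    by (intro tendsto_intros abs_resolvent_sum_tendsto)+
  then show ?thesis
    using LIMSEQ_unique abs_resolvent_sum_commute[OF assms] by fastforce
qed

lemma shift_abs_resolvent_commute: "shift_op T x * abs_resolvent T x = abs_resolvent T x * shift_op T x"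
  by (rule abs_resolvent_commute) (simp add: shift_op_commute)

lemma abs_resolvent_squared:
  "abs_resolvent T x * abs_resolvent T x * (shift_op T x * shift_op T x) = 1"
proof -
  let ?C = "\<Sum>k. inv_sqrt_coeff k *\<^sub>R scaled_defect T x ^ k" and ?K = "norm_scale T x"
  have "?C * ?C * (1 - scaled_defect T x) = 1"
    using norm_scaled_defect_less_1 by (rule inv_sqrt_series_squared)
  moreover have "1 - scaled_defect T x = (1 / ?K\<^sup>2) *\<^sub>R (shift_op T x * shift_op T x)"
    by (simp add: scaled_defect_def)
  ultimately show ?thesis
    by (simp add: abs_resolvent_def power2_eq_square)
qed

lemma sign_op_squared: "sign_op T x * sign_op T x = 1"
proof -
  have "sign_op T x * sign_op T x
      = abs_resolvent T x * abs_resolvent T x * (shift_op T x * shift_op T x)"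
    unfolding sign_op_def using shift_abs_resolvent_commute by (metis mult.assoc)
  then show ?thesis by (simp only: abs_resolvent_squared)
qed

lemma sign_op_involution [simp]: "sign_op T x \<cdot> sign_op T x \<cdot> u = u"
  using sign_op_squared endo_apply_mult by metis

lemma symmetric_sign_op: "symmetric_op (sign_op T x)"
  unfolding sign_op_def
  by (intro symmetric_op_mult symmetric_shift_op symmetric_abs_resolvent T shift_abs_resolvent_commute)

lemma sign_op_commute:
  assumes "A * T = T * A"
  shows "A * sign_op T x = sign_op T x * A"
  unfolding sign_op_def
  using abs_resolvent_commute[OF assms] shift_op_commute[OF assms, of x] by (metis mult.assoc)

lemma norm_sign_op: "norm (sign_op T x \<cdot> u) = norm u"
proof -
  have "(sign_op T x \<cdot> u) \<bullet> (sign_op T x \<cdot> u) = u \<bullet> u"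
    by (simp add: symmetric_opD[OF symmetric_sign_op])
  then show ?thesis by (simp add: norm_eq_sqrt_inner)
qed

text \<open>
  The inverse of \<open>T - x\<close> is the sign of \<open>T - x\<close> times the inverse of its absolute value, so a
  symmetric operator that is bounded below is automatically onto.
\<close>

lemma shift_op_right_inverse:
  "shift_op T x * (sign_op T x * abs_resolvent T x) = 1"
proof -
  have "shift_op T x * (sign_op T x * abs_resolvent T x)
      = abs_resolvent T x * abs_resolvent T x * (shift_op T x * shift_op T x)"
    unfolding sign_op_def using shift_abs_resolvent_commute by (metis mult.assoc)
  then show ?thesis by (simp only: abs_resolvent_squared)
qed

lemma abs_resolvent_Cauchy_Schwarz:
  "((abs_resolvent T x \<cdot> u) \<bullet> v)\<^sup>2 \<le> ((abs_resolvent T x \<cdot> u) \<bullet> u) * ((abs_resolvent T x \<cdot> v) \<bullet> v)"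
proof -
  let ?R = "abs_resolvent T x"
  have sym: "(?R \<cdot> v) \<bullet> u = (?R \<cdot> u) \<bullet> v"
    by (metis symmetric_opD[OF symmetric_abs_resolvent] inner_commute)
  have quad: "0 \<le> ((?R \<cdot> u) \<bullet> u) + 2 * r * ((?R \<cdot> u) \<bullet> v) + r\<^sup>2 * ((?R \<cdot> v) \<bullet> v)" for r
    using abs_resolvent_nonneg[of "u + r *\<^sub>R v"]
    by (simp add: inner_add_left inner_add_right sym algebra_simps power2_eq_square)
  show ?thesis
  proof (cases "(?R \<cdot> v) \<bullet> v = 0")
    case True
    have "(?R \<cdot> u) \<bullet> v = 0"
    proof (rule ccontr)
      assume nz: "(?R \<cdot> u) \<bullet> v \<noteq> 0"
      show False
        using quad[of "- ((?R \<cdot> u) \<bullet> u + 1) / (2 * ((?R \<cdot> u) \<bullet> v))"] nz True by (simp add: field_simps)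
    qed
    then show ?thesis using True by simp
  next
    case False
    then have "(?R \<cdot> v) \<bullet> v > 0" using abs_resolvent_nonneg[of v] by simp
    then show ?thesis
      using quad[of "- ((?R \<cdot> u) \<bullet> v) / ((?R \<cdot> v) \<bullet> v)"]
      by (simp add: field_simps power2_eq_square)
  qed
qed

text \<open>
  The product of \<open>T - x\<close> with its sign is \<open>\<bar>T - x\<bar>\<close>, whose inverse has norm at most \<open>1 / \<eta>\<close>.
  The bound on the norm becomes one on the form through Cauchy-Schwarz for the form of
  \<open>\<bar>T - x\<bar>\<^sup>-\<^sup>1\<close>, taken at \<open>w = (T - x) u\<close>.
\<close>

lemma sign_op_form_ge:
  assumes \<eta>: "\<eta> > 0" "\<And>u. \<eta> * norm u \<le> norm (shift_op T x \<cdot> u)"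
  shows "\<eta> * (norm u)\<^sup>2 \<le> (shift_op T x \<cdot> sign_op T x \<cdot> u) \<bullet> u"
proof -
  let ?R = "abs_resolvent T x" and ?M = "shift_op T x"
  have bound: "norm (?R \<cdot> v) \<le> norm v / \<eta>" for v
  proof -
    have "?M \<cdot> ?R \<cdot> v = sign_op T x \<cdot> v" by (simp add: sign_op_def)
    then have "\<eta> * norm (?R \<cdot> v) \<le> norm v"
      using \<eta>(2)[of "?R \<cdot> v"] norm_sign_op[of v] by simp
    then show ?thesis using \<eta>(1) by (simp add: field_simps)
  qed
  define w where "w = ?M \<cdot> u"
  have Rw: "?R \<cdot> w = sign_op T x \<cdot> u"
    unfolding w_def sign_op_def using shift_abs_resolvent_commute endo_apply_mult by metis
  have q: "(?M \<cdot> sign_op T x \<cdot> u) \<bullet> u = (?R \<cdot> w) \<bullet> w"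
    using symmetric_opD[OF symmetric_shift_op[OF T], of x "sign_op T x \<cdot> u" u]
    by (simp only: Rw w_def[symmetric])
  have n: "norm (?R \<cdot> w) = norm u"
    unfolding Rw by (rule norm_sign_op)
  have "((norm u)\<^sup>2)\<^sup>2 = ((?R \<cdot> w) \<bullet> (?R \<cdot> w))\<^sup>2"
    by (simp add: n flip: power2_norm_eq_inner)
  also have "\<dots> \<le> ((?R \<cdot> w) \<bullet> w) * ((?R \<cdot> ?R \<cdot> w) \<bullet> (?R \<cdot> w))"
    by (rule abs_resolvent_Cauchy_Schwarz)
  also have "(?R \<cdot> ?R \<cdot> w) \<bullet> (?R \<cdot> w) \<le> (norm u)\<^sup>2 / \<eta>"
  proof -
    have "(?R \<cdot> ?R \<cdot> w) \<bullet> (?R \<cdot> w) \<le> norm (?R \<cdot> ?R \<cdot> w) * norm (?R \<cdot> w)"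
      by (rule norm_cauchy_schwarz)
    also have "\<dots> \<le> norm u / \<eta> * norm u"
      using bound[of "?R \<cdot> w"] n \<eta>(1) by (intro mult_mono) auto
    finally show ?thesis by (simp add: power2_eq_square)
  qed
  finally have *: "((norm u)\<^sup>2)\<^sup>2 \<le> ((?R \<cdot> w) \<bullet> w) * ((norm u)\<^sup>2 / \<eta>)"
    using abs_resolvent_nonneg[of w] by (simp add: mult_left_mono)
  show ?thesis
  proof (cases "u = 0")
    case False
    then have "(norm u)\<^sup>2 > 0" by simp
    moreover have "(norm u)\<^sup>2 * (norm u)\<^sup>2 \<le> ((?R \<cdot> w) \<bullet> w) / \<eta> * (norm u)\<^sup>2"
      using * unfolding power2_eq_square[of "(norm u)\<^sup>2"] by simp
    ultimately have "(norm u)\<^sup>2 \<le> ((?R \<cdot> w) \<bullet> w) / \<eta>"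
      by (rule mult_right_le_imp_le[rotated])
    then show ?thesis using \<eta>(1) q by (simp add: field_simps)
  qed (simp)
qed

end

text \<open>
  For \<open>\<epsilon> = 1\<close>: a unit vector in the positive subspace at \<open>x\<close> and in the negative subspace at \<open>y\<close>
  would have \<open>T\<close>-form at least \<open>x + \<eta>\<close> and at most \<open>y\<close>.  For \<open>\<epsilon> = -1\<close> the inequalities are
  reversed.
\<close>

lemma sign_op_opposite_zero:
  fixes T :: "'a::{real_inner, banach, perfect_space} endo"
  assumes T: "symmetric_op T"
    and \<eta>: "\<eta> > 0" "\<And>u. \<eta> * norm u \<le> norm (shift_op T x \<cdot> u)"
    and y: "bounded_below (shift_op T y)" and near: "\<bar>y - x\<bar> < \<eta>"
    and \<epsilon>: "\<bar>\<epsilon>\<bar> = 1" and w: "sign_op T x \<cdot> w = \<epsilon> *\<^sub>R w" "sign_op T y \<cdot> w = (- \<epsilon>) *\<^sub>R w"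
  shows "w = 0"
proof -
  have x: "bounded_below (shift_op T x)"
    using \<eta> by (auto simp: bounded_below_def)
  obtain \<eta>' where \<eta>': "\<eta>' > 0" "\<And>u. \<eta>' * norm u \<le> norm (shift_op T y \<cdot> u)"
    using y by (auto simp: bounded_below_def)
  have "\<eta> * (norm w)\<^sup>2 \<le> \<epsilon> * ((T \<cdot> w) \<bullet> w - x * (norm w)\<^sup>2)"
    using sign_op_form_ge[OF T x \<eta>, of w] w
    by (simp add: inner_diff_left power2_norm_eq_inner algebra_simps)
  moreover have "\<eta>' * (norm w)\<^sup>2 \<le> - \<epsilon> * ((T \<cdot> w) \<bullet> w - y * (norm w)\<^sup>2)"
    using sign_op_form_ge[OF T y \<eta>', of w] w
    by (simp add: inner_diff_left power2_norm_eq_inner algebra_simps)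
  then have "0 \<le> - \<epsilon> * ((T \<cdot> w) \<bullet> w - y * (norm w)\<^sup>2)"
    using \<eta>'(1) by (meson mult_nonneg_nonneg less_imp_le order_trans zero_le_power2)
  ultimately have "\<eta> * (norm w)\<^sup>2 \<le> \<epsilon> * (y - x) * (norm w)\<^sup>2"
    by (simp add: algebra_simps)
  moreover have "\<epsilon> * (y - x) < \<eta>"
    using near \<epsilon> by (auto simp: abs_if split: if_splits)
  ultimately have "(norm w)\<^sup>2 \<le> 0"
    by (metis mult_le_cancel_right not_le)
  then show ?thesis by simp
qed

lemma sign_op_locally_constant:
  fixes T :: "'a::{real_inner, banach, perfect_space} endo"
  assumes T: "symmetric_op T"
    and \<eta>: "\<eta> > 0" "\<And>u. \<eta> * norm u \<le> norm (shift_op T x \<cdot> u)"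
    and y: "bounded_below (shift_op T y)" and near: "\<bar>y - x\<bar> < \<eta>"
  shows "sign_op T x = sign_op T y"
proof (rule endo_eqI)
  fix u
  let ?S = "sign_op T x" and ?S' = "sign_op T y"
  have x: "bounded_below (shift_op T x)"
    using \<eta> by (auto simp: bounded_below_def)
  have "T * ?S' = ?S' * T"
    by (rule sign_op_commute[OF T y]) simp
  then have "?S' * ?S = ?S * ?S'"
    by (intro sign_op_commute[OF T x]) simp
  then have comm: "?S' \<cdot> ?S \<cdot> v = ?S \<cdot> ?S' \<cdot> v" for v
    using endo_apply_mult(1) by metis
  \<comment> \<open>These are \<open>(1 + S) (1 - S') u\<close> and \<open>(1 - S) (1 + S') u\<close>, where the two signs are opposite.\<close>
  have "u + ?S \<cdot> u - ?S' \<cdot> u - ?S \<cdot> ?S' \<cdot> u = 0"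
    by (rule sign_op_opposite_zero[OF T \<eta> y near, of 1])
      (simp_all add: comm sign_op_involution[OF T x] sign_op_involution[OF T y])
  moreover have "u - ?S \<cdot> u + ?S' \<cdot> u - ?S \<cdot> ?S' \<cdot> u = 0"
    by (rule sign_op_opposite_zero[OF T \<eta> y near, of "-1"])
      (simp_all add: comm sign_op_involution[OF T x] sign_op_involution[OF T y])
  moreover have "2 *\<^sub>R (?S \<cdot> u - ?S' \<cdot> u) = (u + ?S \<cdot> u - ?S' \<cdot> u - ?S \<cdot> ?S' \<cdot> u)
      - (u - ?S \<cdot> u + ?S' \<cdot> u - ?S \<cdot> ?S' \<cdot> u)"
    by (simp add: scaleR_2)
  ultimately have "2 *\<^sub>R (?S \<cdot> u - ?S' \<cdot> u) = 0"
    by simp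
  then show "?S \<cdot> u = ?S' \<cdot> u" by simp
qed

lemma sign_op_constant_on_connected:
  fixes T :: "'a::{real_inner, banach, perfect_space} endo"
  assumes T: "symmetric_op T" and G: "connected G" "\<And>x. x \<in> G \<Longrightarrow> bounded_below (shift_op T x)"
    and "x \<in> G" "y \<in> G"
  shows "sign_op T x = sign_op T y"
proof (rule connected_local_const[where f = "sign_op T", OF G(1) \<open>x \<in> G\<close> \<open>y \<in> G\<close>], rule ballI)
  fix x assume "x \<in> G"
  then obtain \<eta> where \<eta>: "\<eta> > 0" "\<And>u. \<eta> * norm u \<le> norm (shift_op T x \<cdot> u)"
    using G(2) unfolding bounded_below_def by blast
  then show "\<forall>\<^sub>F y in at x within G. sign_op T x = sign_op T y"
    unfolding eventually_at using sign_op_locally_constant[OF T \<eta> G(2)]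
    by (intro exI[of _ \<eta>]) (auto simp: dist_real_def)
qed


section \<open>Polynomials in an operator\<close>

text \<open>
  Generating the operator and the real function side by side lets rule induction compare their
  diagonal matrix entries and integrals.
\<close>

inductive poly_value :: "'a::{real_normed_vector, perfect_space} endo \<Rightarrow> 'a endo \<Rightarrow> (real \<Rightarrow> real) \<Rightarrow> bool"
  for T where
  const: "poly_value T (c *\<^sub>R 1) (\<lambda>_. c)"
| shift: "poly_value T A f \<Longrightarrow> poly_value T (T * A) (\<lambda>t. t * f t)"
| add: "poly_value T A f \<Longrightarrow> poly_value T B g \<Longrightarrow> poly_value T (A + B) (\<lambda>t. f t + g t)"

lemma poly_value_commute: "poly_value T A f \<Longrightarrow> T * A = A * T"
proof (induction rule: poly_value.induct)
  case (shift A f)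
  then show ?case by (metis mult.assoc)
qed (auto simp: algebra_simps)

lemma poly_value_scaleR: "poly_value T A f \<Longrightarrow> poly_value T (c *\<^sub>R A) (\<lambda>t. c * f t)"
proof (induction rule: poly_value.induct)
  case (const d)
  then show ?case using poly_value.const[of T "c * d"] by simp
next
  case (shift A f)
  then show ?case using poly_value.shift[OF shift(2)] by (simp add: mult.left_commute)
next
  case (add A f B g)
  then show ?case using poly_value.add[OF add(3,4)] by (simp add: distrib_left scaleR_add_right)
qed

lemma poly_value_mult: "poly_value T A f \<Longrightarrow> poly_value T B g \<Longrightarrow> poly_value T (A * B) (\<lambda>t. f t * g t)"
proof (induction rule: poly_value.induct)
  case (const c)
  then show ?case using poly_value_scaleR[OF const] by simp
next
  case (shift A f)
  then show ?case using poly_value.shift[OF shift(2)[OF shift(3)]] by (simp add: mult.assoc)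
next
  case (add A f A' f')
  then show ?case using poly_value.add[OF add(3,4)[OF add(5)]] by (simp add: distrib_right)
qed

lemma poly_value_power: "poly_value T A f \<Longrightarrow> poly_value T (A ^ k) (\<lambda>t. f t ^ k)"
proof (induction k)
  case 0
  then show ?case using poly_value.const[of T 1] by simp
qed (simp add: poly_value_mult)

lemma poly_value_sum_lessThan:
  "(\<And>k. poly_value T (A k) (f k)) \<Longrightarrow> poly_value T (\<Sum>k<n. A k) (\<lambda>t. \<Sum>k<(n::nat). f k t)"
proof (induction n)
  case 0
  then show ?case using poly_value.const[of T 0] by simp
qed (simp add: poly_value.add)

definition abs_resolvent_poly :: "'a::{banach, perfect_space} endo \<Rightarrow> real \<Rightarrow> nat \<Rightarrow> real \<Rightarrow> real" where
  "abs_resolvent_poly T x n t = 1 / norm_scale T x *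
     (\<Sum>k<n. inv_sqrt_coeff k * (1 + (- (1 / (norm_scale T x)\<^sup>2)) * ((t + (- x)) * (t + (- x)))) ^ k)"

lemma poly_value_abs_resolvent_sum:
  "poly_value T (abs_resolvent_sum T x n) (abs_resolvent_poly T x n)"
proof -
  let ?K = "norm_scale T x"
  have "poly_value T (T * (1 *\<^sub>R 1)) (\<lambda>t. t * 1)"
    by (intro poly_value.shift poly_value.const)
  then have T: "poly_value T T (\<lambda>t. t)" by simp
  have M: "poly_value T (shift_op T x) (\<lambda>t. t + (- x))"
    using poly_value.add[OF T poly_value.const[of T "- x"]] by (simp add: shift_op_def)
  have "poly_value T (1 *\<^sub>R 1 + (- (1 / ?K\<^sup>2)) *\<^sub>R (shift_op T x * shift_op T x))
     (\<lambda>t. 1 + (- (1 / ?K\<^sup>2)) * ((t + (- x)) * (t + (- x))))"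
    by (intro poly_value.add poly_value.const poly_value_scaleR poly_value_mult M)
  then have "poly_value T (scaled_defect T x) (\<lambda>t. 1 + (- (1 / ?K\<^sup>2)) * ((t + (- x)) * (t + (- x))))"
    by (simp add: scaled_defect_def)
  then show ?thesis
    unfolding abs_resolvent_sum_def abs_resolvent_poly_def[abs_def]
    by (intro poly_value_scaleR poly_value_sum_lessThan poly_value_power)
qed

text \<open>
  The coefficients of the binomial series are non-negative, so the polynomials stay below
  their limit.
\<close>

lemma abs_resolvent_poly_bounds:
  assumes "\<bar>t\<bar> \<le> norm T" "t \<noteq> x"
  shows "0 \<le> abs_resolvent_poly T x n t" "abs_resolvent_poly T x n t \<le> 1 / \<bar>t - x\<bar>"
proof -
  let ?K = "norm_scale T x"
  define y where "y = 1 - ((t - x) / ?K)\<^sup>2"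
  have y: "1 + (- (1 / ?K\<^sup>2)) * ((t + (- x)) * (t + (- x))) = y"
    by (simp add: y_def power_divide power2_eq_square)
  have "\<bar>(t - x) / ?K\<bar> \<le> 1"
    using assms(1) by (simp add: abs_divide norm_scale_def)
  then have "((t - x) / ?K)\<^sup>2 \<le> 1"
    by (simp add: abs_square_le_1)
  moreover have "((t - x) / ?K)\<^sup>2 > 0"
    using assms(2) by simp
  ultimately have y01: "0 \<le> y" "y < 1" by (auto simp: y_def)
  show "0 \<le> abs_resolvent_poly T x n t"
    unfolding abs_resolvent_poly_def y
    by (intro mult_nonneg_nonneg sum_nonneg inv_sqrt_coeff_nonneg zero_le_power y01)
      (simp add: less_imp_le)
  have "abs_resolvent_poly T x n t \<le> 1 / ?K * (1 / sqrt (1 - y))"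
    unfolding abs_resolvent_poly_def y
    by (intro mult_left_mono inv_sqrt_series_partial_sum_le y01) (simp add: less_imp_le)
  also have "sqrt (1 - y) = \<bar>t - x\<bar> / ?K"
    by (simp add: y_def real_sqrt_abs abs_divide less_imp_le)
  finally show "abs_resolvent_poly T x n t \<le> 1 / \<bar>t - x\<bar>" by simp
qed

section \<open>Counting eigenvalues in a gap\<close>

text \<open>
  A homogeneous linear system with more unknowns than equations has a non-trivial solution; the
  induction step is one step of Gaussian elimination with the pivot \<open>j\<close>.
\<close>

lemma common_kernel_combination:
  fixes \<phi> :: "'f \<Rightarrow> 'i \<Rightarrow> real"
  assumes "finite F" "finite I" "card F < card I"
  shows "\<exists>c. (\<exists>i\<in>I. c i \<noteq> 0) \<and> (\<forall>f\<in>F. (\<Sum>i\<in>I. c i * \<phi> f i) = 0)"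
  using assms
proof (induction F arbitrary: I \<phi> rule: finite_induct)
  case empty
  then obtain i where "i \<in> I" by fastforce
  then show ?case by (intro exI[of _ "\<lambda>_. 1"]) auto
next
  case (insert f F)
  show ?case
  proof (cases "\<forall>i\<in>I. \<phi> f i = 0")
    case True
    have "card F < card I" using insert by simp
    from insert.IH[OF insert.prems(1) this, of \<phi>] True show ?thesis by auto
  next
    case False
    then obtain j where j: "j \<in> I" "\<phi> f j \<noteq> 0" by blast
    let ?\<phi> = "\<lambda>g i. \<phi> g i - \<phi> g j * \<phi> f i / \<phi> f j"
    have "card F < card (I - {j})" using insert j by simp
    from insert.IH[OF _ this, of ?\<phi>] insert.prems(1)
    obtain c where c: "\<exists>i\<in>I - {j}. c i \<noteq> 0" "\<And>g. g \<in> F \<Longrightarrow> (\<Sum>i\<in>I - {j}. c i * ?\<phi> g i) = 0"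
      by auto
    define s where "s = (\<Sum>i\<in>I - {j}. c i * \<phi> f i) / \<phi> f j"
    let ?c = "\<lambda>i. if i = j then - s else c i"
    have split: "(\<Sum>i\<in>I. ?c i * \<phi> g i) = (\<Sum>i\<in>I - {j}. c i * \<phi> g i) - s * \<phi> g j" for g
      using j(1) insert.prems(1) by (subst sum.remove[of I j]) (auto intro!: sum.cong)
    have "(\<Sum>i\<in>I. ?c i * \<phi> g i) = 0" if "g \<in> insert f F" for g
    proof (cases "g = f")
      case True
      then show ?thesis unfolding split using j(2) by (simp add: s_def)
    next
      case False
      with that have "(\<Sum>i\<in>I - {j}. c i * ?\<phi> g i) = 0" using c(2) by blast
      also have "(\<Sum>i\<in>I - {j}. c i * ?\<phi> g i)
          = (\<Sum>i\<in>I - {j}. c i * \<phi> g i) - (\<Sum>i\<in>I - {j}. (c i * \<phi> f i) * (\<phi> g j / \<phi> f j))"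
        unfolding sum_subtractf[symmetric] by (intro sum.cong refl) (simp add: algebra_simps)
      also have "(\<Sum>i\<in>I - {j}. (c i * \<phi> f i) * (\<phi> g j / \<phi> f j)) = s * \<phi> g j"
        unfolding sum_distrib_right[symmetric] by (simp add: s_def)
      finally show ?thesis unfolding split .
    qed
    moreover have "\<exists>i\<in>I. ?c i \<noteq> 0" using c(1) by auto
    ultimately show ?thesis by (intro exI[of _ ?c]) blast
  qed
qed

text \<open>
  On the subspace where \<open>T - x\<close> has the sign \<open>\<epsilon>\<close>, the form of \<open>\<epsilon> (T - x)\<close> is that of
  \<open>\<bar>T - x\<bar>\<close>.
\<close>

definition form_orthonormal :: "'a::{real_inner, banach, perfect_space} endo \<Rightarrow> real \<Rightarrow> real \<Rightarrow> 'a set \<Rightarrow> bool" where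
  "form_orthonormal T x \<epsilon> B \<longleftrightarrow> finite B \<and> (\<forall>e\<in>B. sign_op T x \<cdot> e = \<epsilon> *\<^sub>R e) \<and>
     (\<forall>e\<in>B. \<forall>f\<in>B. \<epsilon> * ((shift_op T x \<cdot> e) \<bullet> f) = (if e = f then 1 else 0))"

context
  fixes T :: "'a::{real_inner, banach, perfect_space} endo" and x :: real
  assumes T: "symmetric_op T" and below: "bounded_below (shift_op T x)"
begin

lemma abs_form_nonneg: "0 \<le> (shift_op T x \<cdot> sign_op T x \<cdot> u) \<bullet> u"
  and abs_form_pos: "u \<noteq> 0 \<Longrightarrow> 0 < (shift_op T x \<cdot> sign_op T x \<cdot> u) \<bullet> u"
proof -
  obtain \<eta> where \<eta>: "\<eta> > 0" "\<And>u. \<eta> * norm u \<le> norm (shift_op T x \<cdot> u)"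
    using below unfolding bounded_below_def by blast
  note * = sign_op_form_ge[OF T below \<eta>, of u]
  show "0 \<le> (shift_op T x \<cdot> sign_op T x \<cdot> u) \<bullet> u"
    using * \<eta>(1) by (meson mult_nonneg_nonneg less_imp_le order_trans zero_le_power2)
  show "0 < (shift_op T x \<cdot> sign_op T x \<cdot> u) \<bullet> u" if "u \<noteq> 0"
    using * \<eta>(1) that by (smt (verit) mult_pos_pos zero_less_norm_iff zero_less_power)
qed

text \<open>
  Bessel's inequality for the form of \<open>\<bar>T - x\<bar>\<close>: the coefficient \<open>\<langle>w, e\<rangle>\<close> is the
  form evaluated at \<open>\<bar>T - x\<bar>\<^sup>-\<^sup>1 w\<close> and \<open>e\<close>.
\<close>

lemma form_Bessel:
  assumes B: "form_orthonormal T x \<epsilon> B"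
  shows "(\<Sum>e\<in>B. (w \<bullet> e)\<^sup>2) \<le> (abs_resolvent T x \<cdot> w) \<bullet> w"
proof -
  define A where "A = shift_op T x * sign_op T x"
  define g where "g = abs_resolvent T x \<cdot> w"
  define v where "v = (\<Sum>e\<in>B. (w \<bullet> e) *\<^sub>R e)"
  have fin: "finite B" and on: "\<And>e f. e \<in> B \<Longrightarrow> f \<in> B \<Longrightarrow> (A \<cdot> e) \<bullet> f = (if e = f then 1 else 0)"
    using B by (auto simp: A_def form_orthonormal_def simp del: shift_op_apply)
  have "shift_op T x * sign_op T x = sign_op T x * shift_op T x"
    by (rule sign_op_commute[OF T below]) (simp add: shift_op_def algebra_simps)
  then have sym: "symmetric_op A"
    unfolding A_def by (intro symmetric_op_mult symmetric_shift_op symmetric_sign_op T below)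
  have Ag: "A \<cdot> g = w"
    unfolding g_def A_def using shift_op_right_inverse[OF T below] endo_apply_mult by metis
  have vg: "v \<bullet> w = (\<Sum>e\<in>B. (w \<bullet> e)\<^sup>2)"
    unfolding v_def inner_sum_left
    by (intro sum.cong refl) (simp add: power2_eq_square inner_commute)
  have "(A \<cdot> v) \<bullet> v = (\<Sum>e\<in>B. (w \<bullet> e) * (\<Sum>f\<in>B. (w \<bullet> f) * ((A \<cdot> f) \<bullet> e)))"
    by (simp only: v_def endo_apply_sum endo_apply_simps inner_sum_left inner_sum_right
        inner_scaleR_left inner_scaleR_right)
  also have "\<dots> = (\<Sum>e\<in>B. (w \<bullet> e) * (\<Sum>f\<in>B. (w \<bullet> f) * (if f = e then 1 else 0)))"
    by (intro sum.cong refl arg_cong2[where f = "(*)"]) (simp_all only: on)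
  also have "\<dots> = (\<Sum>e\<in>B. (w \<bullet> e)\<^sup>2)"
    using fin by (simp add: if_distrib[of "\<lambda>z. _ * z"] power2_eq_square cong: if_cong)
  finally have vv: "(A \<cdot> v) \<bullet> v = (\<Sum>e\<in>B. (w \<bullet> e)\<^sup>2)" .
  have "0 \<le> (A \<cdot> (g - v)) \<bullet> (g - v)"
    using abs_form_nonneg[of "g - v"] by (simp only: A_def endo_apply_mult)
  also have "\<dots> = (A \<cdot> g) \<bullet> g - (A \<cdot> g) \<bullet> v - (A \<cdot> v) \<bullet> g + (A \<cdot> v) \<bullet> v"
    by (simp add: inner_diff_left inner_diff_right)
  also have "(A \<cdot> v) \<bullet> g = v \<bullet> (A \<cdot> g)"
    by (rule symmetric_opD[OF sym])
  finally have "0 \<le> w \<bullet> g - (\<Sum>e\<in>B. (w \<bullet> e)\<^sup>2)"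
    unfolding Ag vv using vg by (simp add: inner_commute[of w v])
  then show ?thesis by (simp add: g_def inner_commute)
qed

text \<open>
  Birman--Schwinger in variational form.  A family of largest cardinality among those with
  \<open>a e \<ge> 1\<close> cannot be extended, so \<open>a\<close> is strictly dominated by the form of
  \<open>\<bar>T - x\<bar>\<close> on its orthogonal complement.
\<close>

lemma exists_maximal_form_orthonormal:
  assumes \<epsilon>: "\<bar>\<epsilon>\<bar> = 1"
    and hom: "\<And>r u. a (r *\<^sub>R u) = r\<^sup>2 * a u"
    and trace: "\<And>B. form_orthonormal T x \<epsilon> B \<Longrightarrow> (\<Sum>e\<in>B. a e) \<le> \<tau>"
  obtains B where "form_orthonormal T x \<epsilon> B" "real (card B) \<le> \<tau>"
    "\<And>m. sign_op T x \<cdot> m = \<epsilon> *\<^sub>R m \<Longrightarrow> m \<noteq> 0 \<Longrightarrow> (\<forall>e\<in>B. (shift_op T x \<cdot> m) \<bullet> e = 0)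
        \<Longrightarrow> a m < \<epsilon> * ((shift_op T x \<cdot> m) \<bullet> m)"
proof -
  define P where "P B \<longleftrightarrow> form_orthonormal T x \<epsilon> B \<and> (\<forall>e\<in>B. 1 \<le> a e)" for B
  have card: "real (card B) \<le> \<tau>" if "P B" for B
  proof -
    have "real (card B) = (\<Sum>e\<in>B. 1)" by simp
    also have "\<dots> \<le> (\<Sum>e\<in>B. a e)" using that by (intro sum_mono) (auto simp: P_def)
    also have "\<dots> \<le> \<tau>" using trace that by (auto simp: P_def)
    finally show ?thesis .
  qed
  have "P {}" by (simp add: P_def form_orthonormal_def)
  moreover have "card B \<le> nat \<lfloor>\<tau>\<rfloor>" if "P B" for B
    using card[OF that] by linarith
  ultimately obtain B where B: "P B" and max: "\<And>B'. P B' \<Longrightarrow> card B' \<le> card B"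
    using ex_has_greatest_nat[of P "{}" card "Suc (nat \<lfloor>\<tau>\<rfloor>)"]
    by (auto simp: less_Suc_eq_le)
  show thesis
  proof (rule that)
    show B': "form_orthonormal T x \<epsilon> B" "real (card B) \<le> \<tau>"
      using B card by (auto simp: P_def)
    fix m
    assume m: "sign_op T x \<cdot> m = \<epsilon> *\<^sub>R m" "m \<noteq> 0" "\<forall>e\<in>B. (shift_op T x \<cdot> m) \<bullet> e = 0"
    show "a m < \<epsilon> * ((shift_op T x \<cdot> m) \<bullet> m)"
    proof (rule ccontr)
      define q where "q = \<epsilon> * ((shift_op T x \<cdot> m) \<bullet> m)"
      assume "\<not> ?thesis"
      then have am: "q \<le> a m" by (simp add: q_def)
      have "(shift_op T x \<cdot> sign_op T x \<cdot> m) \<bullet> m = q"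
        unfolding m(1) q_def by (simp add: inner_diff_left algebra_simps)
      then have q: "0 < q" using abs_form_pos[OF m(2)] by simp
      \<comment> \<open>Normalised in the form of \<open>\<bar>T - x\<bar>\<close>, \<open>m\<close> would enlarge the maximal family.\<close>
      define e where "e = (1 / sqrt q) *\<^sub>R m"
      have ee: "\<epsilon> * ((shift_op T x \<cdot> e) \<bullet> e) = 1"
      proof -
        have "\<epsilon> * ((shift_op T x \<cdot> e) \<bullet> e) = (1 / sqrt q) * (1 / sqrt q) * q"
          unfolding e_def q_def endo_apply_simps inner_scaleR_left inner_scaleR_right by simp
        then show ?thesis using q by simp
      qed
      have ef: "(shift_op T x \<cdot> e) \<bullet> f = 0" "(shift_op T x \<cdot> f) \<bullet> e = 0" if "f \<in> B" for f
      proof -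
        show "(shift_op T x \<cdot> e) \<bullet> f = 0"
          using m(3) that unfolding e_def endo_apply_simps inner_scaleR_left by simp
        then show "(shift_op T x \<cdot> f) \<bullet> e = 0"
          by (metis symmetric_opD[OF symmetric_shift_op[OF T]] inner_commute)
      qed
      have "e \<notin> B" using ef(1) ee by fastforce
      have "P (insert e B)"
        unfolding P_def form_orthonormal_def
      proof (intro conjI ballI)
        show "finite (insert e B)" using B' by (simp add: form_orthonormal_def)
        show "sign_op T x \<cdot> f = \<epsilon> *\<^sub>R f" if "f \<in> insert e B" for f
          using that B' m(1) by (auto simp: form_orthonormal_def e_def)
        show "1 \<le> a f" if "f \<in> insert e B" for f
        proof (cases "f = e")
          case True
          have "a e = a m / q" unfolding e_def hom using q by (simp add: power_divide)
          then show ?thesis using True am q by simp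
        next
          case False
          then show ?thesis using B that by (auto simp: P_def)
        qed
        show "\<epsilon> * ((shift_op T x \<cdot> f) \<bullet> g) = (if f = g then 1 else 0)"
          if fg: "f \<in> insert e B" "g \<in> insert e B" for f g
        proof -
          consider "f = e" "g = e" | "f = e" "g \<in> B" | "f \<in> B" "g = e" | "f \<in> B" "g \<in> B"
            using fg by blast
          then show ?thesis
          proof cases
            case 4
            then show ?thesis using B'(1) unfolding form_orthonormal_def by blast
          qed (use ee ef \<open>e \<notin> B\<close> in \<open>auto simp del: shift_op_apply\<close>)
        qed
      qed
      then have "card (insert e B) \<le> card B" by (rule max)
      then show False using \<open>e \<notin> B\<close> B' by (simp add: form_orthonormal_def)
    qed
  qed
qed

end

definition drop_span :: "'a::real_inner set \<Rightarrow> 'a \<Rightarrow> 'a" where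
  "drop_span U w = w - (\<Sum>u\<in>U. ((w \<bullet> u) / (u \<bullet> u)) *\<^sub>R u)"

lemma drop_span_add: "drop_span U (v + w) = drop_span U v + drop_span U w"
  by (simp add: drop_span_def inner_add_left add_divide_distrib scaleR_add_left sum.distrib)

context
  fixes U :: "'a::real_inner set"
  assumes U: "finite U" "0 \<notin> U" "pairwise orthogonal U"
begin

lemma inner_sum_orthogonal:
  assumes "u \<in> U"
  shows "(\<Sum>v\<in>U. k v *\<^sub>R v) \<bullet> u = k u * (u \<bullet> u)"
proof -
  have "(\<Sum>v\<in>U. k v *\<^sub>R v) \<bullet> u = (\<Sum>v\<in>U. if v = u then k u * (u \<bullet> u) else 0)"
    unfolding inner_sum_left
    by (intro sum.cong refl) (use U(3) assms in \<open>auto simp: pairwise_def orthogonal_def\<close>)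
  then show ?thesis using U(1) assms by simp
qed

lemma drop_span_orthogonal: "u \<in> U \<Longrightarrow> drop_span U w \<bullet> u = 0"
  using U(2) by (auto simp: drop_span_def inner_diff_left inner_sum_orthogonal)

lemma drop_span_combination: "drop_span U (\<Sum>u\<in>U. c u *\<^sub>R u) = 0"
proof -
  have "(\<Sum>u\<in>U. (((\<Sum>v\<in>U. c v *\<^sub>R v) \<bullet> u) / (u \<bullet> u)) *\<^sub>R u) = (\<Sum>u\<in>U. c u *\<^sub>R u)"
    by (intro sum.cong refl) (use U(2) in \<open>auto simp: inner_sum_orthogonal\<close>)
  then show ?thesis by (simp add: drop_span_def)
qed

text \<open>
  The span of the eigenvectors is invariant, so the form of \<open>A\<close> splits orthogonally; the
  difference of the two forms is the form at the component in the span.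
\<close>

lemma drop_span_form:
  fixes A :: "'a endo" and w :: 'a
  assumes A: "symmetric_op A" and eig: "\<And>u. u \<in> U \<Longrightarrow> A \<cdot> u = l u *\<^sub>R u"
    and l: "\<And>u. u \<in> U \<Longrightarrow> x \<le> l u \<and> l u \<le> y"
  defines "z \<equiv> drop_span U w"
  shows "x * ((norm w)\<^sup>2 - (norm z)\<^sup>2) \<le> (A \<cdot> w) \<bullet> w - (A \<cdot> z) \<bullet> z"
    and "(A \<cdot> w) \<bullet> w - (A \<cdot> z) \<bullet> z \<le> y * ((norm w)\<^sup>2 - (norm z)\<^sup>2)"
proof -
  define k where "k u = (w \<bullet> u) / (u \<bullet> u)" for u
  define v where "v = (\<Sum>u\<in>U. k u *\<^sub>R u)"
  have w: "w = z + v" by (simp add: z_def drop_span_def v_def k_def)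
  have zu: "z \<bullet> u = 0" if "u \<in> U" for u
    unfolding z_def using that by (rule drop_span_orthogonal)
  have zs: "z \<bullet> (\<Sum>u\<in>U. c u *\<^sub>R u) = 0" for c
    by (simp add: inner_sum_right zu)
  have Av: "A \<cdot> v = (\<Sum>u\<in>U. (k u * l u) *\<^sub>R u)"
    unfolding v_def endo_apply_sum by (intro sum.cong refl) (simp add: eig)
  have vv: "(norm v)\<^sup>2 = (\<Sum>u\<in>U. (k u)\<^sup>2 * (u \<bullet> u))"
    unfolding power2_norm_eq_inner
    by (subst (2) v_def) (simp add: inner_sum_right v_def inner_sum_orthogonal power2_eq_square mult.assoc)
  have Avv: "(A \<cdot> v) \<bullet> v = (\<Sum>u\<in>U. l u * ((k u)\<^sup>2 * (u \<bullet> u)))"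
    unfolding Av
    by (subst v_def) (simp add: inner_sum_right inner_sum_orthogonal power2_eq_square mult_ac)
  have "z \<bullet> (A \<cdot> v) = 0" "z \<bullet> v = 0"
    unfolding Av unfolding v_def by (rule zs)+
  then have "(A \<cdot> w) \<bullet> w - (A \<cdot> z) \<bullet> z = (A \<cdot> v) \<bullet> v"
    and nn: "(norm w)\<^sup>2 - (norm z)\<^sup>2 = (norm v)\<^sup>2"
    unfolding w using symmetric_opD[OF A, of z v]
    by (simp_all add: inner_add_left inner_add_right inner_commute[of v z] inner_commute[of "A \<cdot> v" z]
        power2_norm_eq_inner)
  then have *: "(A \<cdot> w) \<bullet> w - (A \<cdot> z) \<bullet> z = (\<Sum>u\<in>U. l u * ((k u)\<^sup>2 * (u \<bullet> u)))"
    using Avv by simp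
  show "x * ((norm w)\<^sup>2 - (norm z)\<^sup>2) \<le> (A \<cdot> w) \<bullet> w - (A \<cdot> z) \<bullet> z"
    unfolding * nn vv sum_distrib_left
    by (intro sum_mono mult_right_mono) (auto simp: l)
  show "(A \<cdot> w) \<bullet> w - (A \<cdot> z) \<bullet> z \<le> y * ((norm w)\<^sup>2 - (norm z)\<^sup>2)"
    unfolding * nn vv sum_distrib_left
    by (intro sum_mono mult_right_mono) (auto simp: l)
qed

end

text \<open>
  The counting principle.  Were there more eigenvectors of \<open>A\<close> than vectors in the two
  families, some non-zero combination \<open>v\<close> of them would have its components
  \<open>m\<^sub>- + m\<^sub>+ = v\<close> in the negative and the positive subspace of \<open>T\<close> orthogonal to the families.
  Modulo the span of the eigenvectors \<open>m\<^sub>-\<close> and \<open>-m\<^sub>+\<close> coincide; but the form of \<open>A\<close> is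
  below \<open>x\<close> at the first and above \<open>y\<close> at the second.
\<close>

theorem eigenvalue_count_le:
  fixes T A :: "'a::{real_inner, banach, perfect_space} endo"
  assumes T: "symmetric_op T" and A: "symmetric_op A"
    and below: "bounded_below (shift_op T x)" "bounded_below (shift_op T y)"
    and sgn: "sign_op T y = sign_op T x" and "x \<le> y"
    and U: "finite U" "0 \<notin> U" "pairwise orthogonal U"
    and eig: "\<And>u. u \<in> U \<Longrightarrow> A \<cdot> u = l u *\<^sub>R u" "\<And>u. u \<in> U \<Longrightarrow> x \<le> l u \<and> l u \<le> y"
    and upper: "\<And>u. (A \<cdot> u) \<bullet> u \<le> (T \<cdot> u) \<bullet> u + a u"
    and lower: "\<And>u. (T \<cdot> u) \<bullet> u - b u \<le> (A \<cdot> u) \<bullet> u"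
    and hom: "\<And>r u. a (r *\<^sub>R u) = r\<^sup>2 * a u" "\<And>r u. b (r *\<^sub>R u) = r\<^sup>2 * b u"
    and trace: "\<And>B. form_orthonormal T x (-1) B \<Longrightarrow> (\<Sum>e\<in>B. a e) \<le> \<tau>\<^sub>a"
      "\<And>B. form_orthonormal T y 1 B \<Longrightarrow> (\<Sum>e\<in>B. b e) \<le> \<tau>\<^sub>b"
  shows "real (card U) \<le> \<tau>\<^sub>a + \<tau>\<^sub>b"
proof -
  obtain B where B: "form_orthonormal T x (-1) B" "real (card B) \<le> \<tau>\<^sub>a"
    "\<And>m. sign_op T x \<cdot> m = (-1) *\<^sub>R m \<Longrightarrow> m \<noteq> 0 \<Longrightarrow> (\<forall>e\<in>B. (shift_op T x \<cdot> m) \<bullet> e = 0)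
        \<Longrightarrow> a m < (-1) * ((shift_op T x \<cdot> m) \<bullet> m)"
    using exists_maximal_form_orthonormal[OF T below(1) _ hom(1) trace(1)] by (metis abs_minus abs_one)
  obtain B' where B': "form_orthonormal T y 1 B'" "real (card B') \<le> \<tau>\<^sub>b"
    "\<And>m. sign_op T y \<cdot> m = 1 *\<^sub>R m \<Longrightarrow> m \<noteq> 0 \<Longrightarrow> (\<forall>e\<in>B'. (shift_op T y \<cdot> m) \<bullet> e = 0)
        \<Longrightarrow> b m < 1 * ((shift_op T y \<cdot> m) \<bullet> m)"
    using exists_maximal_form_orthonormal[OF T below(2) _ hom(2) trace(2)] by (metis abs_one)
  have fin: "finite B" "finite B'" using B(1) B'(1) by (auto simp: form_orthonormal_def)
  have "card U \<le> card B + card B'"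
  proof (rule ccontr)
    assume "\<not> ?thesis"
    then have "card (B <+> B') < card U" by (simp add: card_Plus fin)
    let ?S = "sign_op T x"
    define neg where "neg v = (1/2) *\<^sub>R (v - ?S \<cdot> v)" for v
    define pos where "pos v = (1/2) *\<^sub>R (v + ?S \<cdot> v)" for v
    have neg_sum: "neg (\<Sum>u\<in>U. c u *\<^sub>R u) = (\<Sum>u\<in>U. c u *\<^sub>R neg u)" for c
      unfolding neg_def by (simp add: endo_apply_sum scaleR_sum_right sum_subtractf[symmetric] algebra_simps)
    have pos_sum: "pos (\<Sum>u\<in>U. c u *\<^sub>R u) = (\<Sum>u\<in>U. c u *\<^sub>R pos u)" for c
      unfolding pos_def by (simp add: endo_apply_sum scaleR_sum_right sum.distrib[symmetric] algebra_simps)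
    define \<phi> where "\<phi> f u = (case f of Inl e \<Rightarrow> (shift_op T x \<cdot> neg u) \<bullet> e
        | Inr e \<Rightarrow> (shift_op T y \<cdot> pos u) \<bullet> e)" for f u
    have "finite (B <+> B')" using fin by simp
    then obtain c where c: "\<exists>u\<in>U. c u \<noteq> 0"
      and zero: "\<And>f. f \<in> B <+> B' \<Longrightarrow> (\<Sum>u\<in>U. c u * \<phi> f u) = 0"
      using common_kernel_combination[OF _ U(1) \<open>card (B <+> B') < card U\<close>, of \<phi>] by blast
    define v where "v = (\<Sum>u\<in>U. c u *\<^sub>R u)"
    have orth: "\<forall>e\<in>B. (shift_op T x \<cdot> neg v) \<bullet> e = 0" "\<forall>e\<in>B'. (shift_op T y \<cdot> pos v) \<bullet> e = 0"
      using zero[of "Inl _"] zero[of "Inr _"] unfolding v_def neg_sum pos_sum \<phi>_def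
      by (auto simp: endo_apply_sum inner_sum_left simp del: shift_op_apply)
    have S: "?S \<cdot> neg v = (-1) *\<^sub>R neg v" "?S \<cdot> pos v = 1 *\<^sub>R pos v"
      by (simp_all add: neg_def pos_def sign_op_involution[OF T below(1)] algebra_simps)
    have "neg v + pos v = v"
      by (simp add: neg_def pos_def algebra_simps flip: scaleR_add_left)
    then have "drop_span U (neg v) + drop_span U (pos v) = 0"
      using drop_span_combination[OF U] by (simp add: v_def flip: drop_span_add)
    then obtain z where z: "drop_span U (neg v) = z" "drop_span U (pos v) = - z"
      using add_eq_0_iff by blast
    have "(A \<cdot> z) \<bullet> z < x * (norm z)\<^sup>2" if "neg v \<noteq> 0"
    proof -
      have "(A \<cdot> neg v) \<bullet> neg v < x * (norm (neg v))\<^sup>2"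
        using B(3)[OF S(1) that orth(1)] upper[of "neg v"]
        by (simp add: inner_diff_left power2_norm_eq_inner)
      then show ?thesis
        using drop_span_form(1)[OF U A eig, of "neg v"] z(1) by (simp add: algebra_simps)
    qed
    moreover have "(A \<cdot> z) \<bullet> z > y * (norm z)\<^sup>2" if "pos v \<noteq> 0"
    proof -
      have "?S = sign_op T y" by (simp add: sgn)
      then have "(A \<cdot> pos v) \<bullet> pos v > y * (norm (pos v))\<^sup>2"
        using B'(3)[OF _ that orth(2)] S(2) lower[of "pos v"]
        by (simp add: inner_diff_left power2_norm_eq_inner)
      then show ?thesis
        using drop_span_form(2)[OF U A eig, of "pos v"] z(2) by (simp add: algebra_simps)
    qed
    moreover have "x * (norm z)\<^sup>2 \<le> y * (norm z)\<^sup>2"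
      using \<open>x \<le> y\<close> by (simp add: mult_right_mono)
    moreover have "z = 0" if "neg v = 0 \<or> pos v = 0"
      using that z by (auto simp: drop_span_def)
    ultimately have "neg v = 0 \<and> pos v = 0"
      by (cases "neg v = 0"; cases "pos v = 0") auto
    then have "v = 0" using \<open>neg v + pos v = v\<close> by simp
    obtain u where "u \<in> U" "c u \<noteq> 0" using c by blast
    then have "c u * (u \<bullet> u) = 0" using \<open>v = 0\<close> inner_sum_orthogonal[OF U, of u c] by (simp add: v_def)
    then show False using \<open>u \<in> U\<close> \<open>c u \<noteq> 0\<close> U(2) by auto
  qed
  then have "real (card U) \<le> real (card B) + real (card B')" by linarith
  then show ?thesis using B(2) B'(2) by linarith
qed

section \<open>Jacobi operators and their spectra\<close>

definition mult_op :: "(int \<Rightarrow> complex) \<Rightarrow> l2 endo" where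
  "mult_op c = to_endo (Blinfun (\<lambda>u. to_l2 (\<lambda>n. c n * coord u n)))"

definition translate_op :: "int \<Rightarrow> l2 endo" where
  "translate_op k = to_endo (Blinfun (\<lambda>u. to_l2 (\<lambda>n. coord u (n + k))))"

abbreviation cscale_op :: "complex \<Rightarrow> l2 endo" where
  "cscale_op z \<equiv> mult_op (\<lambda>_. z)"

definition jacobi_op :: "(int \<Rightarrow> real) \<Rightarrow> (int \<Rightarrow> real) \<Rightarrow> l2 endo" where
  "jacobi_op a b = translate_op (-1) * mult_op (\<lambda>n. of_real (a n)) + mult_op (\<lambda>n. of_real (b n))
     + mult_op (\<lambda>n. of_real (a n)) * translate_op 1"

lemma coord_mult_op:
  assumes "bounded (range c)"
  shows "coord (mult_op c \<cdot> u) n = c n * coord u n"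
proof -
  obtain K where K: "\<And>n. cmod (c n) \<le> K"
    using assms by (auto simp: bounded_iff)
  have K0: "0 \<le> K" using K[of 0] by (meson norm_ge_zero order_trans)
  have e: "(\<lambda>n. c n * coord u n) \<in> ell2" for u
    using K by (intro ell2_mult_bounded[where K = K] coord)
  note i = to_l2_inverse[OF e]
  have "bounded_linear (\<lambda>u. to_l2 (\<lambda>n. c n * coord u n))"
  proof (rule bounded_linear_intro[where K = K])
    fix u v :: l2 and r :: real
    show "to_l2 (\<lambda>n. c n * coord (u + v) n) = to_l2 (\<lambda>n. c n * coord u n) + to_l2 (\<lambda>n. c n * coord v n)"
      by (rule l2_eqI) (use fun_cong[OF i[of "u + v"]] fun_cong[OF i[of u]] fun_cong[OF i[of v]] in
          \<open>simp add: distrib_left\<close>)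
    show "to_l2 (\<lambda>n. c n * coord (r *\<^sub>R u) n) = r *\<^sub>R to_l2 (\<lambda>n. c n * coord u n)"
      by (rule l2_eqI) (use fun_cong[OF i[of "r *\<^sub>R u"]] fun_cong[OF i[of u]] in simp)
    show "norm (to_l2 (\<lambda>n. c n * coord u n)) \<le> norm u * K"
    proof (rule norm_l2_leI)
      fix F :: "int set" assume "finite F"
      have "(\<Sum>n\<in>F. (cmod (coord (to_l2 (\<lambda>n. c n * coord u n)) n))\<^sup>2) \<le> (\<Sum>n\<in>F. K\<^sup>2 * (cmod (coord u n))\<^sup>2)"
        using K by (intro sum_mono)
          (auto simp: to_l2_inverse e norm_mult power_mult_distrib intro!: mult_right_mono power_mono)
      also have "\<dots> \<le> K\<^sup>2 * (norm u)\<^sup>2"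
        unfolding sum_distrib_left[symmetric] by (intro mult_left_mono coord_sum_le_norm \<open>finite F\<close>) auto
      finally show "(\<Sum>n\<in>F. (cmod (coord (to_l2 (\<lambda>n. c n * coord u n)) n))\<^sup>2) \<le> (norm u * K)\<^sup>2"
        by (simp add: power_mult_distrib mult.commute)
    qed (simp add: K0)
  qed
  then show ?thesis
    by (simp add: mult_op_def endo_apply.rep_eq to_endo_inverse bounded_linear_Blinfun_apply
        to_l2_inverse e)
qed

lemma coord_translate_op: "coord (translate_op k \<cdot> u) n = coord u (n + k)"
proof -
  have bij: "bij (\<lambda>n::int. n + k)"
    by (rule bij_betw_byWitness[where f' = "\<lambda>n. n - k"]) auto
  have e: "(\<lambda>n. coord u (n + k)) \<in> ell2" for u
    using coord_sq_summable[of u]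
    unfolding ell2_def mem_Collect_eq by (subst summable_on_reindex_bij_betw[OF bij])
  have n: "norm (to_l2 (\<lambda>n. coord u (n + k))) = norm u" for u
    unfolding norm_l2_ell2_norm to_l2_inverse[OF e] ell2_norm_def
    by (subst infsum_reindex_bij_betw[OF bij]) simp
  note i = to_l2_inverse[OF e]
  have "bounded_linear (\<lambda>u. to_l2 (\<lambda>n. coord u (n + k)))"
  proof (rule bounded_linear_intro[where K = 1])
    fix u v :: l2 and r :: real
    show "to_l2 (\<lambda>n. coord (u + v) (n + k)) = to_l2 (\<lambda>n. coord u (n + k)) + to_l2 (\<lambda>n. coord v (n + k))"
      by (rule l2_eqI) (use fun_cong[OF i[of "u + v"]] fun_cong[OF i[of u]] fun_cong[OF i[of v]] in simp)
    show "to_l2 (\<lambda>n. coord (r *\<^sub>R u) (n + k)) = r *\<^sub>R to_l2 (\<lambda>n. coord u (n + k))"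
      by (rule l2_eqI) (use fun_cong[OF i[of "r *\<^sub>R u"]] fun_cong[OF i[of u]] in simp)
  qed (simp add: n)
  then show ?thesis
    by (simp add: translate_op_def endo_apply.rep_eq to_endo_inverse bounded_linear_Blinfun_apply
        to_l2_inverse e)
qed

lemma coord_cscale_op [simp]: "coord (cscale_op z \<cdot> u) n = z * coord u n"
  by (rule coord_mult_op) simp

lemma bounded_of_real_range:
  "bounded (range a) \<Longrightarrow> bounded (range (\<lambda>n. complex_of_real (a n)))"
  by (auto simp: bounded_iff)

lemma translate_op_adjoint: "(translate_op k \<cdot> u) \<bullet> v = u \<bullet> (translate_op (- k) \<cdot> v)"
proof -
  have bij: "bij (\<lambda>n::int. n + k)"
    by (rule bij_betw_byWitness[where f' = "\<lambda>n. n - k"]) auto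
  show ?thesis
    unfolding inner_l2_def coord_translate_op
    using infsum_reindex_bij_betw[OF bij, of "\<lambda>n. coord u n \<bullet> coord v (n - k)"] by simp
qed

lemma symmetric_real_mult_op:
  assumes "bounded (range a)"
  shows "symmetric_op (mult_op (\<lambda>n. of_real (a n)))"
  using coord_mult_op[OF bounded_of_real_range[OF assms]]
  by (simp add: symmetric_op_def inner_l2_def inner_complex_def algebra_simps)

context
  fixes a b :: "int \<Rightarrow> real"
  assumes ab: "bounded (range a)" "bounded (range b)"
begin

lemma coord_jacobi_op: "coord (jacobi_op a b \<cdot> u) = jacobi a b (coord u)"
  using coord_mult_op[OF bounded_of_real_range[OF ab(1)]] coord_mult_op[OF bounded_of_real_range[OF ab(2)]]
  by (simp add: fun_eq_iff jacobi_op_def jacobi_def coord_translate_op)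

lemma symmetric_jacobi_op: "symmetric_op (jacobi_op a b)"
  unfolding symmetric_op_def
proof (intro allI)
  fix u v :: l2
  let ?a = "mult_op (\<lambda>n. of_real (a n))" and ?b = "mult_op (\<lambda>n. of_real (b n))"
  note a = symmetric_opD[OF symmetric_real_mult_op[OF ab(1)]]
  note b = symmetric_opD[OF symmetric_real_mult_op[OF ab(2)]]
  have "(translate_op (-1) \<cdot> ?a \<cdot> u) \<bullet> v = u \<bullet> (?a \<cdot> translate_op 1 \<cdot> v)"
    using translate_op_adjoint[of "-1"] a by simp
  moreover have "(?a \<cdot> translate_op 1 \<cdot> u) \<bullet> v = u \<bullet> (translate_op (-1) \<cdot> ?a \<cdot> v)"
    using translate_op_adjoint[of "1"] a by simp
  ultimately show "(jacobi_op a b \<cdot> u) \<bullet> v = u \<bullet> (jacobi_op a b \<cdot> v)"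
    by (simp add: jacobi_op_def inner_add_left inner_add_right b)
qed

lemma cscale_jacobi_op_commute: "cscale_op z * jacobi_op a b = jacobi_op a b * cscale_op z"
proof (rule endo_eqI, rule l2_eqI)
  fix u n
  show "coord ((cscale_op z * jacobi_op a b) \<cdot> u) n = coord ((jacobi_op a b * cscale_op z) \<cdot> u) n"
    by (simp add: coord_jacobi_op) (simp add: jacobi_def algebra_simps)
qed

end

lemma cscale_op_of_real: "cscale_op (of_real x) = x *\<^sub>R 1"
  by (intro endo_eqI l2_eqI) (simp, simp add: scaleR_conv_of_real)

lemma cscale_op_add: "cscale_op (z + w) = cscale_op z + cscale_op w"
  and cscale_op_mult: "cscale_op (z * w) = cscale_op z * cscale_op w"
  by (intro endo_eqI l2_eqI; simp add: algebra_simps)+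

lemma cscale_op_i_skew: "(cscale_op \<i> \<cdot> u) \<bullet> v = - (u \<bullet> (cscale_op \<i> \<cdot> v))"
proof -
  have "u \<bullet> (cscale_op \<i> \<cdot> v) = (\<Sum>\<^sub>\<infinity>n. - (coord (cscale_op \<i> \<cdot> u) n \<bullet> coord v n))"
    unfolding inner_l2_def by (intro infsum_cong) (simp add: inner_complex_def)
  then show ?thesis by (simp add: inner_l2_def infsum_uminus)
qed

lemma norm_cscale_op: "norm (cscale_op z \<cdot> u) = cmod z * norm u"
proof -
  have "(norm (cscale_op z \<cdot> u))\<^sup>2 = (cmod z * norm u)\<^sup>2"
    by (simp add: norm_l2_sq norm_mult power_mult_distrib infsum_cmult_right')
  then show ?thesis by (simp add: power2_eq_iff_nonneg)
qed

lemma cscale_unit_vec_inner: "(cscale_op \<i> \<cdot> unit_vec n) \<bullet> u = Im (coord u n)"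
  by (simp add: cscale_op_i_skew unit_vec_inner)

locale symmetric_l2_op =
  fixes T :: "l2 endo" and f :: "(int \<Rightarrow> complex) \<Rightarrow> (int \<Rightarrow> complex)"
  assumes acts: "\<And>u. coord (T \<cdot> u) = f (coord u)"
    and sym: "symmetric_op T"
    and complex_linear: "cscale_op z * T = T * cscale_op z"
begin

lemma shifted_coord: "shifted f z (coord u) = coord ((T - cscale_op z) \<cdot> u)"
  by (simp add: fun_eq_iff shifted_def acts)

lemma bounded_below_if_not_spectrum:
  assumes "z \<notin> spectrum f"
  shows "bounded_below (T - cscale_op z)"
proof -
  obtain B where bij: "bij_betw (shifted f z) ell2 ell2"
    and B: "\<And>v. v \<in> ell2 \<Longrightarrow> ell2_norm (resolvent f z v) \<le> B * ell2_norm v"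
    using assms unfolding spectrum_def by blast
  have "1 / (\<bar>B\<bar> + 1) * norm u \<le> norm ((T - cscale_op z) \<cdot> u)" for u
  proof -
    have "resolvent f z (coord ((T - cscale_op z) \<cdot> u)) = coord u"
      unfolding resolvent_def shifted_coord[symmetric]
      using bij by (intro inv_into_f_f coord) (auto simp: bij_betw_def)
    then have "norm u \<le> B * norm ((T - cscale_op z) \<cdot> u)"
      unfolding norm_l2_ell2_norm using B[OF coord] by metis
    also have "\<dots> \<le> (\<bar>B\<bar> + 1) * norm ((T - cscale_op z) \<cdot> u)"
      by (intro mult_right_mono) auto
    finally show ?thesis by (simp add: field_simps)
  qed
  then show ?thesis
    unfolding bounded_below_def by (intro exI[of _ "1 / (\<bar>B\<bar> + 1)"]) (auto simp: add_nonneg_pos)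
qed

text \<open>
  A lower bound gives injectivity, a right inverse surjectivity, and together they bound the
  resolvent; so spectral statements reduce to the operators on the Hilbert space.
\<close>

lemma resolvent_eq:
  assumes below: "bounded_below (T - cscale_op z)" and W: "(T - cscale_op z) * W = 1"
  shows "resolvent f z (coord v) = coord (W \<cdot> v)" and "z \<notin> spectrum f"
proof -
  let ?Z = "T - cscale_op z"
  obtain \<eta> where \<eta>: "\<eta> > 0" "\<And>u. \<eta> * norm u \<le> norm (?Z \<cdot> u)"
    using below by (auto simp: bounded_below_def)
  have inj: "inj_on (shifted f z) ell2"
  proof (rule inj_onI)
    fix u v assume uv: "u \<in> ell2" "v \<in> ell2" "shifted f z u = shifted f z v"
    then have "coord (?Z \<cdot> to_l2 u) = coord (?Z \<cdot> to_l2 v)"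
      unfolding shifted_coord[symmetric] by (simp add: to_l2_inverse)
    then have "?Z \<cdot> (to_l2 u - to_l2 v) = 0"
      by (simp only: coord_inject endo_apply_simps) simp
    then have "to_l2 u = to_l2 v"
      using \<eta>(2)[of "to_l2 u - to_l2 v"] \<eta>(1) by (simp add: mult_le_0_iff)
    then show "u = v" using uv by (simp add: to_l2_inject)
  qed
  have right: "shifted f z (coord (W \<cdot> v)) = coord v" for v
    unfolding shifted_coord using W endo_apply_mult by metis
  have surj: "shifted f z ` ell2 = ell2"
  proof
    show "shifted f z ` ell2 \<subseteq> ell2"
    proof
      fix w assume "w \<in> shifted f z ` ell2"
      then obtain u where "u \<in> ell2" "w = shifted f z u" by blast
      then have "w = coord (?Z \<cdot> to_l2 u)"
        unfolding shifted_coord[symmetric] by (simp add: to_l2_inverse)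
      then show "w \<in> ell2" using coord by metis
    qed
    show "ell2 \<subseteq> shifted f z ` ell2"
      using right by (metis coord image_eqI subsetI to_l2_inverse)
  qed
  show res: "resolvent f z (coord v) = coord (W \<cdot> v)" for v
    using inv_into_f_f[OF inj coord[of "W \<cdot> v"]] unfolding right resolvent_def .
  have "\<forall>v\<in>ell2. ell2_norm (resolvent f z v) \<le> norm W * ell2_norm v"
  proof
    fix v assume "v \<in> ell2"
    then have "ell2_norm (resolvent f z v) = norm (W \<cdot> to_l2 v)"
      using res[of "to_l2 v"] by (simp add: to_l2_inverse norm_l2_ell2_norm)
    also have "\<dots> \<le> norm W * norm (to_l2 v)" by (rule norm_endo_apply)
    finally show "ell2_norm (resolvent f z v) \<le> norm W * ell2_norm v"
      using \<open>v \<in> ell2\<close> by (simp add: to_l2_inverse norm_l2_ell2_norm)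
  qed
  then show "z \<notin> spectrum f"
    using inj surj unfolding spectrum_def bij_betw_def by blast
qed

lemma real_shift: "T - cscale_op (of_real x) = shift_op T x"
  by (simp add: shift_op_def cscale_op_of_real)

lemma real_spectrum_iff: "complex_of_real x \<in> spectrum f \<longleftrightarrow> \<not> bounded_below (shift_op T x)"
proof
  assume "complex_of_real x \<in> spectrum f"
  then show "\<not> bounded_below (shift_op T x)"
    using resolvent_eq(2)[of "of_real x"] shift_op_right_inverse[OF sym] unfolding real_shift by blast
qed (use bounded_below_if_not_spectrum[of "of_real x"] in \<open>auto simp: real_shift\<close>)

lemma real_resolvent:
  assumes "bounded_below (shift_op T x)"
  shows "resolvent f (of_real x) (coord v) = coord (sign_op T x \<cdot> abs_resolvent T x \<cdot> v)"
  using resolvent_eq(1)[of "of_real x" "sign_op T x * abs_resolvent T x"] assms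
    shift_op_right_inverse[OF sym assms]
  by (simp add: real_shift)

text \<open>
  For \<open>t \<noteq> 0\<close> the operator \<open>(T - s)\<^sup>2 + t\<^sup>2\<close> is symmetric and bounded below, hence
  invertible; it factors through \<open>T - s - \<i>t\<close>.
\<close>

lemma spectrum_real:
  assumes "z \<in> spectrum f"
  shows "z = of_real (Re z)"
proof (rule ccontr)
  assume "z \<noteq> of_real (Re z)"
  define s t where "s = Re z" and "t = Im z"
  have "t \<noteq> 0" using \<open>z \<noteq> of_real (Re z)\<close> by (auto simp: t_def complex_eq_iff)
  define M I Y where "M = shift_op T s" and "I = cscale_op \<i>" and "Y = - (M * M)"
  have MI: "I * M = M * I" unfolding M_def I_def by (rule shift_op_commute, rule complex_linear)
  have II: "I * I = - 1"
    unfolding I_def cscale_op_mult[symmetric] using cscale_op_of_real[of "-1"] by simp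
  have z: "T - cscale_op z = M - t *\<^sub>R I"
  proof -
    have "z = of_real s + of_real t * \<i>"
      by (simp add: s_def t_def complex_eq_iff)
    then have "cscale_op z = cscale_op (of_real s + of_real t * \<i>)" by (rule arg_cong)
    then show ?thesis
      unfolding cscale_op_add cscale_op_mult cscale_op_of_real by (simp add: M_def I_def shift_op_def)
  qed
  have symM: "symmetric_op M" unfolding M_def by (rule symmetric_shift_op[OF sym])
  have symY: "symmetric_op Y"
    unfolding Y_def using symmetric_op_scaleR[OF symmetric_op_mult[OF symM symM], of "-1"] by simp
  have belowY: "bounded_below (shift_op Y (t\<^sup>2))"
    unfolding bounded_below_def
  proof (intro exI conjI allI)
    fix u
    have "t\<^sup>2 * (norm u)\<^sup>2 \<le> (norm (M \<cdot> u))\<^sup>2 + t\<^sup>2 * (norm u)\<^sup>2" by simp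
    also have "\<dots> = - ((shift_op Y (t\<^sup>2) \<cdot> u) \<bullet> u)"
      using symmetric_opD[OF symM, of "M \<cdot> u" u]
      by (simp add: Y_def inner_diff_left power2_norm_eq_inner)
    also have "\<dots> \<le> norm (shift_op Y (t\<^sup>2) \<cdot> u) * norm u"
      using Cauchy_Schwarz_ineq2[of "shift_op Y (t\<^sup>2) \<cdot> u" u] by linarith
    finally have "t\<^sup>2 * norm u * norm u \<le> norm (shift_op Y (t\<^sup>2) \<cdot> u) * norm u"
      by (simp add: power2_eq_square mult.assoc)
    then show "t\<^sup>2 * norm u \<le> norm (shift_op Y (t\<^sup>2) \<cdot> u)"
      by (cases "u = 0") (auto simp: mult_le_cancel_right)
  qed (use \<open>t \<noteq> 0\<close> in simp)
  define V where "V = sign_op Y (t\<^sup>2) * abs_resolvent Y (t\<^sup>2)"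
  have V: "shift_op Y (t\<^sup>2) * V = 1"
    unfolding V_def by (rule shift_op_right_inverse[OF symY belowY])
  have "(M - t *\<^sub>R I) * (M + t *\<^sub>R I) = - shift_op Y (t\<^sup>2)"
    using MI II by (simp add: algebra_simps Y_def shift_op_def power2_eq_square)
  then have right: "(T - cscale_op z) * ((M + t *\<^sub>R I) * (- V)) = 1"
    unfolding z mult.assoc[symmetric] using V by simp
  have below: "bounded_below (T - cscale_op z)"
    unfolding bounded_below_def z
  proof (intro exI conjI allI)
    fix u
    have "(M \<cdot> u) \<bullet> (I \<cdot> u) = u \<bullet> (I \<cdot> M \<cdot> u)"
      using symmetric_opD[OF symM, of u "I \<cdot> u"] MI endo_apply_mult by metis
    also have "\<dots> = - ((M \<cdot> u) \<bullet> (I \<cdot> u))"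
      unfolding I_def using cscale_op_i_skew[of u "M \<cdot> u"] by (simp add: inner_commute)
    finally have "(M \<cdot> u) \<bullet> (I \<cdot> u) = 0" by simp
    then have "(norm (M \<cdot> u - t *\<^sub>R (I \<cdot> u)))\<^sup>2 = (norm (M \<cdot> u))\<^sup>2 + t\<^sup>2 * (norm (I \<cdot> u))\<^sup>2"
      unfolding power2_norm_eq_inner
      by (simp add: inner_diff_left inner_diff_right inner_commute[of "I \<cdot> u" "M \<cdot> u"] power2_eq_square)
    then have "(\<bar>t\<bar> * norm u)\<^sup>2 \<le> (norm ((M - t *\<^sub>R I) \<cdot> u))\<^sup>2"
      by (simp add: I_def norm_cscale_op power_mult_distrib)
    then show "\<bar>t\<bar> * norm u \<le> norm ((M - t *\<^sub>R I) \<cdot> u)"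
      by (rule power2_le_imp_le) simp
  qed (use \<open>t \<noteq> 0\<close> in simp)
  show False using resolvent_eq(2)[OF below right] assms by blast
qed

end

lemma symmetric_l2_op_jacobi:
  "bounded (range a) \<Longrightarrow> bounded (range b) \<Longrightarrow> symmetric_l2_op (jacobi_op a b) (jacobi a b)"
  by unfold_locales
    (auto simp: coord_jacobi_op symmetric_jacobi_op cscale_jacobi_op_commute)

lemma bounded_below_perturb:
  fixes T :: "'a::{real_normed_vector, perfect_space} endo"
  assumes \<eta>: "\<And>u. \<eta> * norm u \<le> norm (shift_op T x \<cdot> u)" and "\<bar>y - x\<bar> < \<eta>"
  shows "bounded_below (shift_op T y)"
  unfolding bounded_below_def
proof (intro exI conjI allI)
  show "0 < \<eta> - \<bar>y - x\<bar>" using assms(2) by simp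
  fix u
  have "shift_op T x \<cdot> u = shift_op T y \<cdot> u + (y - x) *\<^sub>R u" by (simp add: algebra_simps)
  then have "norm (shift_op T x \<cdot> u) \<le> norm (shift_op T y \<cdot> u) + norm ((y - x) *\<^sub>R u)"
    by (metis norm_triangle_ineq)
  then show "(\<eta> - \<bar>y - x\<bar>) * norm u \<le> norm (shift_op T y \<cdot> u)"
    using \<eta>[of u] by (simp add: left_diff_distrib)
qed

lemma shift_op_lower_bound:
  fixes T :: "'a::{real_normed_vector, perfect_space} endo"
  shows "(\<bar>x\<bar> - norm T) * norm u \<le> norm (shift_op T x \<cdot> u)"
proof -
  have "\<bar>x\<bar> * norm u = norm (T \<cdot> u - shift_op T x \<cdot> u)" by simp
  also have "\<dots> \<le> norm T * norm u + norm (shift_op T x \<cdot> u)"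
    using norm_triangle_ineq4[of "T \<cdot> u" "shift_op T x \<cdot> u"] norm_endo_apply[of T u] by linarith
  finally show ?thesis by (simp add: algebra_simps)
qed

definition real_spectrum :: "'a::{real_normed_vector, perfect_space} endo \<Rightarrow> real set" where
  "real_spectrum T = {x. \<not> bounded_below (shift_op T x)}"

lemma abs_real_spectrum_le:
  assumes "x \<in> real_spectrum T"
  shows "\<bar>x\<bar> \<le> norm T"
proof (rule ccontr)
  assume "\<not> ?thesis"
  then have "bounded_below (shift_op T x)"
    unfolding bounded_below_def using shift_op_lower_bound[of x T]
    by (intro exI[of _ "\<bar>x\<bar> - norm T"]) auto
  then show False using assms by (simp add: real_spectrum_def)
qed

lemma compact_real_spectrum: "compact (real_spectrum T)"
proof -
  have "open (- real_spectrum T)"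
    unfolding open_dist
  proof
    fix x assume "x \<in> - real_spectrum T"
    then obtain \<eta> where "\<eta> > 0" "\<And>u. \<eta> * norm u \<le> norm (shift_op T x \<cdot> u)"
      by (auto simp: real_spectrum_def bounded_below_def)
    then show "\<exists>e>0. \<forall>y. dist y x < e \<longrightarrow> y \<in> - real_spectrum T"
      using bounded_below_perturb[of \<eta> T x]
      by (intro exI[of _ \<eta>]) (auto simp: real_spectrum_def dist_real_def)
  qed
  moreover have "bounded (real_spectrum T)"
    using abs_real_spectrum_le by (auto simp: bounded_iff)
  ultimately show ?thesis
    by (simp add: compact_eq_bounded_closed closed_def)
qed

section \<open>Spectral measures\<close>

lemma set_integrable_continuous_on_compact:
  fixes g :: "real \<Rightarrow> real"
  assumes "sets \<rho> = sets borel" "finite_measure \<rho>" "compact E" "continuous_on E g"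
  shows "set_integrable \<rho> E g"
proof -
  obtain G where G: "\<And>t. t \<in> E \<Longrightarrow> \<bar>g t\<bar> \<le> G"
    using compact_imp_bounded[OF compact_continuous_image[OF assms(4,3)]] by (auto simp: bounded_iff)
  have "(\<lambda>t. indicator E t *\<^sub>R g t) \<in> borel_measurable borel"
    using assms by (intro borel_measurable_continuous_on_indicator) (auto intro: borel_compact)
  then have "(\<lambda>t. indicator E t *\<^sub>R g t) \<in> borel_measurable \<rho>"
    using measurable_cong_sets[OF assms(1) refl] by blast
  then show ?thesis
    unfolding set_integrable_def using assms(2) G
    by (intro finite_measure.integrable_const_bound[where B = "max 0 G"])
      (auto simp: indicator_def intro!: AE_I2 le_max_iff_disj[THEN iffD2])
qed

lemma set_integral_abs_le:
  fixes g :: "real \<Rightarrow> real"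
  assumes "sets \<rho> = sets borel" "finite_measure \<rho>" "compact E" "continuous_on E g"
    and G: "\<And>t. t \<in> E \<Longrightarrow> \<bar>g t\<bar> \<le> G" and "0 \<le> G"
  shows "\<bar>LINT t:E|\<rho>. g t\<bar> \<le> G * measure \<rho> (space \<rho>)"
proof -
  interpret finite_measure \<rho> by fact
  have "\<bar>LINT t:E|\<rho>. g t\<bar> \<le> (LINT t|\<rho>. norm (indicator E t *\<^sub>R g t))"
    unfolding set_lebesgue_integral_def real_norm_def[symmetric] by (rule integral_norm_bound)
  also have "\<dots> \<le> (LINT t|\<rho>. G)"
    using set_integrable_continuous_on_compact[OF assms(1-4)] G \<open>0 \<le> G\<close>
    by (intro integral_mono) (auto simp: set_integrable_def indicator_def)
  finally show ?thesis by (simp add: mult.commute)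
qed

lemma continuous_on_poly_value: "poly_value T A f \<Longrightarrow> continuous_on S f"
  by (induction rule: poly_value.induct) (auto intro!: continuous_intros)

context symmetric_l2_op
begin

lemma real_spectrum_eq: "{t. complex_of_real t \<in> spectrum f} = real_spectrum T"
  by (auto simp: real_spectrum_def real_spectrum_iff)

context
  fixes n :: int and \<rho> :: "real measure"
  assumes \<rho>: "is_spectral_measure f (ell2_basis n) \<rho>"
begin

lemma spectral_measure_sets: "sets \<rho> = sets borel"
  and spectral_measure_finite: "finite_measure \<rho>"
  using \<rho> by (simp_all add: is_spectral_measure_def Let_def)

lemma spectral_measure_resolvent:
  assumes "x \<notin> real_spectrum T"
  shows "unit_vec n \<bullet> (sign_op T x \<cdot> abs_resolvent T x \<cdot> unit_vec n)
      = (LINT t:real_spectrum T|\<rho>. 1 / (t - x))"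
proof -
  let ?E = "real_spectrum T"
  have below: "bounded_below (shift_op T x)" using assms by (simp add: real_spectrum_def)
  let ?w = "sign_op T x \<cdot> abs_resolvent T x \<cdot> unit_vec n"
  have "ell2_inner (ell2_basis n) (resolvent f (of_real x) (ell2_basis n))
      = (LINT t:?E|\<rho>. 1 / (complex_of_real t - of_real x))"
  proof -
    have "complex_of_real x \<notin> complex_of_real ` ?E" using assms by auto
    then show ?thesis
      using \<rho> unfolding is_spectral_measure_def Let_def real_spectrum_eq by blast
  qed
  also have "(LINT t:?E|\<rho>. 1 / (complex_of_real t - of_real x)) = (LINT t:?E|\<rho>. of_real (1 / (t - x)))"
    by simp
  also have "\<dots> = of_real (LINT t:?E|\<rho>. 1 / (t - x))"
    by (rule set_integral_complex_of_real)
  also have "resolvent f (of_real x) (ell2_basis n) = coord ?w"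
    using real_resolvent[OF below, of "unit_vec n"] by (simp add: unit_vec_def to_l2_inverse ell2_basis_in_ell2)
  also have "ell2_inner (ell2_basis n) (coord ?w) = (\<Sum>\<^sub>\<infinity>m\<in>{n}. cnj (ell2_basis n m) * coord ?w m)"
    unfolding ell2_inner_def by (rule infsum_cong_neutral) (auto simp: ell2_basis_def)
  also have "\<dots> = coord ?w n" by (simp add: ell2_basis_def)
  finally have "coord ?w n = of_real (LINT t:?E|\<rho>. 1 / (t - x))" .
  then show ?thesis by (simp add: unit_vec_inner)
qed

text \<open>
  Polynomial moments are read off from the resolvent at infinity: for a polynomial value \<open>A\<close>
  of \<open>T\<close>, the quantities \<open>- x \<langle>A (T - x)\<^sup>-\<^sup>1 \<delta>\<^sub>n, \<delta>\<^sub>n\<rangle>\<close> tend to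
  \<open>\<langle>A \<delta>\<^sub>n, \<delta>\<^sub>n\<rangle>\<close> on the one side and to the integral of the polynomial on the other.
\<close>

lemma spectral_measure_moment_aux:
  assumes A: "poly_value T A g"
    and res: "\<And>x. norm T < x \<Longrightarrow> unit_vec n \<bullet> (A \<cdot> sign_op T x \<cdot> abs_resolvent T x \<cdot> unit_vec n)
      = (LINT t:real_spectrum T|\<rho>. g t / (t - x))"
  shows "unit_vec n \<bullet> (A \<cdot> unit_vec n) = (LINT t:real_spectrum T|\<rho>. g t)"
proof -
  let ?E = "real_spectrum T" and ?d = "unit_vec n"
  note E = compact_real_spectrum[of T]
  note cont = continuous_on_poly_value[OF A]
  obtain G where G: "\<And>t. t \<in> ?E \<Longrightarrow> \<bar>g t\<bar> \<le> G"
    using compact_imp_bounded[OF compact_continuous_image[OF cont E]] by (auto simp: bounded_iff)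
  define c where "c = norm (A * T) + \<bar>G\<bar> * norm T * measure \<rho> (space \<rho>)"
  have main: "\<bar>?d \<bullet> (A \<cdot> ?d) - (LINT t:?E|\<rho>. g t)\<bar> \<le> c / (x - norm T)" if x: "norm T < x" for x
  proof -
    have pos: "0 < x - norm T" using x by simp
    have x0: "0 < x" using x norm_ge_zero[of T] by linarith
    then have low: "(x - norm T) * norm u \<le> norm (shift_op T x \<cdot> u)" for u
      using shift_op_lower_bound[of x T u] by simp
    then have below: "bounded_below (shift_op T x)"
      unfolding bounded_below_def using pos by blast
    define r where "r = sign_op T x \<cdot> abs_resolvent T x \<cdot> ?d"
    have r: "shift_op T x \<cdot> r = ?d"
      unfolding r_def using shift_op_right_inverse[OF sym below] endo_apply_mult by metis
    then have norm_r: "norm r \<le> 1 / (x - norm T)"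
      using low[of r] pos by (simp add: field_simps del: shift_op_apply)
    have "A \<cdot> ?d = (A * T) \<cdot> r - x *\<^sub>R (A \<cdot> r)"
      unfolding r[symmetric] by simp
    then have 1: "?d \<bullet> (A \<cdot> ?d) = ?d \<bullet> ((A * T) \<cdot> r) - x * (LINT t:?E|\<rho>. g t / (t - x))"
      using res[OF x] unfolding r_def[symmetric] by (simp add: inner_diff_right)
    have "\<bar>?d \<bullet> ((A * T) \<cdot> r)\<bar> \<le> norm ?d * norm ((A * T) \<cdot> r)"
      by (rule Cauchy_Schwarz_ineq2)
    also have "\<dots> \<le> norm (A * T) * norm r"
      using norm_endo_apply[of "A * T" r] by simp
    also have "\<dots> \<le> norm (A * T) * (1 / (x - norm T))"
      by (intro mult_left_mono norm_r) simp
    finally have 2: "\<bar>?d \<bullet> ((A * T) \<cdot> r)\<bar> \<le> norm (A * T) / (x - norm T)" by simp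
    have ne: "t \<noteq> x" if "t \<in> ?E" for t using abs_real_spectrum_le[OF that] x by auto
    have cont': "continuous_on ?E (\<lambda>t. g t / (t - x))" "continuous_on ?E (\<lambda>t. g t * t / (t - x))"
      using ne by (auto intro!: continuous_intros cont)
    have int: "set_integrable \<rho> ?E (\<lambda>t. g t / (t - x))" "set_integrable \<rho> ?E g"
      by (intro set_integrable_continuous_on_compact spectral_measure_sets spectral_measure_finite E
          cont cont')+
    have "(LINT t:?E|\<rho>. g t) + x * (LINT t:?E|\<rho>. g t / (t - x)) = (LINT t:?E|\<rho>. g t + x * (g t / (t - x)))"
      using set_integral_add(2)[OF int(2) set_integrable_mult_right[of x, OF int(1)]]
      by (simp only: set_integral_mult_right)
    also have "\<dots> = (LINT t:?E|\<rho>. g t * t / (t - x))"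
    proof (rule set_lebesgue_integral_cong)
      show "?E \<in> sets \<rho>" using spectral_measure_sets E by (simp add: borel_compact)
      show "\<forall>t. t \<in> ?E \<longrightarrow> g t + x * (g t / (t - x)) = g t * t / (t - x)"
        using ne by (auto simp: field_simps)
    qed
    finally have "\<bar>(LINT t:?E|\<rho>. g t) + x * (LINT t:?E|\<rho>. g t / (t - x))\<bar>
        \<le> (\<bar>G\<bar> * norm T / (x - norm T)) * measure \<rho> (space \<rho>)"
    proof (rule ssubst, intro set_integral_abs_le spectral_measure_sets spectral_measure_finite E cont')
      fix t assume t: "t \<in> ?E"
      have "\<bar>g t * t / (t - x)\<bar> = \<bar>g t\<bar> * \<bar>t\<bar> / \<bar>t - x\<bar>" by (simp add: abs_mult)
      also have "\<dots> \<le> \<bar>G\<bar> * norm T / (x - norm T)"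
        using abs_real_spectrum_le[OF t] G[OF t] pos by (intro frac_le mult_mono) auto
      finally show "\<bar>g t * t / (t - x)\<bar> \<le> \<bar>G\<bar> * norm T / (x - norm T)" .
    qed (use pos in simp)
    then show ?thesis
      using 1 2 by (simp add: c_def add_divide_distrib)
  qed
  show ?thesis
  proof (rule ccontr)
    define \<Delta> where "\<Delta> = \<bar>?d \<bullet> (A \<cdot> ?d) - (LINT t:?E|\<rho>. g t)\<bar>"
    assume "\<not> ?thesis"
    then have "\<Delta> > 0" by (simp add: \<Delta>_def)
    have "c \<ge> 0" by (simp add: c_def)
    \<comment> \<open>The point \<open>x\<close> is chosen so far out that the error is at most \<open>\<Delta> c / (c + 1) < \<Delta>\<close>.\<close>
    have "\<Delta> \<le> c / ((norm T + (c + 1) / \<Delta>) - norm T)"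
      unfolding \<Delta>_def by (rule main) (use \<open>\<Delta> > 0\<close> \<open>c \<ge> 0\<close> in \<open>simp add: \<Delta>_def\<close>)
    then have "\<Delta> * (c + 1) \<le> c * \<Delta>"
      using \<open>\<Delta> > 0\<close> \<open>c \<ge> 0\<close> by (simp add: field_simps)
    then show False using \<open>\<Delta> > 0\<close> by (simp add: algebra_simps)
  qed
qed

lemma spectral_measure_moment:
  assumes "poly_value T A g"
  shows "unit_vec n \<bullet> (A \<cdot> unit_vec n) = (LINT t:real_spectrum T|\<rho>. g t)"
proof -
  let ?E = "real_spectrum T" and ?d = "unit_vec n"
  note E = compact_real_spectrum[of T]
  have ne: "t \<noteq> x" if "t \<in> ?E" "norm T < x" for t x using abs_real_spectrum_le[OF that(1)] that(2) by auto
  have int: "set_integrable \<rho> ?E h" if "continuous_on ?E h" for h :: "real \<Rightarrow> real"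
    by (intro set_integrable_continuous_on_compact spectral_measure_sets spectral_measure_finite E that)
  have "?d \<bullet> (A \<cdot> sign_op T x \<cdot> abs_resolvent T x \<cdot> ?d) = (LINT t:?E|\<rho>. g t / (t - x))" if x: "norm T < x" for x
    using assms x
  proof (induction arbitrary: x rule: poly_value.induct)
    case (const c)
    then have "x \<notin> ?E" using ne by blast
    moreover have "(LINT t:?E|\<rho>. c / (t - x)) = c * (LINT t:?E|\<rho>. 1 / (t - x))"
      by (subst set_integral_mult_right[symmetric]) simp
    ultimately show ?case
      using spectral_measure_resolvent[of x] by simp
  next
    case (shift A g)
    have "0 < x" using shift.prems norm_ge_zero[of T] by linarith
    then have "bounded_below (shift_op T x)"
      using shift_op_lower_bound[of x T] shift.prems by (auto simp: bounded_below_def intro!: exI[of _ "x - norm T"])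
    then have "shift_op T x \<cdot> sign_op T x \<cdot> abs_resolvent T x \<cdot> ?d = ?d"
      using shift_op_right_inverse[OF sym] endo_apply_mult by metis
    then have T: "T \<cdot> sign_op T x \<cdot> abs_resolvent T x \<cdot> ?d = ?d + x *\<^sub>R (sign_op T x \<cdot> abs_resolvent T x \<cdot> ?d)"
      by (simp add: algebra_simps)
    have "?d \<bullet> ((T * A) \<cdot> sign_op T x \<cdot> abs_resolvent T x \<cdot> ?d)
        = ?d \<bullet> (A \<cdot> T \<cdot> sign_op T x \<cdot> abs_resolvent T x \<cdot> ?d)"
      unfolding poly_value_commute[OF shift.hyps] by simp
    also have "\<dots> = ?d \<bullet> (A \<cdot> ?d) + x * (?d \<bullet> (A \<cdot> sign_op T x \<cdot> abs_resolvent T x \<cdot> ?d))"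
      unfolding T by (simp add: inner_add_right)
    also have "\<dots> = (LINT t:?E|\<rho>. g t) + x * (LINT t:?E|\<rho>. g t / (t - x))"
      using spectral_measure_moment_aux[OF shift.hyps shift.IH] shift.IH[OF shift.prems] by simp
    also have "\<dots> = (LINT t:?E|\<rho>. g t + x * (g t / (t - x)))"
    proof -
      have "set_integrable \<rho> ?E g" "set_integrable \<rho> ?E (\<lambda>t. g t / (t - x))"
        using ne[OF _ shift.prems] continuous_on_poly_value[OF shift.hyps]
        by (auto intro!: int continuous_intros)
      from set_integral_add(2)[OF this(1) set_integrable_mult_right[of x, OF this(2)]]
      show ?thesis by (simp only: set_integral_mult_right)
    qed
    also have "\<dots> = (LINT t:?E|\<rho>. t * g t / (t - x))"
      using ne[OF _ shift.prems]
      by (intro set_lebesgue_integral_cong)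
        (auto simp: spectral_measure_sets E borel_compact field_simps)
    finally show ?case .
  next
    case (add A g B h)
    have "set_integrable \<rho> ?E (\<lambda>t. g t / (t - x))" "set_integrable \<rho> ?E (\<lambda>t. h t / (t - x))"
      using ne[OF _ add.prems] continuous_on_poly_value[OF add.hyps(1)] continuous_on_poly_value[OF add.hyps(2)]
      by (auto intro!: int continuous_intros)
    then show ?case
      using add.IH(1)[OF add.prems] add.IH(2)[OF add.prems]
      by (simp add: inner_add_right add_divide_distrib set_integral_add)
  qed
  then show ?thesis
    using spectral_measure_moment_aux[OF assms] by blast
qed

text \<open>
  The partial sums of the binomial series are polynomials in \<open>T\<close>, so their diagonal entries are
  integrals of polynomials that lie below \<open>1 / \<bar>t - x\<bar>\<close> on the spectrum.
\<close>

lemma abs_resolvent_diagonal_le: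
  assumes x: "x \<notin> real_spectrum T" and "0 \<le> c"
    and c: "(\<integral>\<^sup>+t\<in>real_spectrum T. ennreal (1 / \<bar>t - x\<bar>) \<partial>\<rho>) \<le> ennreal c"
  shows "(abs_resolvent T x \<cdot> unit_vec n) \<bullet> unit_vec n \<le> c"
proof -
  let ?E = "real_spectrum T" and ?d = "unit_vec n"
  have below: "bounded_below (shift_op T x)" using x by (simp add: real_spectrum_def)
  have "(abs_resolvent_sum T x k \<cdot> ?d) \<bullet> ?d \<le> c" for k
  proof -
    let ?p = "abs_resolvent_poly T x k"
    have p: "0 \<le> ?p t" "?p t \<le> 1 / \<bar>t - x\<bar>" if "t \<in> ?E" for t
      using abs_resolvent_poly_bounds[OF abs_real_spectrum_le[OF that], of x k] x that by auto
    have int: "set_integrable \<rho> ?E ?p"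
      by (intro set_integrable_continuous_on_compact spectral_measure_sets spectral_measure_finite
          compact_real_spectrum continuous_on_poly_value[OF poly_value_abs_resolvent_sum])
    have "ennreal (LINT t:?E|\<rho>. ?p t) = (\<integral>\<^sup>+t. ennreal (indicator ?E t *\<^sub>R ?p t) \<partial>\<rho>)"
      unfolding set_lebesgue_integral_def using int p
      by (intro nn_integral_eq_integral[symmetric]) (auto simp: set_integrable_def indicator_def)
    also have "\<dots> \<le> (\<integral>\<^sup>+t\<in>?E. ennreal (1 / \<bar>t - x\<bar>) \<partial>\<rho>)"
      using p by (intro nn_integral_mono) (auto simp: indicator_def intro!: ennreal_leI)
    also have "\<dots> \<le> ennreal c" by (rule c)
    finally have "(LINT t:?E|\<rho>. ?p t) \<le> c" using \<open>0 \<le> c\<close> by (simp add: ennreal_le_iff)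
    then show ?thesis
      using spectral_measure_moment[OF poly_value_abs_resolvent_sum, of x k] by (simp add: inner_commute)
  qed
  then show ?thesis
    by (intro tendsto_upperbound[OF abs_resolvent_form_tendsto[OF sym below]]) auto
qed

text \<open>
  \<open>\<integral> (t - \<lambda>)\<^sup>2 d\<rho>\<^sub>n = \<parallel>(T - \<lambda>) \<delta>\<^sub>n\<parallel>\<^sup>2\<close>, so the spectrum is not contained in \<open>{\<lambda>}\<close>
  unless \<open>\<delta>\<^sub>n\<close> is an eigenvector.
\<close>

lemma real_spectrum_not_subset_singleton:
  assumes "shift_op T l \<cdot> unit_vec n \<noteq> 0"
  shows "\<not> real_spectrum T \<subseteq> {l}"
proof
  assume sub: "real_spectrum T \<subseteq> {l}"
  have "poly_value T (T * (1 *\<^sub>R 1)) (\<lambda>t. t * 1)"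
    by (intro poly_value.shift poly_value.const)
  from poly_value.add[OF this poly_value.const[of T "- l"]]
  have M: "poly_value T (shift_op T l) (\<lambda>t. t + - l)" by (simp add: shift_op_def)
  have "(norm (shift_op T l \<cdot> unit_vec n))\<^sup>2 = unit_vec n \<bullet> ((shift_op T l * shift_op T l) \<cdot> unit_vec n)"
    using symmetric_opD[OF symmetric_shift_op[OF sym], of l "unit_vec n" "shift_op T l \<cdot> unit_vec n"]
    by (simp only: power2_norm_eq_inner endo_apply_mult)
  also have "\<dots> = (LINT t:real_spectrum T|\<rho>. (t + - l) * (t + - l))"
    by (rule spectral_measure_moment[OF poly_value_mult[OF M M]])
  also have "\<dots> = (LINT t:real_spectrum T|\<rho>. 0)"
    using sub by (intro set_lebesgue_integral_cong)
      (auto simp: spectral_measure_sets compact_real_spectrum borel_compact)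
  also have "\<dots> = 0" by (simp add: set_lebesgue_integral_def)
  finally show False using assms by simp
qed

end

end

section \<open>Trace class perturbations of Jacobi operators\<close>

text \<open>
  The diagonal majorant of the perturbation: \<open>\<plusminus> 2 \<delta>a\<^sub>n Re (cnj u\<^sub>n * u\<^sub>n\<^sub>+\<^sub>1)\<close> is at
  most \<open>\<bar>\<delta>a\<^sub>n\<bar> (\<bar>u\<^sub>n\<bar>\<^sup>2 + \<bar>u\<^sub>n\<^sub>+\<^sub>1\<bar>\<^sup>2)\<close>.
\<close>

definition trace_weight :: "(int \<Rightarrow> real) \<Rightarrow> (int \<Rightarrow> real) \<Rightarrow> (int \<Rightarrow> real) \<Rightarrow> (int \<Rightarrow> real) \<Rightarrow> int \<Rightarrow> real" where
  "trace_weight a b a' b' n = max 0 (b n - b' n) + \<bar>a (n - 1) - a' (n - 1)\<bar> + \<bar>a n - a' n\<bar>"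

definition diag_form :: "(int \<Rightarrow> real) \<Rightarrow> l2 \<Rightarrow> real" where
  "diag_form w u = (\<Sum>\<^sub>\<infinity>n. w n * (cmod (coord u n))\<^sup>2)"

lemma weighted_inner_summable:
  assumes "bounded (range (c :: int \<Rightarrow> real))"
  shows "(\<lambda>n. c n * (coord u n \<bullet> coord v n)) summable_on UNIV"
  using coord_inner_summable[of "mult_op (\<lambda>n. of_real (c n)) \<cdot> u" v]
  by (simp add: coord_mult_op[OF bounded_of_real_range[OF assms]] inner_complex_def algebra_simps)

lemma weighted_square_summable:
  "bounded (range (c :: int \<Rightarrow> real)) \<Longrightarrow> (\<lambda>n. c n * (cmod (coord u n))\<^sup>2) summable_on UNIV"
  using weighted_inner_summable[of c u u] by (simp add: power2_norm_eq_inner)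

lemma diag_form_scaleR: "diag_form w (r *\<^sub>R u) = r\<^sup>2 * diag_form w u"
  unfolding diag_form_def infsum_cmult_right'[symmetric]
  by (intro infsum_cong) (simp add: power_mult_distrib)

lemma infsum_real_diff:
  fixes f g :: "'n \<Rightarrow> real"
  assumes "f summable_on A" "g summable_on A"
  shows "infsum f A - infsum g A = (\<Sum>\<^sub>\<infinity>n\<in>A. f n - g n)"
  using infsum_add[of f A "\<lambda>n. - g n"] assms
  by (simp add: infsum_uminus summable_on_uminus)

lemma infsum_int_shift: "(\<Sum>\<^sub>\<infinity>n::int. f (n + k)) = (\<Sum>\<^sub>\<infinity>n. f n)"
  and summable_int_shift: "(\<lambda>n::int. f (n + k)) summable_on UNIV \<longleftrightarrow> f summable_on UNIV"
proof -
  have bij: "bij (\<lambda>n::int. n + k)"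
    by (rule bij_betw_byWitness[where f' = "\<lambda>n. n - k"]) auto
  show "(\<Sum>\<^sub>\<infinity>n. f (n + k)) = (\<Sum>\<^sub>\<infinity>n. f n)"
    by (rule infsum_reindex_bij_betw[OF bij])
  show "(\<lambda>n. f (n + k)) summable_on UNIV \<longleftrightarrow> f summable_on UNIV"
    by (rule summable_on_reindex_bij_betw[OF bij])
qed

text \<open>The two off-diagonal parts are adjoint to each other and contribute the same real part.\<close>

lemma jacobi_form:
  assumes "bounded (range a)" "bounded (range b)"
  shows "(jacobi_op a b \<cdot> u) \<bullet> u
    = diag_form b u + 2 * (\<Sum>\<^sub>\<infinity>n. a n * (coord u (n + 1) \<bullet> coord u n))"
proof -
  let ?a = "mult_op (\<lambda>n. of_real (a n))" and ?b = "mult_op (\<lambda>n. of_real (b n))"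
  have b: "(?b \<cdot> u) \<bullet> u = diag_form b u"
    unfolding inner_l2_def diag_form_def coord_mult_op[OF bounded_of_real_range[OF assms(2)]]
    by (intro infsum_cong) (simp add: power2_norm_eq_inner inner_complex_def algebra_simps)
  have a: "(?a \<cdot> translate_op 1 \<cdot> u) \<bullet> u = (\<Sum>\<^sub>\<infinity>n. a n * (coord u (n + 1) \<bullet> coord u n))"
    unfolding inner_l2_def coord_mult_op[OF bounded_of_real_range[OF assms(1)]] coord_translate_op
    by (intro infsum_cong) (simp add: inner_complex_def algebra_simps)
  have "(translate_op (-1) \<cdot> ?a \<cdot> u) \<bullet> u = (?a \<cdot> translate_op 1 \<cdot> u) \<bullet> u"
    using translate_op_adjoint[of "-1" "?a \<cdot> u" u]
      symmetric_opD[OF symmetric_real_mult_op[OF assms(1)], of u "translate_op 1 \<cdot> u"]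
    by (simp add: inner_commute)
  then show ?thesis
    by (simp add: jacobi_op_def inner_add_left a b)
qed

context
  fixes a b a' b' :: "int \<Rightarrow> real"
  assumes ab: "bounded (range a)" "bounded (range b)" and ab': "bounded (range a')" "bounded (range b')"
    and trace_class: "(\<lambda>n. \<bar>a n - a' n\<bar> + \<bar>b n - b' n\<bar>) summable_on UNIV"
begin

lemma abs_diff_summable:
  shows "(\<lambda>n. \<bar>a n - a' n\<bar>) summable_on UNIV" "(\<lambda>n. \<bar>b n - b' n\<bar>) summable_on UNIV"
  by (rule summable_on_comparison_test[OF trace_class]; simp)+

lemma trace_weight_summable: "trace_weight a b a' b' summable_on UNIV"
proof -
  have "(\<lambda>n. \<bar>a (n + - 1) - a' (n + - 1)\<bar>) summable_on UNIV"
    using abs_diff_summable(1) by (subst summable_int_shift)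
  moreover have "(\<lambda>n. max 0 (b n - b' n)) summable_on UNIV"
    by (rule summable_on_comparison_test[OF abs_diff_summable(2)]) auto
  ultimately have "(\<lambda>n. max 0 (b n - b' n) + \<bar>a (n + - 1) - a' (n + - 1)\<bar> + \<bar>a n - a' n\<bar>) summable_on UNIV"
    by (intro summable_on_add abs_diff_summable)
  then show ?thesis by (simp add: trace_weight_def[abs_def])
qed

lemma bounded_diff: "bounded (range (\<lambda>n. a n - a' n))" "bounded (range (\<lambda>n. b n - b' n))"
  using ab ab' by (auto intro: bounded_minus_comp)

lemma bounded_abs_diff: "bounded (range (\<lambda>n. \<bar>a n - a' n\<bar>))"
  "bounded (range (\<lambda>n. max 0 (b n - b' n)))"
proof -
  obtain K L where K: "\<And>n. \<bar>a n - a' n\<bar> \<le> K" and L: "\<And>n. \<bar>b n - b' n\<bar> \<le> L"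
    using bounded_diff by (auto simp: bounded_iff)
  show "bounded (range (\<lambda>n. \<bar>a n - a' n\<bar>))"
    using K by (auto simp: bounded_iff)
  have "norm (max 0 (b n - b' n)) \<le> L" for n
    using L[of n] by (auto simp: max_def)
  then show "bounded (range (\<lambda>n. max 0 (b n - b' n)))"
    unfolding bounded_iff by blast
qed

lemma jacobi_form_le:
  "(jacobi_op a b \<cdot> u) \<bullet> u \<le> (jacobi_op a' b' \<cdot> u) \<bullet> u + diag_form (trace_weight a b a' b') u"
proof -
  let ?s = "\<lambda>n. (cmod (coord u n))\<^sup>2" and ?p = "\<lambda>n. coord u (n + 1) \<bullet> coord u n"
  let ?d = "\<lambda>n. \<bar>a n - a' n\<bar>" and ?e = "\<lambda>n. max 0 (b n - b' n)"
  have cross: "(\<lambda>n. c n * ?p n) summable_on UNIV" if "bounded (range c)" for c :: "int \<Rightarrow> real"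
    using weighted_inner_summable[OF that, of "translate_op 1 \<cdot> u" u] by (simp add: coord_translate_op)
  have sq: "(\<lambda>n. c n * ?s (n + 1)) summable_on UNIV" if "bounded (range c)" for c :: "int \<Rightarrow> real"
    using weighted_square_summable[OF that, of "translate_op 1 \<cdot> u"] by (simp add: coord_translate_op)
  have s0: "(\<lambda>n. c n * ?s n) summable_on UNIV" if "bounded (range c)" for c :: "int \<Rightarrow> real"
    by (rule weighted_square_summable[OF that])
  have "diag_form b u - diag_form b' u = (\<Sum>\<^sub>\<infinity>n. (b n - b' n) * ?s n)"
    unfolding diag_form_def
    by (subst infsum_real_diff) (auto intro: s0 ab ab' simp: algebra_simps)
  also have "\<dots> \<le> (\<Sum>\<^sub>\<infinity>n. ?e n * ?s n)"
    by (intro infsum_mono s0 bounded_diff bounded_abs_diff mult_right_mono) auto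
  finally have 1: "diag_form b u - diag_form b' u \<le> (\<Sum>\<^sub>\<infinity>n. ?e n * ?s n)" .
  have "2 * (\<Sum>\<^sub>\<infinity>n. a n * ?p n) - 2 * (\<Sum>\<^sub>\<infinity>n. a' n * ?p n) = 2 * (\<Sum>\<^sub>\<infinity>n. (a n - a' n) * ?p n)"
    unfolding right_diff_distrib[symmetric]
    by (subst infsum_real_diff) (auto intro: cross ab ab' simp: algebra_simps)
  also have "\<dots> = (\<Sum>\<^sub>\<infinity>n. 2 * ((a n - a' n) * ?p n))"
    by (rule infsum_cmult_right'[symmetric])
  also have "\<dots> \<le> (\<Sum>\<^sub>\<infinity>n. ?d n * ?s n + ?d n * ?s (n + 1))"
  proof (intro infsum_mono summable_on_add summable_on_cmult_right cross sq s0 bounded_diff bounded_abs_diff)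
    fix n
    have "2 * ((a n - a' n) * ?p n) \<le> 2 * (?d n * \<bar>?p n\<bar>)"
      by (metis abs_ge_self abs_mult mult_left_mono zero_le_numeral)
    also have "\<dots> \<le> 2 * (?d n * (cmod (coord u (n + 1)) * cmod (coord u n)))"
      by (intro mult_left_mono Cauchy_Schwarz_ineq2) auto
    also have "\<dots> = ?d n * (2 * cmod (coord u n) * cmod (coord u (n + 1)))" by simp
    also have "\<dots> \<le> ?d n * (?s n + ?s (n + 1))"
      by (intro mult_left_mono sum_squares_bound) auto
    finally show "2 * ((a n - a' n) * ?p n) \<le> ?d n * ?s n + ?d n * ?s (n + 1)"
      by (simp add: distrib_left)
  qed
  also have "\<dots> = (\<Sum>\<^sub>\<infinity>n. ?d n * ?s n) + (\<Sum>\<^sub>\<infinity>n. ?d n * ?s (n + 1))"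
    by (intro infsum_add sq s0 bounded_abs_diff)
  also have "(\<Sum>\<^sub>\<infinity>n. ?d n * ?s (n + 1)) = (\<Sum>\<^sub>\<infinity>n. ?d (n - 1) * ?s n)"
    using infsum_int_shift[of "\<lambda>n. ?d (n - 1) * ?s n" 1] by simp
  finally have 2: "2 * (\<Sum>\<^sub>\<infinity>n. a n * ?p n) - 2 * (\<Sum>\<^sub>\<infinity>n. a' n * ?p n)
      \<le> (\<Sum>\<^sub>\<infinity>n. ?d n * ?s n) + (\<Sum>\<^sub>\<infinity>n. ?d (n - 1) * ?s n)" .
  have sum3: "(\<lambda>n. ?d (n - 1) * ?s n) summable_on UNIV"
    using summable_int_shift[of "\<lambda>n. ?d (n - 1) * ?s n" 1] sq[OF bounded_abs_diff(1)] by simp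
  have "diag_form (trace_weight a b a' b') u = (\<Sum>\<^sub>\<infinity>n. (?e n * ?s n + ?d (n - 1) * ?s n) + ?d n * ?s n)"
    by (simp add: diag_form_def trace_weight_def algebra_simps)
  also have "\<dots> = ((\<Sum>\<^sub>\<infinity>n. ?e n * ?s n) + (\<Sum>\<^sub>\<infinity>n. ?d (n - 1) * ?s n)) + (\<Sum>\<^sub>\<infinity>n. ?d n * ?s n)"
    by (subst infsum_add infsum_add | intro summable_on_add s0 sum3 bounded_abs_diff refl)+
  finally show ?thesis
    using 1 2 jacobi_form[OF ab, of u] jacobi_form[OF ab', of u] by linarith
qed

end

lemma trace_weight_nonneg: "0 \<le> trace_weight a b a' b' n"
  by (simp add: trace_weight_def)

lemma bounded_summable:
  assumes "w summable_on UNIV" "\<And>n. 0 \<le> w n"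
  shows "bounded (range (w :: int \<Rightarrow> real))"
proof -
  have "w n \<le> infsum w UNIV" for n
    using finite_sum_le_infsum[OF assms(1), of "{n}"] assms(2) by auto
  then show ?thesis using assms(2) by (auto simp: bounded_iff)
qed

lemma infsum_finite_sum_swap:
  fixes g :: "'i \<Rightarrow> 'n \<Rightarrow> real"
  assumes "finite B" "\<And>e. e \<in> B \<Longrightarrow> g e summable_on A"
  shows "(\<Sum>e\<in>B. infsum (g e) A) = (\<Sum>\<^sub>\<infinity>n\<in>A. \<Sum>e\<in>B. g e n)" "(\<lambda>n. \<Sum>e\<in>B. g e n) summable_on A"
  using assms by (induction B rule: finite_induct) (simp_all add: infsum_add summable_on_add)

context symmetric_l2_op
begin

lemma abs_resolvent_rotate:
  assumes "bounded_below (shift_op T x)"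
  shows "(abs_resolvent T x \<cdot> cscale_op \<i> \<cdot> u) \<bullet> (cscale_op \<i> \<cdot> u) = (abs_resolvent T x \<cdot> u) \<bullet> u"
proof -
  have "abs_resolvent T x \<cdot> cscale_op \<i> \<cdot> u = cscale_op \<i> \<cdot> abs_resolvent T x \<cdot> u"
    using abs_resolvent_commute[OF sym assms complex_linear] endo_apply_mult by metis
  moreover have "cscale_op \<i> \<cdot> cscale_op \<i> \<cdot> u = - u" for u
    by (rule l2_eqI) simp
  ultimately show ?thesis by (simp add: cscale_op_i_skew)
qed

text \<open>
  The trace of a diagonal weight against \<open>\<bar>T - x\<bar>\<^sup>-\<^sup>1\<close>.  In the real Hilbert space every
  coordinate contributes the two directions \<open>\<delta>\<^sub>n\<close> and \<open>\<i> \<delta>\<^sub>n\<close>, whence the factor 2.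
\<close>

lemma diag_form_trace_le:
  assumes below: "bounded_below (shift_op T x)"
    and diag: "\<And>n. (abs_resolvent T x \<cdot> unit_vec n) \<bullet> unit_vec n \<le> c"
    and w: "w summable_on UNIV" "\<And>n. 0 \<le> w n"
    and B: "form_orthonormal T x \<epsilon> B"
  shows "(\<Sum>e\<in>B. diag_form w e) \<le> 2 * (c * (\<Sum>\<^sub>\<infinity>n. w n))"
proof -
  let ?R = "abs_resolvent T x" and ?I = "cscale_op \<i>"
  have fin: "finite B" using B by (simp add: form_orthonormal_def)
  have col: "(\<Sum>e\<in>B. (cmod (coord e n))\<^sup>2) \<le> 2 * c" for n
  proof -
    have "(\<Sum>e\<in>B. (cmod (coord e n))\<^sup>2)
        = (\<Sum>e\<in>B. (unit_vec n \<bullet> e)\<^sup>2) + (\<Sum>e\<in>B. ((?I \<cdot> unit_vec n) \<bullet> e)\<^sup>2)"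
      by (simp add: unit_vec_inner cscale_unit_vec_inner cmod_power2 sum.distrib)
    also have "\<dots> \<le> (?R \<cdot> unit_vec n) \<bullet> unit_vec n + (?R \<cdot> ?I \<cdot> unit_vec n) \<bullet> (?I \<cdot> unit_vec n)"
      by (intro add_mono form_Bessel[OF sym below B])
    finally show ?thesis using diag[of n] by (simp add: abs_resolvent_rotate[OF below])
  qed
  have sums: "(\<lambda>n. w n * (cmod (coord e n))\<^sup>2) summable_on UNIV" for e
    by (intro weighted_square_summable bounded_summable w)
  have "(\<Sum>e\<in>B. diag_form w e) = (\<Sum>\<^sub>\<infinity>n. \<Sum>e\<in>B. w n * (cmod (coord e n))\<^sup>2)"
    unfolding diag_form_def by (rule infsum_finite_sum_swap[OF fin sums])
  also have "\<dots> \<le> (\<Sum>\<^sub>\<infinity>n. 2 * c * w n)"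
  proof (rule infsum_mono)
    show "(\<lambda>n. \<Sum>e\<in>B. w n * (cmod (coord e n))\<^sup>2) summable_on UNIV"
      by (rule infsum_finite_sum_swap[OF fin sums])
    show "(\<lambda>n. 2 * c * w n) summable_on UNIV"
      by (intro summable_on_cmult_right w)
    show "(\<Sum>e\<in>B. w n * (cmod (coord e n))\<^sup>2) \<le> 2 * c * w n" for n
      using mult_left_mono[OF col[of n] w(2)[of n]] by (simp add: sum_distrib_left mult_ac)
  qed
  also have "\<dots> = 2 * (c * (\<Sum>\<^sub>\<infinity>n. w n))"
    by (simp add: infsum_cmult_right')
  finally show ?thesis .
qed

end

definition eigenvalue :: "'a::real_normed_vector endo \<Rightarrow> real \<Rightarrow> bool" where
  "eigenvalue A l \<longleftrightarrow> (\<exists>u. u \<noteq> 0 \<and> A \<cdot> u = l *\<^sub>R u)"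

lemma eigenvectors_orthogonal:
  assumes "symmetric_op A" "A \<cdot> u = l *\<^sub>R u" "A \<cdot> v = k *\<^sub>R v" "l \<noteq> k"
  shows "u \<bullet> v = 0"
  using symmetric_opD[OF assms(1), of u v] assms(2-4) by simp

text \<open>
  The counting principle applied to the vectors \<open>u\<close> and \<open>\<i> u\<close>, for one eigenvector \<open>u\<close> per
  eigenvalue.  The doubled number of vectors cancels the factor 2 of the traces.
\<close>

theorem eigenvalues_in_gap_le:
  fixes a b a' b' :: "int \<Rightarrow> real"
  defines "T \<equiv> jacobi_op a' b'" and "A \<equiv> jacobi_op a b"
  assumes ab: "bounded (range a)" "bounded (range b)" and ab': "bounded (range a')" "bounded (range b')"
    and trace_class: "(\<lambda>n. \<bar>a n - a' n\<bar> + \<bar>b n - b' n\<bar>) summable_on UNIV"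
    and "x \<le> y" and gap: "{x..y} \<inter> real_spectrum T = {}"
    and diag: "\<And>n. (abs_resolvent T x \<cdot> unit_vec n) \<bullet> unit_vec n \<le> c"
      "\<And>n. (abs_resolvent T y \<cdot> unit_vec n) \<bullet> unit_vec n \<le> d"
    and L: "finite L" "L \<subseteq> {x..y}" "\<And>l. l \<in> L \<Longrightarrow> eigenvalue A l"
  shows "real (card L) \<le> c * (\<Sum>\<^sub>\<infinity>n. trace_weight a b a' b' n) + d * (\<Sum>\<^sub>\<infinity>n. trace_weight a' b' a b n)"
proof -
  interpret T: symmetric_l2_op T "jacobi a' b'"
    unfolding T_def by (rule symmetric_l2_op_jacobi[OF ab'])
  interpret A: symmetric_l2_op A "jacobi a b"
    unfolding A_def by (rule symmetric_l2_op_jacobi[OF ab])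
  have trace_class': "(\<lambda>n. \<bar>a' n - a n\<bar> + \<bar>b' n - b n\<bar>) summable_on UNIV"
    using trace_class by (simp add: abs_minus_commute)
  have below: "bounded_below (shift_op T z)" if "z \<in> {x..y}" for z
    using gap that by (auto simp: real_spectrum_def)
  have sgn: "sign_op T y = sign_op T x"
    using \<open>x \<le> y\<close> by (intro sign_op_constant_on_connected[OF T.sym connected_Icc[of x y]] below) auto
  obtain u where u: "\<And>l. l \<in> L \<Longrightarrow> u l \<noteq> 0" "\<And>l. l \<in> L \<Longrightarrow> A \<cdot> u l = l *\<^sub>R u l"
    using L(3) unfolding eigenvalue_def by metis
  let ?I = "cscale_op \<i>"
  define e where "e q = (if snd q then ?I \<cdot> u (fst q) else u (fst q))" for q :: "real \<times> bool"
  let ?Q = "L \<times> (UNIV :: bool set)"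
  have AI: "A \<cdot> ?I \<cdot> v = ?I \<cdot> A \<cdot> v" for v
    using A.complex_linear[of \<i>] endo_apply_mult by metis
  have Ae: "A \<cdot> e q = fst q *\<^sub>R e q" "e q \<noteq> 0" if "q \<in> ?Q" for q
  proof -
    have "norm (?I \<cdot> u (fst q)) = norm (u (fst q))" by (simp add: norm_cscale_op)
    then show "A \<cdot> e q = fst q *\<^sub>R e q" "e q \<noteq> 0"
      using that u by (auto simp: e_def AI)
  qed
  have ortho: "e q \<bullet> e r = 0" if "q \<in> ?Q" "r \<in> ?Q" "q \<noteq> r" for q r
  proof (cases "fst q = fst r")
    case True
    have "(?I \<cdot> v) \<bullet> v = 0" for v
      using cscale_op_i_skew[of v v] by (simp add: inner_commute)
    then show ?thesis
      using True that(3) by (cases q; cases r) (auto simp: e_def inner_commute[of _ "?I \<cdot> _"])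
  qed (use eigenvectors_orthogonal[OF A.sym Ae(1) Ae(1)] that in blast)
  have inj: "inj_on e ?Q"
    using ortho Ae(2) by (metis inj_onI inner_eq_zero_iff)
  define U where "U = e ` ?Q"
  have "card U = 2 * card L"
    unfolding U_def card_image[OF inj] by (simp add: card_cartesian_product)
  moreover have "real (card U) \<le> 2 * (c * (\<Sum>\<^sub>\<infinity>n. trace_weight a b a' b' n))
      + 2 * (d * (\<Sum>\<^sub>\<infinity>n. trace_weight a' b' a b n))"
  proof (rule eigenvalue_count_le[OF T.sym A.sym _ _ sgn \<open>x \<le> y\<close>,
        where l = "\<lambda>v. fst (inv_into ?Q e v)" and a = "diag_form (trace_weight a b a' b')"
          and b = "diag_form (trace_weight a' b' a b)"])
    show "bounded_below (shift_op T x)" "bounded_below (shift_op T y)"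
      using below \<open>x \<le> y\<close> by auto
    show "finite U" using L(1) by (simp add: U_def)
    show "0 \<notin> U" using Ae(2) by (fastforce simp: U_def)
    show "pairwise orthogonal U"
      unfolding pairwise_def orthogonal_def U_def using ortho by blast
    fix v assume "v \<in> U"
    then have q: "inv_into ?Q e v \<in> ?Q" "e (inv_into ?Q e v) = v"
      unfolding U_def by (rule inv_into_into, rule f_inv_into_f)
    show "A \<cdot> v = fst (inv_into ?Q e v) *\<^sub>R v" using Ae(1)[OF q(1)] q(2) by simp
    show "x \<le> fst (inv_into ?Q e v) \<and> fst (inv_into ?Q e v) \<le> y" using q(1) L(2) by auto
  next
    show "(A \<cdot> v) \<bullet> v \<le> (T \<cdot> v) \<bullet> v + diag_form (trace_weight a b a' b') v" for v
      unfolding A_def T_def by (rule jacobi_form_le[OF ab ab' trace_class])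
    show "(T \<cdot> v) \<bullet> v - diag_form (trace_weight a' b' a b) v \<le> (A \<cdot> v) \<bullet> v" for v
      unfolding A_def T_def using jacobi_form_le[OF ab' ab trace_class', of v] by simp
    show "(\<Sum>e\<in>B. diag_form (trace_weight a b a' b') e) \<le> 2 * (c * (\<Sum>\<^sub>\<infinity>n. trace_weight a b a' b' n))"
      if "form_orthonormal T x (-1) B" for B
      using below \<open>x \<le> y\<close>
      by (intro T.diag_form_trace_le[OF _ diag(1) _ _ that] trace_weight_nonneg
          trace_weight_summable[OF ab ab' trace_class]) auto
    show "(\<Sum>e\<in>B. diag_form (trace_weight a' b' a b) e) \<le> 2 * (d * (\<Sum>\<^sub>\<infinity>n. trace_weight a' b' a b n))"
      if "form_orthonormal T y 1 B" for B
      using below \<open>x \<le> y\<close>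
      by (intro T.diag_form_trace_le[OF _ diag(2) _ _ that] trace_weight_nonneg
          trace_weight_summable[OF ab' ab trace_class']) auto
  qed (simp_all add: diag_form_scaleR)
  ultimately show ?thesis by simp
qed

lemma trace_weight_total:
  assumes trace_class: "(\<lambda>n. \<bar>a n - a' n\<bar> + \<bar>b n - b' n\<bar>) summable_on UNIV"
    and ab: "bounded (range a)" "bounded (range b)" and ab': "bounded (range a')" "bounded (range b')"
  shows "(\<Sum>\<^sub>\<infinity>n. trace_weight a b a' b' n) + (\<Sum>\<^sub>\<infinity>n. trace_weight a' b' a b n)
    = (\<Sum>\<^sub>\<infinity>n. 4 * \<bar>a n - a' n\<bar> + \<bar>b n - b' n\<bar>)"
proof -
  have trace_class': "(\<lambda>n. \<bar>a' n - a n\<bar> + \<bar>b' n - b n\<bar>) summable_on UNIV"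
    using trace_class by (simp add: abs_minus_commute)
  let ?d = "\<lambda>n. \<bar>a n - a' n\<bar>" and ?b = "\<lambda>n. \<bar>b n - b' n\<bar>"
  note d = abs_diff_summable[OF ab ab' trace_class]
  have d': "(\<lambda>n. ?d (n - 1)) summable_on UNIV" "(\<Sum>\<^sub>\<infinity>n. ?d (n - 1)) = (\<Sum>\<^sub>\<infinity>n. ?d n)"
    using d(1) summable_int_shift[of ?d "-1"] infsum_int_shift[of ?d "-1"] by auto
  have "(\<Sum>\<^sub>\<infinity>n. trace_weight a b a' b' n) + (\<Sum>\<^sub>\<infinity>n. trace_weight a' b' a b n)
      = (\<Sum>\<^sub>\<infinity>n. trace_weight a b a' b' n + trace_weight a' b' a b n)"
    by (intro infsum_add[symmetric] trace_weight_summable[OF ab ab' trace_class]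
        trace_weight_summable[OF ab' ab trace_class'])
  also have "\<dots> = (\<Sum>\<^sub>\<infinity>n. (2 * ?d (n - 1) + 2 * ?d n) + ?b n)"
    by (intro infsum_cong) (simp add: trace_weight_def abs_minus_commute[of "a' _"] max_def)
  also have "\<dots> = (\<Sum>\<^sub>\<infinity>n. 2 * ?d (n - 1) + 2 * ?d n) + (\<Sum>\<^sub>\<infinity>n. ?b n)"
    by (intro infsum_add summable_on_add summable_on_cmult_right d d')
  also have "(\<Sum>\<^sub>\<infinity>n. 2 * ?d (n - 1) + 2 * ?d n) = (\<Sum>\<^sub>\<infinity>n. 2 * ?d (n - 1)) + (\<Sum>\<^sub>\<infinity>n. 2 * ?d n)"
    by (intro infsum_add summable_on_cmult_right d d')
  also have "\<dots> = (\<Sum>\<^sub>\<infinity>n. 4 * ?d n)"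
    by (simp add: infsum_cmult_right' d')
  also have "\<dots> + (\<Sum>\<^sub>\<infinity>n. ?b n) = (\<Sum>\<^sub>\<infinity>n. 4 * ?d n + ?b n)"
    by (intro infsum_add[symmetric] summable_on_cmult_right d)
  finally show ?thesis .
qed

section \<open>Stability of the essential spectrum\<close>

lemma norm_mult_op_split:
  assumes "finite F" "\<And>n. n \<notin> F \<Longrightarrow> cmod (c n) \<le> e" "\<And>n. cmod (c n) \<le> K" "0 \<le> e" "0 \<le> K"
  shows "norm (mult_op c \<cdot> u) \<le> e * norm u + K * (\<Sum>n\<in>F. cmod (coord u n))"
proof (rule norm_l2_leI)
  have bdd: "bounded (range c)" using assms(3) by (auto simp: bounded_iff)
  let ?s = "\<Sum>n\<in>F. cmod (coord u n)"
  have s0: "0 \<le> ?s" by (intro sum_nonneg) auto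
  fix G :: "int set" assume G: "finite G"
  have "(cmod (coord (mult_op c \<cdot> u) n))\<^sup>2
      \<le> e\<^sup>2 * (cmod (coord u n))\<^sup>2 + (if n \<in> F then K\<^sup>2 * (cmod (coord u n))\<^sup>2 else 0)" for n
  proof -
    have "(cmod (c n))\<^sup>2 \<le> e\<^sup>2" if "n \<notin> F" using assms(2)[OF that] by (intro power_mono) auto
    moreover have "(cmod (c n))\<^sup>2 \<le> K\<^sup>2" using assms(3)[of n] by (intro power_mono) auto
    ultimately show ?thesis
      by (auto simp: coord_mult_op[OF bdd] norm_mult power_mult_distrib mult_right_mono
          intro: add_increasing)
  qed
  then have "(\<Sum>n\<in>G. (cmod (coord (mult_op c \<cdot> u) n))\<^sup>2)
      \<le> (\<Sum>n\<in>G. e\<^sup>2 * (cmod (coord u n))\<^sup>2 + (if n \<in> F then K\<^sup>2 * (cmod (coord u n))\<^sup>2 else 0))"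
    by (rule sum_mono)
  also have "\<dots> = e\<^sup>2 * (\<Sum>n\<in>G. (cmod (coord u n))\<^sup>2) + K\<^sup>2 * (\<Sum>n\<in>G \<inter> F. (cmod (coord u n))\<^sup>2)"
    using G by (simp add: sum.distrib sum_distrib_left sum.inter_restrict) (auto intro!: sum.cong)
  also have "\<dots> \<le> e\<^sup>2 * (norm u)\<^sup>2 + K\<^sup>2 * ?s\<^sup>2"
  proof (intro add_mono mult_left_mono coord_sum_le_norm G)
    have "(\<Sum>n\<in>G \<inter> F. (cmod (coord u n))\<^sup>2) \<le> (\<Sum>n\<in>F. (cmod (coord u n))\<^sup>2)"
      using assms(1) by (intro sum_mono2) auto
    also have "\<dots> \<le> ?s\<^sup>2"
      using L2_set_le_sum[of F "\<lambda>n. cmod (coord u n)"] s0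
      by (simp add: L2_set_def real_sqrt_le_iff sqrt_le_D)
    finally show "(\<Sum>n\<in>G \<inter> F. (cmod (coord u n))\<^sup>2) \<le> ?s\<^sup>2" .
  qed auto
  also have "\<dots> \<le> (e * norm u + K * ?s)\<^sup>2"
    using assms(4,5) s0 by (simp add: power2_sum power_mult_distrib)
  finally show "(\<Sum>n\<in>G. (cmod (coord (mult_op c \<cdot> u) n))\<^sup>2) \<le> (e * norm u + K * ?s)\<^sup>2" .
qed (use assms(4,5) in \<open>auto intro!: add_nonneg_nonneg mult_nonneg_nonneg sum_nonneg\<close>)

lemma norm_translate_op: "norm (translate_op k \<cdot> u) = norm u"
proof -
  have "(translate_op k \<cdot> u) \<bullet> (translate_op k \<cdot> u) = u \<bullet> u"
  proof -
    have "translate_op (- k) \<cdot> translate_op k \<cdot> u = u"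
      by (rule l2_eqI) (simp add: coord_translate_op)
    then show ?thesis by (simp add: translate_op_adjoint)
  qed
  then show ?thesis by (simp add: norm_eq_sqrt_inner)
qed

lemma summable_finite_exceptions:
  fixes w :: "int \<Rightarrow> real"
  assumes "w summable_on UNIV" "\<And>n. 0 \<le> w n" "0 < e"
  obtains F where "finite F" "\<And>n. n \<notin> F \<Longrightarrow> w n \<le> e"
proof -
  have "(sum w \<longlongrightarrow> infsum w UNIV) (finite_subsets_at_top UNIV)"
    using assms(1) by (rule infsum_tendsto)
  then have "\<forall>\<^sub>F F in finite_subsets_at_top UNIV. infsum w UNIV - e < sum w F"
    using assms(3) by (intro order_tendstoD) auto
  then obtain F where F: "finite F" "infsum w UNIV - e < sum w F"
    unfolding eventually_finite_subsets_at_top by blast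
  have "w n \<le> e" if n: "n \<notin> F" for n
  proof -
    have "sum w (insert n F) \<le> infsum w UNIV"
      using F(1) by (intro finite_sum_le_infsum assms) auto
    then show ?thesis using F n by simp
  qed
  then show thesis using that F(1) by blast
qed

text \<open>
  The perturbation is compact: up to an arbitrarily small operator it only sees finitely many
  coordinates.
\<close>

lemma jacobi_diff_compact:
  fixes a b a' b' :: "int \<Rightarrow> real"
  assumes ab: "bounded (range a)" "bounded (range b)" and ab': "bounded (range a')" "bounded (range b')"
    and trace_class: "(\<lambda>n. \<bar>a n - a' n\<bar> + \<bar>b n - b' n\<bar>) summable_on UNIV"
    and "0 < e"
  obtains F C where "finite F" "0 \<le> C"
    "\<And>u. norm ((jacobi_op a b - jacobi_op a' b') \<cdot> u) \<le> e * norm u + C * (\<Sum>n\<in>F. cmod (coord u n))"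
proof -
  let ?a = "\<lambda>n. complex_of_real (a n - a' n)" and ?b = "\<lambda>n. complex_of_real (b n - b' n)"
  let ?w = "\<lambda>n. \<bar>a n - a' n\<bar> + \<bar>b n - b' n\<bar>"
  obtain F where F: "finite F" "\<And>n. n \<notin> F \<Longrightarrow> ?w n \<le> e / 3"
    using summable_finite_exceptions[OF trace_class, of "e / 3"] \<open>0 < e\<close> by auto
  have "bounded (range ?w)" by (rule bounded_summable[OF trace_class]) auto
  then obtain K where "\<And>n. \<bar>?w n\<bar> \<le> K" by (auto simp: bounded_iff)
  then have K: "?w n \<le> K" for n by (meson abs_le_D1)
  then have K0: "0 \<le> K" by (meson abs_ge_zero add_nonneg_nonneg order_trans)
  have small: "cmod (?a n) \<le> e / 3" "cmod (?b n) \<le> e / 3" if "n \<notin> F" for n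
    using F(2)[OF that] unfolding norm_of_real by linarith+
  have bdd: "cmod (?a n) \<le> K" "cmod (?b n) \<le> K" for n
    using K[of n] unfolding norm_of_real by linarith+
  define F' where "F' = F \<union> (\<lambda>n. n + 1) ` F"
  let ?s = "\<lambda>u. \<Sum>n\<in>F'. cmod (coord u n)"
  have D: "jacobi_op a b - jacobi_op a' b' = jacobi_op (\<lambda>n. a n - a' n) (\<lambda>n. b n - b' n)"
  proof (intro endo_eqI l2_eqI)
    fix u n
    have "bounded (range (\<lambda>n. a n - a' n))" "bounded (range (\<lambda>n. b n - b' n))"
      using ab ab' by (auto intro: bounded_minus_comp)
    then show "coord ((jacobi_op a b - jacobi_op a' b') \<cdot> u) n
        = coord (jacobi_op (\<lambda>n. a n - a' n) (\<lambda>n. b n - b' n) \<cdot> u) n"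
      using ab ab' by (simp add: coord_jacobi_op) (simp add: jacobi_def algebra_simps)
  qed
  show thesis
  proof (rule that[of F' "3 * K"])
    show "finite F'" "0 \<le> 3 * K" using F(1) K0 by (auto simp: F'_def)
    fix u
    have s1: "(\<Sum>n\<in>F. cmod (coord u n)) \<le> ?s u"
      using F(1) by (intro sum_mono2) (auto simp: F'_def)
    have "(\<Sum>n\<in>F. cmod (coord u (n + 1))) = (\<Sum>n\<in>(\<lambda>n. n + 1) ` F. cmod (coord u n))"
      by (subst sum.reindex) (auto simp: inj_on_def)
    also have "\<dots> \<le> ?s u"
      using F(1) by (intro sum_mono2) (auto simp: F'_def)
    finally have s2: "(\<Sum>n\<in>F. cmod (coord u (n + 1))) \<le> ?s u" .
    have e0: "0 \<le> e / 3" using \<open>0 < e\<close> by simp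
    have A: "norm (mult_op ?a \<cdot> v) \<le> e / 3 * norm v + K * (\<Sum>n\<in>F. cmod (coord v n))"
      and B: "norm (mult_op ?b \<cdot> v) \<le> e / 3 * norm v + K * (\<Sum>n\<in>F. cmod (coord v n))" for v
      by (intro norm_mult_op_split F(1) small bdd e0 K0; assumption)+
    have 1: "norm (mult_op ?a \<cdot> u) \<le> e / 3 * norm u + K * ?s u"
      using A[of u] mult_left_mono[OF s1 K0] by linarith
    have 2: "norm (mult_op ?b \<cdot> u) \<le> e / 3 * norm u + K * ?s u"
      using B[of u] mult_left_mono[OF s1 K0] by linarith
    have 3: "norm (mult_op ?a \<cdot> translate_op 1 \<cdot> u) \<le> e / 3 * norm u + K * ?s u"
      using A[of "translate_op 1 \<cdot> u"] mult_left_mono[OF s2 K0]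
      by (simp add: norm_translate_op coord_translate_op)
    have tri: "norm (p + q + r) \<le> norm p + norm q + norm r" for p q r :: l2
      using norm_triangle_ineq[of "p + q" r] norm_triangle_ineq[of p q] by linarith
    have "norm ((jacobi_op a b - jacobi_op a' b') \<cdot> u)
        \<le> norm (mult_op ?a \<cdot> u) + norm (mult_op ?b \<cdot> u) + norm (mult_op ?a \<cdot> translate_op 1 \<cdot> u)"
      using tri[of "translate_op (-1) \<cdot> mult_op ?a \<cdot> u" "mult_op ?b \<cdot> u" "mult_op ?a \<cdot> translate_op 1 \<cdot> u"]
      unfolding D unfolding jacobi_op_def by (simp add: norm_translate_op)
    then show "norm ((jacobi_op a b - jacobi_op a' b') \<cdot> u) \<le> e * norm u + 3 * K * ?s u"
      using 1 2 3 by (simp add: algebra_simps)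
  qed
qed

text \<open>A lower bound modulo finitely many coordinates, which survives compact perturbations.\<close>

definition almost_bounded_below :: "l2 endo \<Rightarrow> bool" where
  "almost_bounded_below A \<longleftrightarrow> (\<exists>\<eta>>0. \<exists>F C. finite F \<and> 0 \<le> C \<and>
     (\<forall>u. \<eta> * norm u \<le> norm (A \<cdot> u) + C * (\<Sum>n\<in>F. cmod (coord u n))))"

lemma almost_bounded_below_jacobi:
  fixes a b a' b' :: "int \<Rightarrow> real"
  assumes ab: "bounded (range a)" "bounded (range b)" and ab': "bounded (range a')" "bounded (range b')"
    and trace_class: "(\<lambda>n. \<bar>a n - a' n\<bar> + \<bar>b n - b' n\<bar>) summable_on UNIV"
    and below: "bounded_below (shift_op (jacobi_op a' b') x)"
  shows "almost_bounded_below (shift_op (jacobi_op a b) x)"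
proof -
  obtain \<eta> where \<eta>: "\<eta> > 0" "\<And>u. \<eta> * norm u \<le> norm (shift_op (jacobi_op a' b') x \<cdot> u)"
    using below by (auto simp: bounded_below_def)
  obtain F C where FC: "finite F" "0 \<le> C"
    "\<And>u. norm ((jacobi_op a b - jacobi_op a' b') \<cdot> u) \<le> \<eta> / 2 * norm u + C * (\<Sum>n\<in>F. cmod (coord u n))"
    using jacobi_diff_compact[OF ab ab' trace_class, of "\<eta> / 2"] \<eta>(1) by auto
  have "\<eta> / 2 * norm u \<le> norm (shift_op (jacobi_op a b) x \<cdot> u) + C * (\<Sum>n\<in>F. cmod (coord u n))" for u
  proof -
    have "shift_op (jacobi_op a' b') x \<cdot> u
        = shift_op (jacobi_op a b) x \<cdot> u - (jacobi_op a b - jacobi_op a' b') \<cdot> u" by simp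
    then have "norm (shift_op (jacobi_op a' b') x \<cdot> u)
        \<le> norm (shift_op (jacobi_op a b) x \<cdot> u) + norm ((jacobi_op a b - jacobi_op a' b') \<cdot> u)"
      by (metis norm_triangle_ineq4)
    then show ?thesis using \<eta>(2)[of u] FC(3)[of u] by (simp add: field_simps del: shift_op_apply)
  qed
  then show ?thesis
    unfolding almost_bounded_below_def using \<eta>(1) FC(1,2) by (intro exI[of _ "\<eta> / 2"]) auto
qed

lemma convergent_subsequence_finite:
  fixes X :: "nat \<Rightarrow> int \<Rightarrow> complex"
  assumes "finite F" "\<And>n. bounded (range (\<lambda>k. X k n))"
  shows "\<exists>r. strict_mono (r :: nat \<Rightarrow> nat) \<and> (\<forall>n\<in>F. convergent (\<lambda>k. X (r k) n))"
  using assms(1)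
proof induction
  case empty
  then show ?case by (intro exI[of _ id]) (auto simp: strict_mono_def)
next
  case (insert m F)
  then obtain r where r: "strict_mono (r :: nat \<Rightarrow> nat)" "\<forall>n\<in>F. convergent (\<lambda>k. X (r k) n)" by blast
  have "bounded (range (\<lambda>k. X (r k) m))"
    by (rule bounded_subset[OF assms(2)[of m]]) auto
  then obtain l q where q: "strict_mono (q :: nat \<Rightarrow> nat)" "((\<lambda>k. X (r k) m) \<circ> q) \<longlonglongrightarrow> l"
    using bounded_imp_convergent_subsequence by blast
  have "convergent (\<lambda>k. X (r (q k)) n)" if "n \<in> insert m F" for n
  proof (cases "n = m")
    case True
    then show ?thesis using q(2) by (auto simp: convergent_def comp_def)
  next
    case False
    then have "convergent (\<lambda>k. X (r k) n)" using r(2) that by blast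
    then show ?thesis
      using convergent_subseq_convergent[OF _ q(1)] by (force simp: comp_def)
  qed
  then show ?case
    using strict_mono_o[OF r(1) q(1)] unfolding comp_def by blast
qed

text \<open>
  Approximate eigenvectors have a convergent subsequence, since along it the finitely many
  exceptional coordinates converge.
\<close>

lemma almost_bounded_below_eigenvalue:
  assumes almost: "almost_bounded_below (shift_op A x)" and x: "x \<in> real_spectrum A"
  shows "eigenvalue A x"
proof -
  let ?M = "shift_op A x"
  obtain \<eta> F C where \<eta>: "\<eta> > 0" "finite F" "0 \<le> C"
    "\<And>u. \<eta> * norm u \<le> norm (?M \<cdot> u) + C * (\<Sum>n\<in>F. cmod (coord u n))"
    using almost unfolding almost_bounded_below_def by blast
  have "\<exists>u. norm u = 1 \<and> norm (?M \<cdot> u) \<le> 1 / real (Suc k)" for k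
  proof -
    have "\<not> (\<forall>v. 1 / real (Suc k) * norm v \<le> norm (?M \<cdot> v))"
    proof
      assume "\<forall>v. 1 / real (Suc k) * norm v \<le> norm (?M \<cdot> v)"
      then have "bounded_below ?M"
        unfolding bounded_below_def by (intro exI[of _ "1 / real (Suc k)"]) simp
      then show False using x by (simp add: real_spectrum_def)
    qed
    then obtain v where v: "\<not> 1 / real (Suc k) * norm v \<le> norm (?M \<cdot> v)" by blast
    then have "v \<noteq> 0" by auto
    have "?M \<cdot> ((1 / norm v) *\<^sub>R v) = (1 / norm v) *\<^sub>R (?M \<cdot> v)" by (rule endo_apply_simps)
    then have "norm (?M \<cdot> ((1 / norm v) *\<^sub>R v)) = norm (?M \<cdot> v) / norm v" by simp
    also have "\<dots> \<le> 1 / real (Suc k)"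
      using v \<open>v \<noteq> 0\<close> by (simp add: field_simps del: shift_op_apply)
    finally show ?thesis using \<open>v \<noteq> 0\<close> by (intro exI[of _ "(1 / norm v) *\<^sub>R v"]) simp
  qed
  then obtain X where X: "\<And>k. norm (X k) = 1" "\<And>k. norm (?M \<cdot> X k) \<le> 1 / real (Suc k)" by metis
  have "bounded (range (\<lambda>k. coord (X k) n))" for n
    using X(1) coord_le_norm[of "X _" n] by (auto simp: bounded_iff intro!: exI[of _ 1])
  then obtain r where r: "strict_mono (r :: nat \<Rightarrow> nat)" "\<And>n. n \<in> F \<Longrightarrow> convergent (\<lambda>k. coord (X (r k)) n)"
    using convergent_subsequence_finite[OF \<eta>(2), of "\<lambda>k. coord (X k)"] by blast
  have inv0: "(\<lambda>k. 1 / real (Suc (r k))) \<longlonglongrightarrow> 0"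
    using LIMSEQ_subseq_LIMSEQ[OF LIMSEQ_Suc[OF lim_1_over_n] r(1)] by (simp add: comp_def)
  have M0: "(\<lambda>k. ?M \<cdot> X (r k)) \<longlonglongrightarrow> 0"
    by (rule tendsto_norm_zero_cancel, rule Lim_null_comparison[OF _ inv0]) (use X(2) in auto)
  have "Cauchy (\<lambda>k. X (r k))"
    unfolding Cauchy_iff
  proof (intro allI impI)
    fix e :: real assume "e > 0"
    define P where "P = 1 + C * (1 + real (card F))"
    define d where "d = e * \<eta> / (2 * P)"
    have den: "0 < P"
      unfolding P_def using \<eta>(3) by (intro add_pos_nonneg mult_nonneg_nonneg) auto
    then have "d > 0" using \<open>e > 0\<close> \<eta>(1) by (simp add: d_def)
    have "\<exists>N. \<forall>j\<ge>N. \<forall>k\<ge>N. cmod (coord (X (r j)) n - coord (X (r k)) n) < d" if "n \<in> F" for n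
      using r(2)[OF that] \<open>d > 0\<close> unfolding Cauchy_convergent_iff[symmetric] Cauchy_iff by blast
    then obtain N where N: "\<And>n j k. n \<in> F \<Longrightarrow> j \<ge> N n \<Longrightarrow> k \<ge> N n \<Longrightarrow>
        cmod (coord (X (r j)) n - coord (X (r k)) n) < d" by metis
    have "Cauchy (\<lambda>k. ?M \<cdot> X (r k))" using M0 by (intro LIMSEQ_imp_Cauchy)
    then obtain N' where N': "\<And>j k. j \<ge> N' \<Longrightarrow> k \<ge> N' \<Longrightarrow> norm (?M \<cdot> X (r j) - ?M \<cdot> X (r k)) < d"
      using \<open>d > 0\<close> unfolding Cauchy_iff by metis
    define N0 where "N0 = N' + (\<Sum>n\<in>F. N n)"
    have N0: "N n \<le> N0" if "n \<in> F" for n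
      using member_le_sum[OF that, of N] \<eta>(2) by (simp add: N0_def)
    have "norm (X (r j) - X (r k)) < e" if "j \<ge> N0" "k \<ge> N0" for j k
    proof -
      have "(\<Sum>n\<in>F. cmod (coord (X (r j) - X (r k)) n)) \<le> (\<Sum>n\<in>F. d)"
        by (intro sum_mono less_imp_le) (simp, meson N N0 that order_trans)
      then have s: "C * (\<Sum>n\<in>F. cmod (coord (X (r j) - X (r k)) n)) \<le> C * (real (card F) * d)"
        using \<eta>(3) by (intro mult_left_mono) auto
      have "norm (?M \<cdot> (X (r j) - X (r k))) \<le> d"
        using N'[of j k] that by (simp only: endo_apply_simps) (auto simp: N0_def)
      then have "\<eta> * norm (X (r j) - X (r k)) \<le> d + C * (real (card F) * d)"
        using \<eta>(4)[of "X (r j) - X (r k)"] s by linarith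
      also have "\<dots> \<le> d * P"
        using \<open>d > 0\<close> \<eta>(3) by (simp add: P_def algebra_simps)
      also have "\<dots> = e * \<eta> / 2" using den by (simp add: d_def)
      also have "\<dots> < \<eta> * e" using \<open>e > 0\<close> \<eta>(1) by simp
      finally show ?thesis using \<eta>(1) by simp
    qed
    then show "\<exists>N. \<forall>j\<ge>N. \<forall>k\<ge>N. norm (X (r j) - X (r k)) < e" by blast
  qed
  then obtain u where u: "(\<lambda>k. X (r k)) \<longlonglongrightarrow> u"
    by (auto simp: Cauchy_convergent_iff convergent_def)
  have "(\<lambda>k. norm (X (r k))) \<longlonglongrightarrow> norm u" by (intro tendsto_intros u)
  then have "norm u = 1" using X(1) LIMSEQ_unique[OF tendsto_const] by fastforce
  have "(\<lambda>k. ?M \<cdot> X (r k)) \<longlonglongrightarrow> ?M \<cdot> u"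
    by (rule bounded_linear.tendsto[OF bounded_linear_endo_apply u])
  then have "?M \<cdot> u = 0" using M0 LIMSEQ_unique by blast
  then show ?thesis
    unfolding eigenvalue_def using \<open>norm u = 1\<close> by (intro exI[of _ u]) auto
qed

lemma diagonal_le_norm: "(B \<cdot> unit_vec n) \<bullet> unit_vec n \<le> norm B"
  using norm_cauchy_schwarz[of "B \<cdot> unit_vec n" "unit_vec n"] norm_endo_apply[of B "unit_vec n"] by simp

text \<open>
  Weyl's theorem for a spectral gap.  In the gap of \<open>T\<close> the spectrum of \<open>A\<close> consists of
  eigenvalues.  They cannot accumulate, since the counting principle bounds their number in a
  neighbourhood; the diagonal entries it needs are bounded by the operator norm.
\<close>

theorem perturbed_gap_isolated_eigenvalue:
  fixes a b a' b' :: "int \<Rightarrow> real"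
  defines "T \<equiv> jacobi_op a' b'" and "A \<equiv> jacobi_op a b"
  assumes ab: "bounded (range a)" "bounded (range b)" and ab': "bounded (range a')" "bounded (range b')"
    and trace_class: "(\<lambda>n. \<bar>a n - a' n\<bar> + \<bar>b n - b' n\<bar>) summable_on UNIV"
    and x: "x \<notin> real_spectrum T"
  shows "x \<in> real_spectrum A \<Longrightarrow> eigenvalue A x"
    and "\<exists>d>0. \<forall>l. 0 < \<bar>l - x\<bar> \<and> \<bar>l - x\<bar> < d \<longrightarrow> l \<notin> real_spectrum A"
proof -
  have almost: "almost_bounded_below (shift_op A l)" if "l \<notin> real_spectrum T" for l
    using almost_bounded_below_jacobi[OF ab ab' trace_class, of l] that
    by (simp add: A_def T_def real_spectrum_def)
  then have eig: "eigenvalue A l" if "l \<notin> real_spectrum T" "l \<in> real_spectrum A" for l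
    using almost_bounded_below_eigenvalue that by blast
  then show "x \<in> real_spectrum A \<Longrightarrow> eigenvalue A x" using x by blast
  have "open (- real_spectrum T)" using compact_imp_closed[OF compact_real_spectrum] by blast
  then obtain e where e: "e > 0" "ball x e \<subseteq> - real_spectrum T"
    using x unfolding open_contains_ball by blast
  define d where "d = e / 2"
  have "d > 0" using e(1) by (simp add: d_def)
  have gap: "{x - d..x + d} \<inter> real_spectrum T = {}"
    using e by (force simp: d_def dist_real_def)
  define c where "c = norm (abs_resolvent T (x - d)) * (\<Sum>\<^sub>\<infinity>n. trace_weight a b a' b' n)
    + norm (abs_resolvent T (x + d)) * (\<Sum>\<^sub>\<infinity>n. trace_weight a' b' a b n)"
  have "finite {l \<in> {x - d..x + d}. eigenvalue A l}"
  proof (rule ccontr)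
    assume "infinite {l \<in> {x - d..x + d}. eigenvalue A l}"
    then obtain L where L: "L \<subseteq> {l \<in> {x - d..x + d}. eigenvalue A l}" "finite L" "card L = Suc (nat \<lceil>c\<rceil>)"
      using infinite_arbitrarily_large by blast
    have "real (card L) \<le> c"
      unfolding c_def
      by (rule eigenvalues_in_gap_le[OF ab ab' trace_class, folded T_def A_def, OF _ gap])
        (use \<open>d > 0\<close> L in \<open>auto intro: diagonal_le_norm\<close>)
    then show False using L(3) by linarith
  qed
  then obtain d' where d': "d' > 0" "\<And>l. l \<in> {x - d..x + d} \<Longrightarrow> eigenvalue A l \<Longrightarrow> l \<noteq> x \<Longrightarrow> d' \<le> dist x l"
    using finite_set_avoid[of "{l \<in> {x - d..x + d}. eigenvalue A l}" x] by blast
  show "\<exists>d>0. \<forall>l. 0 < \<bar>l - x\<bar> \<and> \<bar>l - x\<bar> < d \<longrightarrow> l \<notin> real_spectrum A"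
  proof (intro exI[of _ "min d d'"] conjI allI impI notI)
    fix l assume l: "0 < \<bar>l - x\<bar> \<and> \<bar>l - x\<bar> < min d d'" "l \<in> real_spectrum A"
    then have near: "l \<in> {x - d..x + d}" by auto
    then have "l \<notin> real_spectrum T" using gap by blast
    then have "d' \<le> dist x l" using d'(2)[OF near eig] l by auto
    then show False using l by (simp add: dist_real_def abs_minus_commute)
  qed (use \<open>d > 0\<close> d' in simp)
qed


section \<open>Isolated points of the spectrum\<close>

text \<open>
  If the signs on the two sides of an isolated point \<open>l\<close> agreed, \<open>T - l\<close> would be bounded
  below.  So they differ, and on their difference the form of \<open>T - l\<close> vanishes.
\<close>

lemma isolated_spectrum_eigenvalue:
  fixes T :: "'a::{real_inner, banach, perfect_space} endo"
  assumes T: "symmetric_op T" and l: "l \<in> real_spectrum T" and "d > 0"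
    and iso: "\<And>x. 0 < \<bar>x - l\<bar> \<Longrightarrow> \<bar>x - l\<bar> < d \<Longrightarrow> x \<notin> real_spectrum T"
  shows "eigenvalue T l"
proof -
  have below: "bounded_below (shift_op T x)" if "x \<in> {l - d<..<l} \<union> {l<..<l + d}" for x
    using iso[of x] that by (auto simp: real_spectrum_def)
  define S\<^sub>l S\<^sub>r where "S\<^sub>l = sign_op T (l - d/2)" and "S\<^sub>r = sign_op T (l + d/2)"
  have Sl: "sign_op T x = S\<^sub>l" if "x \<in> {l - d<..<l}" for x
    unfolding S\<^sub>l_def using that \<open>d > 0\<close> below
    by (intro sign_op_constant_on_connected[OF T, of "{l - d<..<l}"]) auto
  have Sr: "sign_op T x = S\<^sub>r" if "x \<in> {l<..<l + d}" for x
    unfolding S\<^sub>r_def using that \<open>d > 0\<close> below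
    by (intro sign_op_constant_on_connected[OF T, of "{l<..<l + d}"]) auto
  have left: "0 \<le> (shift_op T x \<cdot> S\<^sub>l \<cdot> u) \<bullet> u" if "x \<in> {l - d<..<l}" for x u
    using abs_form_nonneg[OF T below, of x u] Sl[OF that] that by (simp del: shift_op_apply)
  have right: "0 \<le> (shift_op T x \<cdot> S\<^sub>r \<cdot> u) \<bullet> u" if "x \<in> {l<..<l + d}" for x u
    using abs_form_nonneg[OF T below, of x u] Sr[OF that] that by (simp del: shift_op_apply)
  have lr: "l - d/2 \<in> {l - d<..<l}" "l + d/2 \<in> {l<..<l + d}" using \<open>d > 0\<close> by auto
  note inv = sign_op_involution[OF T below[OF UnI1[OF lr(1)]], folded S\<^sub>l_def]
    sign_op_involution[OF T below[OF UnI2[OF lr(2)]], folded S\<^sub>r_def]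
  have TS: "T * S\<^sub>l = S\<^sub>l * T" "T * S\<^sub>r = S\<^sub>r * T"
    unfolding S\<^sub>l_def S\<^sub>r_def using below lr by (intro sign_op_commute[OF T]; force)+
  have comm: "S\<^sub>r \<cdot> S\<^sub>l \<cdot> v = S\<^sub>l \<cdot> S\<^sub>r \<cdot> v" for v
  proof -
    have "S\<^sub>r * S\<^sub>l = S\<^sub>l * S\<^sub>r"
      unfolding S\<^sub>l_def by (rule sign_op_commute[OF T below]) (use lr TS in auto)
    then show ?thesis using endo_apply_mult by metis
  qed
  have neq: "S\<^sub>l \<noteq> S\<^sub>r"
  proof
    assume eq: "S\<^sub>l = S\<^sub>r"
    have "d / 4 * norm u \<le> norm (shift_op T l \<cdot> u)" for u
    proof -
      define p m where "p = (1/2) *\<^sub>R (u + S\<^sub>l \<cdot> u)" and "m = (1/2) *\<^sub>R (u - S\<^sub>l \<cdot> u)"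
      have S: "S\<^sub>r \<cdot> p = p" "S\<^sub>l \<cdot> m = - m"
        by (simp_all add: p_def m_def inv eq algebra_simps)
      have u: "u = p + m" "S\<^sub>l \<cdot> u = p - m"
        by (simp_all add: p_def m_def algebra_simps flip: scaleR_add_left)
      have p: "d / 2 * (norm p)\<^sup>2 \<le> (shift_op T l \<cdot> p) \<bullet> p"
        using right[OF lr(2), of p] S by (simp add: inner_diff_left power2_norm_eq_inner algebra_simps)
      have m: "d / 2 * (norm m)\<^sup>2 \<le> - ((shift_op T l \<cdot> m) \<bullet> m)"
        using left[OF lr(1), of m] S by (simp add: inner_diff_left power2_norm_eq_inner algebra_simps)
      have "(norm u)\<^sup>2 \<le> (norm p + norm m)\<^sup>2"
        unfolding u(1) by (intro power_mono norm_triangle_ineq) auto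
      also have "\<dots> \<le> 2 * ((norm p)\<^sup>2 + (norm m)\<^sup>2)"
        using sum_squares_bound[of "norm p" "norm m"] by (simp add: power2_sum)
      finally have "d / 4 * (norm u)\<^sup>2 \<le> d / 4 * (2 * ((norm p)\<^sup>2 + (norm m)\<^sup>2))"
        using \<open>d > 0\<close> by (intro mult_left_mono) auto
      also have "\<dots> = d / 2 * (norm p)\<^sup>2 + d / 2 * (norm m)\<^sup>2" by (simp add: algebra_simps)
      also have "\<dots> \<le> (shift_op T l \<cdot> p) \<bullet> p - (shift_op T l \<cdot> m) \<bullet> m"
        using p m by linarith
      also have "\<dots> = (shift_op T l \<cdot> u) \<bullet> (S\<^sub>l \<cdot> u)"
      proof -
        have "(shift_op T l \<cdot> m) \<bullet> p = (shift_op T l \<cdot> p) \<bullet> m"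
          using symmetric_opD[OF symmetric_shift_op[OF T]] by (metis inner_commute)
        then show ?thesis
          unfolding u(2) unfolding u(1) endo_apply_simps(7) inner_add_left inner_diff_right by linarith
      qed
      also have "\<dots> \<le> norm (shift_op T l \<cdot> u) * norm (S\<^sub>l \<cdot> u)" by (rule norm_cauchy_schwarz)
      also have "norm (S\<^sub>l \<cdot> u) = norm u"
        unfolding S\<^sub>l_def by (rule norm_sign_op[OF T below]) (use lr in auto)
      finally have "(d / 4 * norm u) * norm u \<le> norm (shift_op T l \<cdot> u) * norm u"
        by (simp add: power2_eq_square mult.assoc)
      then show ?thesis by (cases "u = 0") (auto simp: mult_le_cancel_right)
    qed
    then have "bounded_below (shift_op T l)"
      unfolding bounded_below_def using \<open>d > 0\<close> by (intro exI[of _ "d / 4"]) auto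
    then show False using l by (simp add: real_spectrum_def)
  qed
  then obtain u where u: "S\<^sub>l \<cdot> u \<noteq> S\<^sub>r \<cdot> u" using endo_eqI by blast
  \<comment> \<open>\<open>v = (1 - S\<^sub>l) (1 + S\<^sub>r) u\<close>: there \<open>T\<close> would be below \<open>l - d/2\<close> and above \<open>l + d/2\<close>.\<close>
  define v where "v = u - S\<^sub>l \<cdot> u + S\<^sub>r \<cdot> u - S\<^sub>l \<cdot> S\<^sub>r \<cdot> u"
  have "S\<^sub>l \<cdot> v = - v" "S\<^sub>r \<cdot> v = v" by (simp_all add: v_def inv comm)
  then have "d * (norm v)\<^sup>2 \<le> 0"
    using left[OF lr(1), of v] right[OF lr(2), of v]
    by (simp add: inner_diff_left power2_norm_eq_inner algebra_simps)
  then have "v = 0" using \<open>d > 0\<close> by (simp add: mult_le_0_iff)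
  \<comment> \<open>\<open>w = (1 + S\<^sub>l) (1 - S\<^sub>r) u\<close>: the spectral subspace of the isolated point.\<close>
  define w where "w = u + S\<^sub>l \<cdot> u - S\<^sub>r \<cdot> u - S\<^sub>l \<cdot> S\<^sub>r \<cdot> u"
  have "w = w - v" using \<open>v = 0\<close> by simp
  also have "w - v = 2 *\<^sub>R (S\<^sub>l \<cdot> u - S\<^sub>r \<cdot> u)" by (simp add: w_def v_def scaleR_2)
  finally have "w \<noteq> 0" using u by simp
  have Sw: "S\<^sub>l \<cdot> w = w" "S\<^sub>r \<cdot> w = - w" by (simp_all add: w_def inv comm)
  have zero: "(shift_op T l \<cdot> y) \<bullet> y = 0" if y: "S\<^sub>l \<cdot> y = y" "S\<^sub>r \<cdot> y = - y" for y
  proof -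
    have a: "- (e * (norm y)\<^sup>2) \<le> (shift_op T l \<cdot> y) \<bullet> y" "(shift_op T l \<cdot> y) \<bullet> y \<le> e * (norm y)\<^sup>2"
      if "0 < e" "e < d" for e
      using left[of "l - e" y] right[of "l + e" y] y that
      by (simp_all add: inner_diff_left power2_norm_eq_inner algebra_simps)
    have b: "\<bar>(shift_op T l \<cdot> y) \<bullet> y\<bar> \<le> e * (norm y)\<^sup>2" if "0 < e" "e < d" for e
      using a[OF that] by linarith
    show ?thesis
    proof (rule ccontr)
      define q where "q = \<bar>(shift_op T l \<cdot> y) \<bullet> y\<bar>"
      define N where "N = 1 + (norm y)\<^sup>2"
      define e where "e = min (d / 2) (q / (2 * N))"
      assume "\<not> ?thesis"
      then have "q > 0" by (simp add: q_def)
      have n: "0 < N" by (simp add: N_def add_pos_nonneg)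
      have e: "0 < e" "e < d" using \<open>q > 0\<close> \<open>d > 0\<close> n by (auto simp: e_def)
      have "q \<le> e * N" using b[OF e] e by (simp add: q_def N_def distrib_left del: shift_op_apply)
      also have "\<dots> \<le> q / (2 * N) * N"
        using n by (intro mult_right_mono) (auto simp: e_def)
      also have "\<dots> = q / 2" using n by simp
      finally show False using \<open>q > 0\<close> by simp
    qed
  qed
  \<comment> \<open>The form also vanishes at \<open>w + z\<close>, and the mixed term is \<open>2 \<parallel>z\<parallel>\<^sup>2\<close>.\<close>
  define z where "z = shift_op T l \<cdot> w"
  have "S\<^sub>l * shift_op T l = shift_op T l * S\<^sub>l" "S\<^sub>r * shift_op T l = shift_op T l * S\<^sub>r"
    using TS by (intro shift_op_commute; simp)+
  then have Sz: "S\<^sub>l \<cdot> z = z" "S\<^sub>r \<cdot> z = - z"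
  proof -
    assume "S\<^sub>l * shift_op T l = shift_op T l * S\<^sub>l" "S\<^sub>r * shift_op T l = shift_op T l * S\<^sub>r"
    then have "S\<^sub>l \<cdot> shift_op T l \<cdot> w = shift_op T l \<cdot> S\<^sub>l \<cdot> w" "S\<^sub>r \<cdot> shift_op T l \<cdot> w = shift_op T l \<cdot> S\<^sub>r \<cdot> w"
      by (metis endo_apply_mult(1))+
    then show "S\<^sub>l \<cdot> z = z" "S\<^sub>r \<cdot> z = - z"
      by (simp_all only: z_def Sw endo_apply_simps(8))
  qed
  have "0 = (shift_op T l \<cdot> (w + z)) \<bullet> (w + z)"
    by (rule zero[symmetric]) (simp_all add: Sw Sz)
  also have "\<dots> = (shift_op T l \<cdot> w) \<bullet> z + (shift_op T l \<cdot> z) \<bullet> w"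
    unfolding endo_apply_simps(7) inner_add_left inner_add_right zero[OF Sw] zero[OF Sz] by simp
  also have "(shift_op T l \<cdot> z) \<bullet> w = z \<bullet> (shift_op T l \<cdot> w)"
    by (rule symmetric_opD[OF symmetric_shift_op[OF T]])
  finally have "z \<bullet> z = 0" unfolding z_def[symmetric] by simp
  then have "z = 0" by simp
  then show ?thesis
    unfolding eigenvalue_def using \<open>w \<noteq> 0\<close> by (intro exI[of _ w]) (simp add: z_def)
qed

context symmetric_l2_op
begin

text \<open>
  An eigenvector \<open>u\<close> at \<open>l\<close> forces the diagonal of \<open>\<bar>T - x\<bar>\<^sup>-\<^sup>1\<close> to blow up like
  \<open>1 / (x - l)\<close>.  The sign of \<open>T - x\<close> is constant to the right of \<open>l\<close>, so it may be
  applied to \<open>u\<close> first.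
\<close>

lemma no_eigenvalue_if_diagonal_bounded:
  assumes "d > 0" "0 \<le> C"
    and gap: "\<And>x. l < x \<Longrightarrow> x < l + d \<Longrightarrow> x \<notin> real_spectrum T"
    and diag: "\<And>x n. l < x \<Longrightarrow> x < l + d \<Longrightarrow> (abs_resolvent T x \<cdot> unit_vec n) \<bullet> unit_vec n \<le> C / sqrt (x - l)"
  shows "\<not> eigenvalue T l"
proof
  assume "eigenvalue T l"
  then obtain u where u: "u \<noteq> 0" "T \<cdot> u = l *\<^sub>R u" by (auto simp: eigenvalue_def)
  define S where "S = sign_op T (l + d/2)"
  have below: "bounded_below (shift_op T x)" if "x \<in> {l<..<l + d}" for x
    using gap that by (auto simp: real_spectrum_def)
  have S: "sign_op T x = S" if "x \<in> {l<..<l + d}" for x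
    unfolding S_def using that below \<open>d > 0\<close>
    by (intro sign_op_constant_on_connected[OF sym, of "{l<..<l + d}"]) auto
  have est: "(e \<bullet> (S \<cdot> u))\<^sup>2 \<le> C * sqrt (x - l) * (norm u)\<^sup>2"
    if x: "x \<in> {l<..<l + d}" and e: "(abs_resolvent T x \<cdot> e) \<bullet> e \<le> C / sqrt (x - l)" for x e
  proof -
    let ?R = "abs_resolvent T x"
    have pos: "0 < x - l" using x by simp
    have "shift_op T x \<cdot> u = (l - x) *\<^sub>R u" by (simp add: u algebra_simps)
    then have "S \<cdot> u = (l - x) *\<^sub>R (?R \<cdot> u)"
      unfolding S[OF x, symmetric] sign_op_def shift_abs_resolvent_commute[OF sym below[OF x]] by simp
    then have "e \<bullet> (S \<cdot> u) = (l - x) * (e \<bullet> (?R \<cdot> u))" by simp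
    also have "e \<bullet> (?R \<cdot> u) = (?R \<cdot> e) \<bullet> u"
      by (rule symmetric_opD[OF symmetric_abs_resolvent[OF sym below[OF x]], symmetric])
    finally have 1: "(e \<bullet> (S \<cdot> u))\<^sup>2 = (x - l)\<^sup>2 * ((?R \<cdot> e) \<bullet> u)\<^sup>2"
      by (simp add: power_mult_distrib power2_commute)
    have "norm (S \<cdot> u) = norm u"
      unfolding S[OF x, symmetric] by (rule norm_sign_op[OF sym below[OF x]])
    then have "(x - l) * norm (?R \<cdot> u) = norm u"
      using \<open>S \<cdot> u = (l - x) *\<^sub>R (?R \<cdot> u)\<close> pos by simp
    then have "(x - l) * ((?R \<cdot> u) \<bullet> u) \<le> norm u * norm u"
      using norm_cauchy_schwarz[of "?R \<cdot> u" u] pos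
      by (metis mult.assoc mult_left_mono less_imp_le)
    then have 2: "(x - l) * ((?R \<cdot> u) \<bullet> u) \<le> (norm u)\<^sup>2" by (simp add: power2_eq_square)
    have "((?R \<cdot> e) \<bullet> u)\<^sup>2 \<le> ((?R \<cdot> e) \<bullet> e) * ((?R \<cdot> u) \<bullet> u)"
      by (rule abs_resolvent_Cauchy_Schwarz[OF sym below[OF x]])
    also have "\<dots> \<le> C / sqrt (x - l) * ((?R \<cdot> u) \<bullet> u)"
      by (intro mult_right_mono e abs_resolvent_nonneg[OF sym below[OF x]])
    finally have "(e \<bullet> (S \<cdot> u))\<^sup>2 \<le> (x - l)\<^sup>2 * (C / sqrt (x - l) * ((?R \<cdot> u) \<bullet> u))"
      unfolding 1 by (intro mult_left_mono) auto
    also have "\<dots> = C * ((x - l) / sqrt (x - l)) * ((x - l) * ((?R \<cdot> u) \<bullet> u))"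
      by (simp add: power2_eq_square)
    also have "(x - l) / sqrt (x - l) = sqrt (x - l)"
      using pos by (simp add: real_div_sqrt)
    also have "C * sqrt (x - l) * ((x - l) * ((?R \<cdot> u) \<bullet> u)) \<le> C * sqrt (x - l) * (norm u)\<^sup>2"
      using 2 \<open>0 \<le> C\<close> pos by (intro mult_left_mono) auto
    finally show ?thesis .
  qed
  have zero: "e \<bullet> (S \<cdot> u) = 0"
    if e: "\<And>x. x \<in> {l<..<l + d} \<Longrightarrow> (abs_resolvent T x \<cdot> e) \<bullet> e \<le> C / sqrt (x - l)" for e
  proof -
    have "((\<lambda>x. C * sqrt (x - l) * (norm u)\<^sup>2) \<longlongrightarrow> C * sqrt (l - l) * (norm u)\<^sup>2) (at_right l)"
      by (intro tendsto_intros)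
    moreover have "\<forall>\<^sub>F x in at_right l. (e \<bullet> (S \<cdot> u))\<^sup>2 \<le> C * sqrt (x - l) * (norm u)\<^sup>2"
      using \<open>d > 0\<close> est e by (subst eventually_at_right[of l "l + d"]) (auto intro!: exI[of _ "l + d"])
    ultimately have "(e \<bullet> (S \<cdot> u))\<^sup>2 \<le> C * sqrt (l - l) * (norm u)\<^sup>2"
      by (rule tendsto_lowerbound) simp
    then show ?thesis by simp
  qed
  have "S \<cdot> u = 0"
  proof (rule l2_eqI)
    fix n
    have "Re (coord (S \<cdot> u) n) = 0"
      using zero[of "unit_vec n"] diag by (simp add: unit_vec_inner)
    moreover have "Im (coord (S \<cdot> u) n) = 0"
      using zero[of "cscale_op \<i> \<cdot> unit_vec n"] diag abs_resolvent_rotate[OF below]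
      by (simp add: cscale_unit_vec_inner)
    ultimately show "coord (S \<cdot> u) n = coord 0 n" by (simp add: complex_eq_iff)
  qed
  moreover have "norm (S \<cdot> u) = norm u"
    unfolding S_def by (rule norm_sign_op[OF sym below]) (use \<open>d > 0\<close> in auto)
  ultimately show False using u(1) by simp
qed

end

section \<open>Eigenvalues of Jacobi operators are simple\<close>

text \<open>A three-term recurrence with non-zero outer coefficients can be solved in both directions.\<close>

lemma jacobi_solution_zero:
  assumes a: "\<And>n. a n > 0" and w: "\<And>n. jacobi a b w n = z * w n" and "w 0 = 0" "w 1 = 0"
  shows "w n = 0"
proof -
  have "w n = 0 \<and> w (n + 1) = 0"
  proof (induction n rule: int_induct[of _ 0])
    case base
    show ?case using assms by simp
  next
    case (step1 i)
    have "of_real (a (i + 1)) * w (i + 2) = 0"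
      using w[of "i + 1"] step1 by (simp add: jacobi_def add.commute)
    then show ?case using a[of "i + 1"] step1 by (simp add: add.commute)
  next
    case (step2 i)
    have "of_real (a (i - 1)) * w (i - 1) = 0"
      using w[of i] step2 by (simp add: jacobi_def)
    then show ?case using a[of "i - 1"] step2 by simp
  qed
  then show ?thesis ..
qed

text \<open>
  The Wronskian of two solutions is constant, and it tends to 0 along the integers when both
  are square-summable.
\<close>

lemma jacobi_square_summable_solutions_proportional:
  assumes J: "jacobi_parameters a b" and u: "u \<in> ell2" "v \<in> ell2"
    and eq: "\<And>n. jacobi a b u n = z * u n" "\<And>n. jacobi a b v n = z * v n"
    and nz: "u \<noteq> (\<lambda>_. 0)"
  shows "\<exists>c. v = (\<lambda>n. c * u n)"
proof -
  have a: "a n > 0" for n using J by (simp add: jacobi_parameters_def)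
  obtain K where K: "\<And>n. \<bar>a n\<bar> \<le> K" using J by (auto simp: jacobi_parameters_def bounded_iff)
  have K0: "0 < K" using K[of 0] a[of 0] by simp
  define W where "W n = of_real (a n) * (u n * v (n + 1) - u (n + 1) * v n)" for n
  have step: "W (n + 1) = W n" for n
  proof -
    have "jacobi a b u (n + 1) * v (n + 1) - jacobi a b v (n + 1) * u (n + 1) = 0"
      unfolding eq by simp
    then show ?thesis
      by (simp add: jacobi_def W_def algebra_simps)
  qed
  have const: "W (int n) = W 0" for n
  proof (induction n)
    case (Suc n)
    have "int (Suc n) = int n + 1" by simp
    then show ?case using step Suc by metis
  qed simp
  have bound: "cmod (W n) \<le> K * ((cmod (u n))\<^sup>2 + (cmod (v n))\<^sup>2 + (cmod (u (n + 1)))\<^sup>2 + (cmod (v (n + 1)))\<^sup>2)" for n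
  proof -
    have "cmod (W n) = \<bar>a n\<bar> * cmod (u n * v (n + 1) - u (n + 1) * v n)"
      by (simp add: W_def norm_mult)
    also have "\<dots> \<le> K * (cmod (u n) * cmod (v (n + 1)) + cmod (u (n + 1)) * cmod (v n))"
      using norm_triangle_ineq4[of "u n * v (n + 1)" "u (n + 1) * v n"] K0
      by (intro mult_mono K) (auto simp: norm_mult)
    also have "\<dots> \<le> K * ((cmod (u n))\<^sup>2 + (cmod (v n))\<^sup>2 + (cmod (u (n + 1)))\<^sup>2 + (cmod (v (n + 1)))\<^sup>2)"
    proof (intro mult_left_mono)
      have "x * y \<le> x\<^sup>2 + y\<^sup>2" for x y :: real
        using sum_squares_bound[of x y] zero_le_power2[of x] zero_le_power2[of y] by linarith
      from this[of "cmod (u n)" "cmod (v (n + 1))"] this[of "cmod (u (n + 1))" "cmod (v n)"]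
      show "cmod (u n) * cmod (v (n + 1)) + cmod (u (n + 1)) * cmod (v n)
        \<le> (cmod (u n))\<^sup>2 + (cmod (v n))\<^sup>2 + (cmod (u (n + 1)))\<^sup>2 + (cmod (v (n + 1)))\<^sup>2" by linarith
    qed (use K0 in simp)
    finally show ?thesis .
  qed
  let ?w = "\<lambda>n. (cmod (u n))\<^sup>2 + (cmod (v n))\<^sup>2 + (cmod (u (n + 1)))\<^sup>2 + (cmod (v (n + 1)))\<^sup>2"
  have summable: "?w summable_on UNIV"
    using u summable_int_shift[of "\<lambda>n. (cmod (u n))\<^sup>2" 1] summable_int_shift[of "\<lambda>n. (cmod (v n))\<^sup>2" 1]
    by (intro summable_on_add) (auto simp: ell2_def)
  have "W 0 = 0"
  proof (rule ccontr)
    assume "W 0 \<noteq> 0"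
    define e where "e = cmod (W 0) / (2 * K)"
    have "e > 0" using \<open>W 0 \<noteq> 0\<close> K0 by (simp add: e_def)
    obtain F where F: "finite F" "\<And>n. n \<notin> F \<Longrightarrow> ?w n \<le> e"
      using summable_finite_exceptions[OF summable _ \<open>e > 0\<close>] by auto
    have "infinite (range int)" by (simp add: range_inj_infinite)
    then have "\<not> range int \<subseteq> F" using F(1) finite_subset by blast
    then obtain n where "int n \<notin> F" by blast
    then have "cmod (W 0) \<le> K * e"
      using bound[of "int n"] F(2)[of "int n"] const[of n] K0
      by (metis mult_left_mono less_imp_le order_trans)
    then show False using K0 \<open>e > 0\<close> \<open>W 0 \<noteq> 0\<close> by (simp add: e_def)
  qed
  then have W0: "u 0 * v 1 = u 1 * v 0" using a[of 0] by (simp add: W_def)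
  have "u 0 \<noteq> 0 \<or> u 1 \<noteq> 0"
    using jacobi_solution_zero[OF a eq(1)] nz by auto
  then obtain c where c: "v 0 = c * u 0" "v 1 = c * u 1"
  proof (cases "u 0 = 0")
    case True
    with \<open>u 0 \<noteq> 0 \<or> u 1 \<noteq> 0\<close> W0 show ?thesis by (intro that[of "v 1 / u 1"]) auto
  next
    case False
    with W0 show ?thesis by (intro that[of "v 0 / u 0"]) (auto simp: field_simps)
  qed
  have "v n - c * u n = 0" for n
  proof (rule jacobi_solution_zero[OF a, where w = "\<lambda>n. v n - c * u n" and b = b and z = z])
    show "jacobi a b (\<lambda>n. v n - c * u n) n = z * (v n - c * u n)" for n
      using eq(1)[of n] eq(2)[of n] by (simp add: jacobi_def algebra_simps)
        (metis distrib_left mult.left_commute)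
  qed (simp_all add: c)
  then show ?thesis by (intro exI[of _ c]) (auto simp: fun_eq_iff)
qed

lemma jacobi_eigenspace_span:
  assumes J: "jacobi_parameters a b"
  obtains u where "eigenspace (jacobi a b) z \<subseteq> cseq_span {u}"
proof (cases "eigenspace (jacobi a b) z \<subseteq> {\<lambda>_. 0}")
  case True
  have "(\<lambda>_. 0) = (0 :: int \<Rightarrow> complex)" by (simp add: fun_eq_iff)
  then have "{\<lambda>_. 0} \<subseteq> cseq_span {0}" using cseq.span_zero by auto
  with True show ?thesis using that by blast
next
  case False
  then obtain u where u: "u \<in> eigenspace (jacobi a b) z" "u \<noteq> (\<lambda>_. 0)" by blast
  have "eigenspace (jacobi a b) z \<subseteq> cseq_span {u}"
  proof
    fix v assume "v \<in> eigenspace (jacobi a b) z"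
    then obtain c where "v = (\<lambda>n. c * u n)"
      using jacobi_square_summable_solutions_proportional[OF J, of u v z] u by (auto simp: eigenspace_def)
    then show "v \<in> cseq_span {u}" using cseq.span_scale[OF cseq.span_base[of u "{u}"]] by simp
  qed
  then show ?thesis by (rule that)
qed

lemma jacobi_eigenvalue_multiplicity_le_1:
  assumes "jacobi_parameters a b"
  shows "eigenvalue_multiplicity (jacobi a b) z \<le> 1"
proof -
  obtain u where "eigenspace (jacobi a b) z \<subseteq> cseq_span {u}"
    using jacobi_eigenspace_span[OF assms] by blast
  then show ?thesis
    unfolding eigenvalue_multiplicity_def using cseq.dim_le_card[of _ "{u}"] by fastforce
qed


section \<open>From counting functions to moments\<close>

text \<open>
  Layer cake: \<open>\<delta> powr p\<close> is the integral of \<open>p * s powr (p - 1)\<close> over \<open>s \<le> \<delta>\<close>, and summing the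
  indicator functions of these ranges gives the counting function.
\<close>

lemma sum_powr_le_integral:
  fixes \<delta> :: "'i \<Rightarrow> real"
  assumes L: "finite L" "\<And>l. l \<in> L \<Longrightarrow> 0 < \<delta> l \<and> \<delta> l \<le> G" and p: "0 < p"
    and h: "(h has_integral I) {0..G}" "0 \<le> h 0"
    and count: "\<And>s. 0 < s \<Longrightarrow> s \<le> G \<Longrightarrow> p * s powr (p - 1) * real (card {l\<in>L. s \<le> \<delta> l}) \<le> h s"
  shows "(\<Sum>l\<in>L. \<delta> l powr p) \<le> I"
proof -
  let ?f = "\<lambda>l s. if s \<in> {0..\<delta> l} then p * s powr (p - 1) else 0"
  have int: "(?f l has_integral \<delta> l powr p) {0..G}" if "l \<in> L" for l
  proof (subst has_integral_restrict)
    show "{0..\<delta> l} \<subseteq> {0..G}" using L(2)[OF that] by auto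
    have "((\<lambda>s. s powr (p - 1)) has_integral (\<delta> l powr (p - 1 + 1) / (p - 1 + 1))) {0..\<delta> l}"
      using p L(2)[OF that] by (intro has_integral_powr_from_0) auto
    from has_integral_mult_right[OF this, of p] p
    show "((\<lambda>s. p * s powr (p - 1)) has_integral \<delta> l powr p) {0..\<delta> l}" by simp
  qed
  have "((\<lambda>s. \<Sum>l\<in>L. ?f l s) has_integral (\<Sum>l\<in>L. \<delta> l powr p)) {0..G}"
    by (intro has_integral_sum L(1) int)
  then show ?thesis
  proof (rule has_integral_le[OF _ h(1)])
    fix s assume s: "s \<in> {0..G}"
    show "(\<Sum>l\<in>L. ?f l s) \<le> h s"
    proof (cases "s = 0")
      case False
      then have "0 < s" using s by simp
      then have "(\<Sum>l\<in>L. ?f l s) = (\<Sum>l\<in>L. if s \<le> \<delta> l then p * s powr (p - 1) else 0)"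
        by (intro sum.cong) auto
      also have "\<dots> = (\<Sum>l\<in>{l\<in>L. s \<le> \<delta> l}. p * s powr (p - 1))"
        by (rule sum.mono_neutral_cong_right) (use L(1) in auto)
      also have "\<dots> = p * s powr (p - 1) * real (card {l\<in>L. s \<le> \<delta> l})" by simp
      also have "\<dots> \<le> h s" using count[OF \<open>0 < s\<close>] s by simp
      finally show ?thesis .
    next
      case True
      then have "(\<Sum>l\<in>L. ?f l s) = 0" by (intro sum.neutral) auto
      then show ?thesis using h(2) True by simp
    qed
  qed
qed

lemma sum_powr_le_inner:
  fixes \<delta> :: "'i \<Rightarrow> real"
  assumes L: "finite L" "\<And>l. l \<in> L \<Longrightarrow> 0 < \<delta> l \<and> \<delta> l \<le> g" and p: "1/2 < p" and g: "0 < g"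
    and count: "\<And>s. 0 < s \<Longrightarrow> s \<le> g \<Longrightarrow> real (card {l\<in>L. s \<le> \<delta> l}) \<le> c / sqrt s"
  shows "(\<Sum>l\<in>L. \<delta> l powr p) \<le> p / (2 * p - 1) * (2 * (c * g powr (p - 1/2)))"
proof -
  have "((\<lambda>s. c * p * s powr (p - 3/2)) has_integral c * p * (g powr (p - 3/2 + 1) / (p - 3/2 + 1))) {0..g}"
    using p g by (intro has_integral_mult_right has_integral_powr_from_0) auto
  then have "(\<Sum>l\<in>L. \<delta> l powr p) \<le> c * p * (g powr (p - 3/2 + 1) / (p - 3/2 + 1))"
  proof (rule sum_powr_le_integral[OF L, rotated 2])
    fix s assume s: "0 < s" "s \<le> g"
    have "p * s powr (p - 1) * real (card {l\<in>L. s \<le> \<delta> l}) \<le> p * s powr (p - 1) * (c / sqrt s)"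
      using p by (intro mult_left_mono count s) auto
    also have "\<dots> = c * p * (s powr (p - 1) / s powr (1/2))"
      using s by (simp add: powr_half_sqrt)
    also have "s powr (p - 1) / s powr (1/2) = s powr (p - 3/2)"
      by (simp add: powr_diff[symmetric])
    finally show "p * s powr (p - 1) * real (card {l\<in>L. s \<le> \<delta> l}) \<le> c * p * s powr (p - 3/2)" .
  qed (use p in auto)
  also have "\<dots> = p / (2 * p - 1) * (2 * (c * g powr (p - 1/2)))"
  proof -
    have "p - 3/2 + 1 = p - 1/2" by simp
    moreover have "p - 1/2 = (2 * p - 1) / 2" by (simp add: field_simps)
    ultimately show ?thesis using p by (simp add: field_simps)
  qed
  finally show ?thesis .
qed

text \<open>
  The count is used through \<open>1 / sqrt (s + D) \<le> 1 / sqrt D\<close> up to \<open>s = D\<close> and through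
  \<open>1 / sqrt (s + D) \<le> 1 / sqrt s\<close> beyond.
\<close>

lemma sum_powr_le_outer:
  fixes \<delta> :: "'i \<Rightarrow> real"
  assumes L: "finite L" "\<And>l. l \<in> L \<Longrightarrow> 0 < \<delta> l" and p: "1/2 < p" "p < 1" and D: "0 < D" and "0 \<le> c"
    and count: "\<And>s. 0 < s \<Longrightarrow> real (card {l\<in>L. s \<le> \<delta> l}) \<le> c / (sqrt s * sqrt (s + D))"
  shows "(\<Sum>l\<in>L. \<delta> l powr p) \<le> p / (2 * p - 1) * (c / ((1 - p) * D powr (1 - p)))"
proof -
  define G where "G = Max (insert D (\<delta> ` L))"
  have G: "D \<le> G" "\<And>l. l \<in> L \<Longrightarrow> \<delta> l \<le> G" using L(1) by (auto simp: G_def)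
  define h where "h s = (if s \<le> D then c * p / sqrt D * s powr (p - 3/2) else c * p * s powr (p - 2))" for s
  have split: "s powr (p - 1) / sqrt s = s powr (p - 3/2)" if "0 < s" for s
    using that by (simp add: powr_half_sqrt[symmetric] powr_diff[symmetric])
  have "((\<lambda>s. c * p / sqrt D * s powr (p - 3/2)) has_integral
      c * p / sqrt D * (D powr (p - 3/2 + 1) / (p - 3/2 + 1))) {0..D}"
    using p D by (intro has_integral_mult_right has_integral_powr_from_0) auto
  then have i1: "(h has_integral c * p / sqrt D * (D powr (p - 3/2 + 1) / (p - 3/2 + 1))) {0..D}"
    by (rule has_integral_eq[rotated]) (simp add: h_def)
  have "((\<lambda>s. c * p * s powr (p - 2)) has_integral
      c * p / (p - 1) * G powr (p - 1) - c * p / (p - 1) * D powr (p - 1)) {D..G}"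
  proof (rule fundamental_theorem_of_calculus[OF G(1)])
    fix s assume "s \<in> {D..G}"
    then have "0 < s" using D by simp
    then have "((\<lambda>s. c * p / (p - 1) * s powr (p - 1)) has_real_derivative
        c * p / (p - 1) * ((p - 1) * s powr (p - 1 - 1))) (at s within {D..G})"
      by (intro DERIV_subset[OF DERIV_cmult[OF has_real_derivative_powr]]) auto
    then show "((\<lambda>s. c * p / (p - 1) * s powr (p - 1)) has_vector_derivative c * p * s powr (p - 2))
        (at s within {D..G})"
      using p by (simp add: has_real_derivative_iff_has_vector_derivative mult.assoc)
  qed
  \<comment> \<open>The two branches of \<open>h\<close> agree at \<open>s = D\<close>.\<close>
  moreover have "c * p * s powr (p - 2) = h s" if "s \<in> {D..G}" for s
  proof (cases "s = D")
    case True
    have "D powr (p - 3/2 - 1/2) = D powr (p - 3/2) / sqrt D"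
      using D powr_diff[of D "p - 3/2" "1/2"] by (simp only: powr_half_sqrt less_imp_le)
    moreover have "p - 3/2 - 1/2 = p - 2" by simp
    ultimately show ?thesis using True by (simp add: h_def)
  qed (use that in \<open>simp add: h_def\<close>)
  ultimately have i2: "(h has_integral
      c * p / (p - 1) * G powr (p - 1) - c * p / (p - 1) * D powr (p - 1)) {D..G}"
    by (rule has_integral_eq[rotated])
  define I where "I = c * p / sqrt D * (D powr (p - 3/2 + 1) / (p - 3/2 + 1))
      + (c * p / (p - 1) * G powr (p - 1) - c * p / (p - 1) * D powr (p - 1))"
  have "(h has_integral I) {0..G}"
    unfolding I_def using D G(1) by (intro has_integral_combine[OF _ _ i1 i2]) auto
  then have "(\<Sum>l\<in>L. \<delta> l powr p) \<le> I"
  proof (rule sum_powr_le_integral[OF L(1) _ _, rotated 2])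
    fix s assume s: "0 < s" "s \<le> G"
    have "p * s powr (p - 1) * real (card {l\<in>L. s \<le> \<delta> l})
        \<le> p * s powr (p - 1) * (c / (sqrt s * sqrt (s + D)))"
      using p by (intro mult_left_mono count s) auto
    also have "\<dots> = c * p * s powr (p - 3/2) / sqrt (s + D)"
      unfolding split[OF s(1), symmetric] by simp
    also have "\<dots> \<le> h s"
    proof (cases "s \<le> D")
      case True
      have "c * p * s powr (p - 3/2) / sqrt (s + D) \<le> c * p * s powr (p - 3/2) / sqrt D"
        using p D s \<open>0 \<le> c\<close> by (intro divide_left_mono) auto
      then show ?thesis using True by (simp add: h_def)
    next
      case False
      have "c * p * s powr (p - 3/2) / sqrt (s + D) \<le> c * p * s powr (p - 3/2) / sqrt s"
        using p D s \<open>0 \<le> c\<close> by (intro divide_left_mono) auto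
      also have "\<dots> = c * p * (s powr (p - 3/2) / s powr (1/2))"
        using s by (simp add: powr_half_sqrt)
      also have "s powr (p - 3/2) / s powr (1/2) = s powr (p - 2)"
        by (simp add: powr_diff[symmetric])
      finally show ?thesis using False by (simp add: h_def)
    qed
    finally show "p * s powr (p - 1) * real (card {l\<in>L. s \<le> \<delta> l}) \<le> h s" .
  qed (use p D L G in \<open>auto simp: h_def\<close>)
  also have "I \<le> c * p * D powr (p - 1) * (1 / (p - 1/2) + 1 / (1 - p))"
  proof -
    have D1: "1 / sqrt D * D powr (p - 3/2 + 1) = D powr (p - 1)"
      using D by (simp add: powr_half_sqrt[symmetric] powr_diff[symmetric])
    have "c * p / sqrt D * (D powr (p - 3/2 + 1) / (p - 3/2 + 1))
        = c * p * (1 / sqrt D * D powr (p - 3/2 + 1)) * (1 / (p - 3/2 + 1))" by simp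
    also have "\<dots> = c * p * D powr (p - 1) * (1 / (p - 1/2))"
      unfolding D1 by simp
    finally have "c * p / sqrt D * (D powr (p - 3/2 + 1) / (p - 3/2 + 1))
        = c * p * D powr (p - 1) * (1 / (p - 1/2))" .
    moreover have "c * p / (p - 1) * G powr (p - 1) \<le> 0"
      using p \<open>0 \<le> c\<close> by (intro mult_nonpos_nonneg) (auto simp: divide_nonneg_neg)
    moreover have "- (c * p / (p - 1) * D powr (p - 1)) = c * p * D powr (p - 1) * (1 / (1 - p))"
      using p by (simp add: field_simps)
    ultimately show ?thesis unfolding I_def distrib_left by linarith
  qed
  also have "1 / (p - 1/2) + 1 / (1 - p) = 1 / ((2 * p - 1) * (1 - p))"
    using p by (simp add: field_simps)
  also have "c * p * D powr (p - 1) * (1 / ((2 * p - 1) * (1 - p)))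
      = p / (2 * p - 1) * (c / ((1 - p) * D powr (1 - p)))"
  proof -
    have "D powr (p - 1) = 1 / D powr (1 - p)" using powr_minus_divide[of D "1 - p"] by simp
    then show ?thesis by (simp add: mult_ac)
  qed
  finally show ?thesis .
qed


section \<open>Gaps of a compact set\<close>

context
  fixes E :: "real set" and K :: "nat set" and \<alpha> \<beta> :: "nat \<Rightarrow> real"
  assumes E: "compact E" "E \<noteq> {}" and gaps: "gap_enumeration E K \<alpha> \<beta>"
begin

lemma outer_gap_endpoints: "\<alpha> 0 \<in> E" "\<beta> 0 \<in> E" "\<And>e. e \<in> E \<Longrightarrow> \<beta> 0 \<le> e \<and> e \<le> \<alpha> 0"
proof -
  have bdd: "bdd_above E" "bdd_below E" and "closed E"
    using E(1) by (auto simp: compact_eq_bounded_closed bounded_imp_bdd_above bounded_imp_bdd_below)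
  then show "\<alpha> 0 \<in> E" "\<beta> 0 \<in> E"
    using gaps closed_contains_Sup[OF E(2)] closed_contains_Inf[OF E(2)]
    by (auto simp: gap_enumeration_def)
  show "\<beta> 0 \<le> e \<and> e \<le> \<alpha> 0" if "e \<in> E" for e
    using gaps that bdd by (auto simp: gap_enumeration_def intro: cSup_upper cInf_lower)
qed

lemma gap_disjoint: "k \<in> K \<Longrightarrow> x \<in> {\<alpha> k<..<\<beta> k} \<Longrightarrow> x \<notin> E"
  using gaps by (auto simp: gap_enumeration_def)

lemma inner_gap_exists:
  assumes "x \<notin> E" "\<beta> 0 \<le> x" "x \<le> \<alpha> 0"
  shows "\<exists>k\<in>K. x \<in> {\<alpha> k<..<\<beta> k}"
proof -
  have "x \<in> {\<beta> 0..\<alpha> 0} - E" using assms by auto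
  then have "x \<in> (\<Union>k\<in>K. {\<alpha> k<..<\<beta> k})" using gaps unfolding gap_enumeration_def by blast
  then show ?thesis by blast
qed

lemma gap_unique:
  assumes "j \<in> K" "k \<in> K" "x \<in> {\<alpha> j<..<\<beta> j}" "x \<in> {\<alpha> k<..<\<beta> k}"
  shows "j = k"
  using gaps assms unfolding gap_enumeration_def disjoint_family_on_def by blast

lemma gap_subset: "k \<in> K \<Longrightarrow> {\<alpha> k<..<\<beta> k} \<subseteq> {\<beta> 0..\<alpha> 0}"
  using gaps unfolding gap_enumeration_def by blast

text \<open>An end point outside the set would lie in another gap, which would then overlap.\<close>

lemma gap_endpoints:
  assumes k: "k \<in> K"
  shows "\<alpha> k < \<beta> k" "\<alpha> k \<in> E" "\<beta> k \<in> E"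
proof -
  show lt: "\<alpha> k < \<beta> k" using gaps k by (auto simp: gap_enumeration_def)
  have in_hull: "\<beta> 0 \<le> x" "x \<le> \<alpha> 0" if "x \<in> {\<alpha> k<..<\<beta> k}" for x
    using gap_subset[OF k] that by auto
  have "\<beta> 0 \<le> \<alpha> k" using in_hull(1) lt by (intro dense_ge_bounded[of "\<alpha> k" "\<beta> k"]) auto
  moreover have "\<beta> k \<le> \<alpha> 0" using in_hull(2) lt by (intro dense_le_bounded[of "\<alpha> k" "\<beta> k"]) auto
  ultimately have hull: "\<alpha> k \<in> {\<beta> 0..\<alpha> 0}" "\<beta> k \<in> {\<beta> 0..\<alpha> 0}" using lt by auto
  show "\<alpha> k \<in> E"
  proof (rule ccontr)
    assume "\<alpha> k \<notin> E"
    then obtain j where j: "j \<in> K" "\<alpha> k \<in> {\<alpha> j<..<\<beta> j}" using hull inner_gap_exists by auto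
    obtain t where "\<alpha> k < t" "t < min (\<beta> j) (\<beta> k)" using dense[of "\<alpha> k" "min (\<beta> j) (\<beta> k)"] j lt by auto
    then have "t \<in> {\<alpha> j<..<\<beta> j}" "t \<in> {\<alpha> k<..<\<beta> k}" using j(2) by auto
    then have "j = k" by (rule gap_unique[OF j(1) k])
    then show False using j by simp
  qed
  show "\<beta> k \<in> E"
  proof (rule ccontr)
    assume "\<beta> k \<notin> E"
    then obtain j where j: "j \<in> K" "\<beta> k \<in> {\<alpha> j<..<\<beta> j}" using hull inner_gap_exists by auto
    obtain t where "max (\<alpha> j) (\<alpha> k) < t" "t < \<beta> k" using dense[of "max (\<alpha> j) (\<alpha> k)" "\<beta> k"] j lt by auto
    then have "t \<in> {\<alpha> j<..<\<beta> j}" "t \<in> {\<alpha> k<..<\<beta> k}" using j(2) by auto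
    then have "j = k" by (rule gap_unique[OF j(1) k])
    then show False using j by simp
  qed
qed

lemma infdist_eqI:
  assumes "e \<in> E" "dist x e = r" "\<And>e'. e' \<in> E \<Longrightarrow> r \<le> dist x e'"
  shows "infdist x E = r"
proof (rule antisym)
  show "infdist x E \<le> r" using infdist_le[OF assms(1), of x] assms(2) by simp
  show "r \<le> infdist x E"
    unfolding infdist_notempty[OF E(2)] by (rule cINF_greatest[OF E(2) assms(3)])
qed

lemma infdist_inner_gap:
  assumes k: "k \<in> K" and x: "x \<in> {\<alpha> k<..<\<beta> k}"
  shows "infdist x E = min (x - \<alpha> k) (\<beta> k - x)"
proof -
  have far: "e \<le> \<alpha> k \<or> \<beta> k \<le> e" if "e \<in> E" for e
    using gap_disjoint[OF k, of e] that by force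
  have le: "min (x - \<alpha> k) (\<beta> k - x) \<le> dist x e" if "e \<in> E" for e
    using far[OF that] x by (auto simp: dist_real_def)
  show ?thesis
  proof (cases "x - \<alpha> k \<le> \<beta> k - x")
    case True
    then show ?thesis using le x by (intro infdist_eqI[OF gap_endpoints(2)[OF k]]) (auto simp: dist_real_def)
  next
    case False
    then show ?thesis using le x by (intro infdist_eqI[OF gap_endpoints(3)[OF k]]) (auto simp: dist_real_def)
  qed
qed

lemma infdist_outer_gap:
  shows "\<alpha> 0 < x \<Longrightarrow> infdist x E = x - \<alpha> 0" and "x < \<beta> 0 \<Longrightarrow> infdist x E = \<beta> 0 - x"
proof -
  show "infdist x E = x - \<alpha> 0" if "\<alpha> 0 < x"
  proof (rule infdist_eqI[OF outer_gap_endpoints(1)])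
    show "x - \<alpha> 0 \<le> dist x e" if "e \<in> E" for e
      using outer_gap_endpoints(3)[OF that] unfolding dist_real_def by linarith
  qed (use that in \<open>simp add: dist_real_def\<close>)
  show "infdist x E = \<beta> 0 - x" if "x < \<beta> 0"
  proof (rule infdist_eqI[OF outer_gap_endpoints(2)])
    show "\<beta> 0 - x \<le> dist x e" if "e \<in> E" for e
      using outer_gap_endpoints(3)[OF that] unfolding dist_real_def by linarith
  qed (use that in \<open>simp add: dist_real_def\<close>)
qed

end

section \<open>Eigenvalue sums\<close>

text \<open>
  The spectral measures enter the eigenvalue estimates through the diagonal entries of
  \<open>\<bar>T - x\<bar>\<^sup>-\<^sup>1\<close>, on which the integrals are upper bounds.
\<close>

locale jacobi_gap_bounds =
  fixes a b a' b' :: "int \<Rightarrow> real" and E :: "real set" and K :: "nat set" and \<alpha> \<beta> C :: "nat \<Rightarrow> real"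
  assumes bounded_parameters: "bounded (range a)" "bounded (range b)" "bounded (range a')" "bounded (range b')"
    and trace_class: "(\<lambda>n. \<bar>a n - a' n\<bar> + \<bar>b n - b' n\<bar>) summable_on UNIV"
    and spectrum_unperturbed: "real_spectrum (jacobi_op a' b') = E"
    and nonempty: "E \<noteq> {}" and hull: "\<beta> 0 < \<alpha> 0" and gaps: "gap_enumeration E K \<alpha> \<beta>"
    and C_nonneg: "\<And>k. k \<in> insert 0 K \<Longrightarrow> 0 \<le> C k"
    and diag_outer: "\<And>x n. x < \<beta> 0 \<or> \<alpha> 0 < x \<Longrightarrow>
      (abs_resolvent (jacobi_op a' b') x \<cdot> unit_vec n) \<bullet> unit_vec n
        \<le> C 0 / (sqrt \<bar>x - \<alpha> 0\<bar> * sqrt \<bar>x - \<beta> 0\<bar>)"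
    and diag_inner: "\<And>k x n. k \<in> K \<Longrightarrow> x \<in> {\<alpha> k<..<\<beta> k} \<Longrightarrow>
      (abs_resolvent (jacobi_op a' b') x \<cdot> unit_vec n) \<bullet> unit_vec n \<le> C k / sqrt (infdist x E)"
begin

abbreviation "T \<equiv> jacobi_op a' b'"
abbreviation "A \<equiv> jacobi_op a b"
abbreviation "trace_up \<equiv> \<Sum>\<^sub>\<infinity>n. trace_weight a b a' b' n"
abbreviation "trace_down \<equiv> \<Sum>\<^sub>\<infinity>n. trace_weight a' b' a b n"

sublocale T: symmetric_l2_op T "jacobi a' b'"
  by (rule symmetric_l2_op_jacobi[OF bounded_parameters(3,4)])

sublocale A: symmetric_l2_op A "jacobi a b"
  by (rule symmetric_l2_op_jacobi[OF bounded_parameters(1,2)])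

lemma compact_spectrum: "compact E"
  using compact_real_spectrum[of T] by (simp add: spectrum_unperturbed)

lemmas gap_facts = outer_gap_endpoints[OF compact_spectrum nonempty gaps]
  gap_disjoint[OF compact_spectrum nonempty gaps] gap_endpoints[OF compact_spectrum nonempty gaps]

lemma trace_class_sym: "(\<lambda>n. \<bar>a' n - a n\<bar> + \<bar>b' n - b n\<bar>) summable_on UNIV"
  using trace_class by (simp add: abs_minus_commute)

lemma trace_nonneg: "0 \<le> trace_up" "0 \<le> trace_down"
  by (intro infsum_nonneg trace_weight_nonneg)+

text \<open>
  An isolated point \<open>l\<close> would be an eigenvalue, but to the right of \<open>l\<close> there is a gap, inner or
  outer, in which the diagonal of \<open>\<bar>T - x\<bar>\<^sup>-\<^sup>1\<close> grows only like \<open>(x - l) powr (-1/2)\<close>.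
\<close>

lemma no_isolated_point:
  assumes l: "l \<in> E" and "d > 0"
  shows "\<exists>x\<in>E. 0 < \<bar>x - l\<bar> \<and> \<bar>x - l\<bar> < d"
proof (rule ccontr)
  assume "\<not> ?thesis"
  then have iso: "x \<notin> E" if "0 < \<bar>x - l\<bar>" "\<bar>x - l\<bar> < d" for x using that by blast
  have "eigenvalue T l"
    using isolated_spectrum_eigenvalue[OF T.sym _ \<open>d > 0\<close>, of l] l iso by (simp add: spectrum_unperturbed)
  moreover have "\<not> eigenvalue T l"
  proof (cases "l = \<alpha> 0")
    case True
    show ?thesis
    proof (rule T.no_eigenvalue_if_diagonal_bounded[OF \<open>d > 0\<close>, where C = "C 0 / sqrt (\<alpha> 0 - \<beta> 0)"])
      show "0 \<le> C 0 / sqrt (\<alpha> 0 - \<beta> 0)" using C_nonneg[of 0] hull by simp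
      fix x assume x: "l < x" "x < l + d"
      show "x \<notin> real_spectrum T" using iso x by (simp add: spectrum_unperturbed)
      fix n
      have "(abs_resolvent T x \<cdot> unit_vec n) \<bullet> unit_vec n \<le> C 0 / (sqrt \<bar>x - \<alpha> 0\<bar> * sqrt \<bar>x - \<beta> 0\<bar>)"
        using x True by (intro diag_outer) auto
      also have "\<dots> \<le> C 0 / (sqrt (x - l) * sqrt (\<alpha> 0 - \<beta> 0))"
        using x True hull C_nonneg[of 0]
        by (intro divide_left_mono mult_mono mult_pos_pos) auto
      finally show "(abs_resolvent T x \<cdot> unit_vec n) \<bullet> unit_vec n \<le> C 0 / sqrt (\<alpha> 0 - \<beta> 0) / sqrt (x - l)"
        by (simp add: mult.commute)
    qed
  next
    case False
    then have la: "l < \<alpha> 0" "\<beta> 0 \<le> l" using gap_facts(3)[OF l] by auto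
    define y where "y = l + min (d / 2) ((\<alpha> 0 - l) / 2)"
    have y: "l < y" "y < l + d" "y < \<alpha> 0" using la \<open>d > 0\<close> by (auto simp: y_def min_def field_simps)
    then have "y \<notin> E" using iso by auto
    then obtain k where k: "k \<in> K" "y \<in> {\<alpha> k<..<\<beta> k}"
      using inner_gap_exists[OF compact_spectrum nonempty gaps, of y] y la by auto
    have "l \<notin> {\<alpha> k<..<\<beta> k}" using gap_facts(4)[OF k(1)] l by blast
    then have "l \<le> \<alpha> k" using y k by auto
    moreover have "\<not> l < \<alpha> k"
      using iso[of "\<alpha> k"] gap_facts(6)[OF k(1)] y k by auto
    ultimately have "\<alpha> k = l" by simp
    define e where "e = (\<beta> k - l) / 2"
    have "e > 0" using k y by (simp add: e_def)
    show ?thesis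
    proof (rule T.no_eigenvalue_if_diagonal_bounded[OF \<open>e > 0\<close>, where C = "C k"])
      show "0 \<le> C k" using C_nonneg k by auto
      fix x assume x: "l < x" "x < l + e"
      then have x': "x \<in> {\<alpha> k<..<\<beta> k}" "x - l \<le> \<beta> k - x" using \<open>\<alpha> k = l\<close> by (auto simp: e_def field_simps)
      show "x \<notin> real_spectrum T" using gap_facts(4)[OF k(1) x'(1)] by (simp add: spectrum_unperturbed)
      show "(abs_resolvent T x \<cdot> unit_vec n) \<bullet> unit_vec n \<le> C k / sqrt (x - l)" for n
        using diag_inner[OF k(1) x'(1), of n] x'(2) \<open>\<alpha> k = l\<close>
        by (simp add: infdist_inner_gap[OF compact_spectrum nonempty gaps k(1) x'(1)])
    qed
  qed
  ultimately show False by blast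
qed

text \<open>
  Here the roles are exchanged: \<open>T\<close> is a perturbation of \<open>A\<close>, so a point of \<open>E\<close> in a gap of
  \<open>A\<close> would be isolated in \<open>E\<close>.
\<close>

lemma spectrum_subset_perturbed: "E \<subseteq> real_spectrum A"
proof
  fix l assume l: "l \<in> E"
  show "l \<in> real_spectrum A"
  proof (rule ccontr)
    assume "l \<notin> real_spectrum A"
    then obtain d where "d > 0" "\<And>x. 0 < \<bar>x - l\<bar> \<and> \<bar>x - l\<bar> < d \<Longrightarrow> x \<notin> E"
      using perturbed_gap_isolated_eigenvalue(2)[OF bounded_parameters(3,4,1,2) trace_class_sym, of l]
      unfolding spectrum_unperturbed by blast
    then show False using no_isolated_point[OF l] by blast
  qed
qed

lemma new_spectrum_eigenvalue: "l \<in> real_spectrum A \<Longrightarrow> l \<notin> E \<Longrightarrow> eigenvalue A l"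
  using perturbed_gap_isolated_eigenvalue(1)[OF bounded_parameters trace_class, of l]
  by (simp add: spectrum_unperturbed)

lemma new_spectrum_isolated:
  "l \<notin> E \<Longrightarrow> \<exists>d>0. \<forall>x. 0 < \<bar>x - l\<bar> \<and> \<bar>x - l\<bar> < d \<longrightarrow> x \<notin> real_spectrum A"
  using perturbed_gap_isolated_eigenvalue(2)[OF bounded_parameters trace_class, of l]
  by (simp add: spectrum_unperturbed)

lemmas count_in_gap = eigenvalues_in_gap_le[OF bounded_parameters trace_class, unfolded spectrum_unperturbed]

text \<open>
  The comparison interval is \<open>[\<alpha> k + s, \<beta> k - s]\<close>; both its ends have distance \<open>s\<close> from \<open>E\<close>, so
  the two traces come with the same factor.
\<close>

lemma count_inner_gap:
  assumes k: "k \<in> K" and s: "0 < s" and L: "finite L"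
    "\<And>l. l \<in> L \<Longrightarrow> l \<in> real_spectrum A \<and> l \<in> {\<alpha> k<..<\<beta> k} \<and> s \<le> infdist l E"
  shows "real (card L) \<le> C k * (trace_up + trace_down) / sqrt s"
proof (cases "L = {}")
  case True
  then show ?thesis using C_nonneg[of k] k s trace_nonneg by simp
next
  case False
  define x y where "x = \<alpha> k + s" and "y = \<beta> k - s"
  have L': "L \<subseteq> {x..y}"
    using L(2) infdist_inner_gap[OF compact_spectrum nonempty gaps k] by (fastforce simp: x_def y_def)
  then have "x \<le> y" using False by fastforce
  then have xy: "z \<in> {\<alpha> k<..<\<beta> k}" if "z \<in> {x..y}" for z
    using that s by (auto simp: x_def y_def)
  have "infdist x E = s" "infdist y E = s"
    using infdist_inner_gap[OF compact_spectrum nonempty gaps k xy] \<open>x \<le> y\<close> by (auto simp: x_def y_def)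
  then have diag: "(abs_resolvent T x \<cdot> unit_vec n) \<bullet> unit_vec n \<le> C k / sqrt s"
    "(abs_resolvent T y \<cdot> unit_vec n) \<bullet> unit_vec n \<le> C k / sqrt s" for n
    using diag_inner[OF k xy] \<open>x \<le> y\<close> by force+
  have "{x..y} \<inter> E = {}" using gap_facts(4)[OF k xy] by blast
  then have "real (card L) \<le> C k / sqrt s * trace_up + C k / sqrt s * trace_down"
  proof (rule count_in_gap[OF \<open>x \<le> y\<close> _ diag L(1) L'])
    show "eigenvalue A l" if "l \<in> L" for l
      using L(2)[OF that] gap_facts(4)[OF k] by (intro new_spectrum_eigenvalue) auto
  qed
  then show ?thesis by (simp add: distrib_left add_divide_distrib)
qed

definition outer_bound :: "real \<Rightarrow> real" where
  "outer_bound x = C 0 / (sqrt \<bar>x - \<alpha> 0\<bar> * sqrt \<bar>x - \<beta> 0\<bar>)"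

lemma count_outer_gap:
  assumes "x \<le> y" "y < \<beta> 0 \<or> \<alpha> 0 < x" and L: "finite L" "L \<subseteq> real_spectrum A" "L \<subseteq> {x..y}"
  shows "real (card L) \<le> outer_bound x * trace_up + outer_bound y * trace_down"
proof -
  have gap: "{x..y} \<inter> E = {}" using gap_facts(3) assms(1,2) by fastforce
  have "(abs_resolvent T z \<cdot> unit_vec n) \<bullet> unit_vec n \<le> outer_bound z" if "z \<in> {x..y}" for z n
    unfolding outer_bound_def using assms(1,2) that by (intro diag_outer) auto
  then show ?thesis
    using assms(1) L gap by (intro count_in_gap new_spectrum_eigenvalue) auto
qed

text \<open>
  In the unbounded component the far end of the comparison interval is sent to infinity, where
  the diagonal of the resolvent vanishes.
\<close>

lemma outer_bound_small:
  assumes "0 < e" "0 \<le> t"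
  obtains N where "\<And>y. N \<le> \<bar>y\<bar> \<Longrightarrow> outer_bound y * t \<le> e"
proof
  fix y :: real
  let ?r = "C 0 * t / e + 1"
  have C0: "0 \<le> C 0" using C_nonneg by simp
  then have r: "0 < ?r" using assms by (intro add_nonneg_pos) auto
  assume "\<bar>\<alpha> 0\<bar> + \<bar>\<beta> 0\<bar> + ?r \<le> \<bar>y\<bar>"
  then have "?r \<le> \<bar>y - \<alpha> 0\<bar>" "?r \<le> \<bar>y - \<beta> 0\<bar>" by linarith+
  then have "sqrt ?r * sqrt ?r \<le> sqrt \<bar>y - \<alpha> 0\<bar> * sqrt \<bar>y - \<beta> 0\<bar>"
    using r by (intro mult_mono) auto
  then have "outer_bound y \<le> C 0 / ?r"
    unfolding outer_bound_def using r C0 by (intro divide_left_mono mult_pos_pos) auto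
  then have "outer_bound y * t \<le> C 0 / ?r * t" using assms(2) by (rule mult_right_mono)
  also have "\<dots> \<le> e" using r assms(1) by (simp add: divide_le_eq distrib_left)
  finally show "outer_bound y * t \<le> e" .
qed

lemma count_above:
  assumes s: "0 < s" and L: "finite L" "\<And>l. l \<in> L \<Longrightarrow> l \<in> real_spectrum A \<and> \<alpha> 0 + s \<le> l"
  shows "real (card L) \<le> C 0 / (sqrt s * sqrt (s + (\<alpha> 0 - \<beta> 0))) * trace_up"
proof (rule field_le_epsilon)
  fix e :: real assume "e > 0"
  then obtain N where N: "\<And>y. N \<le> \<bar>y\<bar> \<Longrightarrow> outer_bound y * trace_down \<le> e"
    using outer_bound_small trace_nonneg(2) by blast
  define y where "y = Max (insert (\<alpha> 0 + s) (insert N L))"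
  have "z \<le> y" if "z \<in> insert (\<alpha> 0 + s) (insert N L)" for z
    unfolding y_def using L(1) that by (intro Max_ge) auto
  then have y: "\<alpha> 0 + s \<le> y" "N \<le> \<bar>y\<bar>" "\<And>l. l \<in> L \<Longrightarrow> l \<le> y"
    by (auto intro: order_trans[OF _ abs_ge_self])
  have "real (card L) \<le> outer_bound (\<alpha> 0 + s) * trace_up + outer_bound y * trace_down"
    using L y s by (intro count_outer_gap) auto
  moreover have "outer_bound (\<alpha> 0 + s) = C 0 / (sqrt s * sqrt (s + (\<alpha> 0 - \<beta> 0)))"
    using s hull by (simp add: outer_bound_def algebra_simps)
  ultimately show "real (card L) \<le> C 0 / (sqrt s * sqrt (s + (\<alpha> 0 - \<beta> 0))) * trace_up + e"
    using N[OF y(2)] by simp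
qed

lemma count_below:
  assumes s: "0 < s" and L: "finite L" "\<And>l. l \<in> L \<Longrightarrow> l \<in> real_spectrum A \<and> l \<le> \<beta> 0 - s"
  shows "real (card L) \<le> C 0 / (sqrt s * sqrt (s + (\<alpha> 0 - \<beta> 0))) * trace_down"
proof (rule field_le_epsilon)
  fix e :: real assume "e > 0"
  then obtain N where N: "\<And>x. N \<le> \<bar>x\<bar> \<Longrightarrow> outer_bound x * trace_up \<le> e"
    using outer_bound_small trace_nonneg(1) by blast
  define x where "x = Min (insert (\<beta> 0 - s) (insert (- N) L))"
  have le: "x \<le> z" if "z \<in> insert (\<beta> 0 - s) (insert (- N) L)" for z
    unfolding x_def using L(1) that by (intro Min_le) auto
  then have x: "x \<le> \<beta> 0 - s" "\<And>l. l \<in> L \<Longrightarrow> x \<le> l" by auto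
  have "N \<le> \<bar>x\<bar>" using le[of "- N"] by simp
  have "real (card L) \<le> outer_bound x * trace_up + outer_bound (\<beta> 0 - s) * trace_down"
    using L x s by (intro count_outer_gap) auto
  moreover have "\<bar>\<beta> 0 - s - \<alpha> 0\<bar> = s + (\<alpha> 0 - \<beta> 0)" "\<bar>\<beta> 0 - s - \<beta> 0\<bar> = s" using s hull by auto
  then have "outer_bound (\<beta> 0 - s) = C 0 / (sqrt s * sqrt (s + (\<alpha> 0 - \<beta> 0)))"
    unfolding outer_bound_def by (simp only: mult.commute)
  ultimately show "real (card L) \<le> C 0 / (sqrt s * sqrt (s + (\<alpha> 0 - \<beta> 0))) * trace_down + e"
    using N[OF \<open>N \<le> \<bar>x\<bar>\<close>] by simp
qed

text \<open>
  Above \<open>E\<close> only the upward part of the perturbation counts and below \<open>E\<close> only the downward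
  part, so both sides of the outer gap together cost the total trace once.
\<close>

lemma outer_gap_sum:
  assumes p: "1/2 < p" "p < 1" and L: "finite L" "L \<subseteq> real_spectrum A"
    "\<And>l. l \<in> L \<Longrightarrow> l < \<beta> 0 \<or> \<alpha> 0 < l"
  shows "(\<Sum>l\<in>L. infdist l E powr p)
    \<le> p / (2 * p - 1) * (C 0 * (trace_up + trace_down) / ((1 - p) * (\<alpha> 0 - \<beta> 0) powr (1 - p)))"
proof (rule sum_powr_le_outer[OF L(1) _ p])
  note dist = infdist_outer_gap[OF compact_spectrum nonempty gaps]
  show "0 < infdist l E" if "l \<in> L" for l
    using L(3)[OF that] dist[of l] by auto
  show "0 < \<alpha> 0 - \<beta> 0" using hull by simp
  show "0 \<le> C 0 * (trace_up + trace_down)" using C_nonneg[of 0] trace_nonneg by simp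
  fix s :: real assume s: "0 < s"
  define U V where "U = {l\<in>L. \<alpha> 0 + s \<le> l}" and "V = {l\<in>L. l \<le> \<beta> 0 - s}"
  have "{l\<in>L. s \<le> infdist l E} \<subseteq> U \<union> V"
    using L(3) dist by (force simp: U_def V_def)
  then have "card {l\<in>L. s \<le> infdist l E} \<le> card (U \<union> V)"
    using L(1) by (intro card_mono) (auto simp: U_def V_def)
  also have "\<dots> \<le> card U + card V" by (rule card_Un_le)
  finally have "real (card {l\<in>L. s \<le> infdist l E}) \<le> real (card U) + real (card V)" by linarith
  also have "\<dots> \<le> C 0 / (sqrt s * sqrt (s + (\<alpha> 0 - \<beta> 0))) * trace_up
      + C 0 / (sqrt s * sqrt (s + (\<alpha> 0 - \<beta> 0))) * trace_down"
    using L(1,2) by (intro add_mono count_above count_below s) (auto simp: U_def V_def)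
  finally show "real (card {l\<in>L. s \<le> infdist l E})
      \<le> C 0 * (trace_up + trace_down) / (sqrt s * sqrt (s + (\<alpha> 0 - \<beta> 0)))"
    by (simp add: distrib_left add_divide_distrib)
qed

lemma inner_gap_sum:
  assumes p: "1/2 < p" and k: "k \<in> K" and L: "finite L" "L \<subseteq> real_spectrum A" "L \<subseteq> {\<alpha> k<..<\<beta> k}"
  shows "(\<Sum>l\<in>L. infdist l E powr p)
    \<le> p / (2 * p - 1) * (2 * (C k * (trace_up + trace_down) * ((\<beta> k - \<alpha> k) / 2) powr (p - 1/2)))"
proof (rule sum_powr_le_inner[OF L(1) _ p])
  show "0 < infdist l E \<and> infdist l E \<le> (\<beta> k - \<alpha> k) / 2" if "l \<in> L" for l
    using that L(3) infdist_inner_gap[OF compact_spectrum nonempty gaps k, of l] by (auto simp: min_def)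
  show "0 < (\<beta> k - \<alpha> k) / 2" using gap_facts(5)[OF k] by simp
  show "real (card {l\<in>L. s \<le> infdist l E}) \<le> C k * (trace_up + trace_down) / sqrt s" if "0 < s" for s
    using L that by (intro count_inner_gap[OF k]) auto
qed

lemma finite_eigenvalue_sum:
  assumes p: "1/2 < p" "p < 1"
    and C_summable: "(\<lambda>k. C k * (\<beta> k - \<alpha> k) powr (p - 1/2)) summable_on K"
    and L: "finite L" "L \<subseteq> real_spectrum A - E"
  shows "(\<Sum>l\<in>L. infdist l E powr p) \<le> LT_const p K \<alpha> \<beta> C * (trace_up + trace_down)"
proof -
  let ?q = "p / (2 * p - 1)" and ?\<tau> = "trace_up + trace_down"
  let ?g = "\<lambda>k. C k * ((\<beta> k - \<alpha> k) / 2) powr (p - 1/2)"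
  have \<tau>: "0 \<le> ?\<tau>" using trace_nonneg by simp
  have q: "0 \<le> ?q" using p by simp
  define L0 where "L0 = {l\<in>L. l < \<beta> 0 \<or> \<alpha> 0 < l}"
  define gap where "gap k = {l\<in>L. l \<in> {\<alpha> k<..<\<beta> k}}" for k
  have "\<forall>l\<in>L - L0. \<exists>k\<in>K. l \<in> {\<alpha> k<..<\<beta> k}"
    using L(2) inner_gap_exists[OF compact_spectrum nonempty gaps] by (force simp: L0_def)
  then obtain \<kappa> where \<kappa>: "\<And>l. l \<in> L - L0 \<Longrightarrow> \<kappa> l \<in> K \<and> l \<in> {\<alpha> (\<kappa> l)<..<\<beta> (\<kappa> l)}" by metis
  \<comment> \<open>Only finitely many gaps contain a point of \<open>L\<close>.\<close>
  define K' where "K' = \<kappa> ` (L - L0)"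
  have K': "finite K'" "K' \<subseteq> K" using L(1) \<kappa> by (auto simp: K'_def)
  have cover: "L - L0 = (\<Union>k\<in>K'. gap k)"
  proof
    show "L - L0 \<subseteq> (\<Union>k\<in>K'. gap k)" using \<kappa> by (fastforce simp: K'_def gap_def)
    show "(\<Union>k\<in>K'. gap k) \<subseteq> L - L0"
      using K'(2) gap_subset[OF compact_spectrum nonempty gaps] by (fastforce simp: gap_def L0_def)
  qed
  have gap_part: "(\<Sum>k\<in>K'. ?g k) \<le> (\<Sum>\<^sub>\<infinity>k\<in>K. ?g k)"
  proof (rule finite_sum_le_infsum[OF _ K'])
    have half: "C k * (\<beta> k - \<alpha> k) powr (p - 1/2) * (1/2) powr (p - 1/2) = ?g k" if "k \<in> K" for k
    proof -
      have "((\<beta> k - \<alpha> k) * (1/2)) powr (p - 1/2) = (\<beta> k - \<alpha> k) powr (p - 1/2) * (1/2) powr (p - 1/2)"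
        by (rule powr_mult)
      then show ?thesis by simp
    qed
    have "(\<lambda>k. C k * (\<beta> k - \<alpha> k) powr (p - 1/2) * (1/2) powr (p - 1/2)) summable_on K
        \<longleftrightarrow> ?g summable_on K"
      by (rule summable_on_cong, rule half)
    then show "?g summable_on K"
      using summable_on_cmult_left[OF C_summable, of "(1/2) powr (p - 1/2)"] by blast
    show "0 \<le> ?g k" if "k \<in> K - K'" for k using C_nonneg[of k] that by simp
  qed
  have "(\<Sum>l\<in>L. infdist l E powr p) = (\<Sum>l\<in>L0. infdist l E powr p) + (\<Sum>l\<in>L - L0. infdist l E powr p)"
    using L(1) by (intro sum.subset_diff[of L0 L, THEN trans]) (auto simp: L0_def)
  also have "(\<Sum>l\<in>L - L0. infdist l E powr p) = (\<Sum>k\<in>K'. \<Sum>l\<in>gap k. infdist l E powr p)"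
    unfolding cover
  proof (rule sum.UNION_disjoint[OF K'(1)])
    show "\<forall>k\<in>K'. finite (gap k)" using L(1) by (simp add: gap_def)
    show "\<forall>j\<in>K'. \<forall>k\<in>K'. j \<noteq> k \<longrightarrow> gap j \<inter> gap k = {}"
      using gap_unique[OF compact_spectrum nonempty gaps] K'(2) unfolding gap_def by blast
  qed
  also have "(\<Sum>l\<in>L0. infdist l E powr p) \<le> ?q * (C 0 * ?\<tau> / ((1 - p) * (\<alpha> 0 - \<beta> 0) powr (1 - p)))"
    using L by (intro outer_gap_sum p) (auto simp: L0_def)
  also have "(\<Sum>k\<in>K'. \<Sum>l\<in>gap k. infdist l E powr p)
      \<le> (\<Sum>k\<in>K'. ?q * (2 * (C k * ?\<tau> * ((\<beta> k - \<alpha> k) / 2) powr (p - 1/2))))"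
    using L K' by (intro sum_mono inner_gap_sum p) (auto simp: gap_def)
  also have "\<dots> = ?q * (2 * (\<Sum>k\<in>K'. ?g k) * ?\<tau>)"
    by (simp add: sum_distrib_left sum_distrib_right mult_ac)
  also have "\<dots> \<le> ?q * (2 * (\<Sum>\<^sub>\<infinity>k\<in>K. ?g k) * ?\<tau>)"
    by (intro mult_left_mono mult_right_mono gap_part q \<tau>) auto
  finally have "(\<Sum>l\<in>L. infdist l E powr p) \<le> ?q * (C 0 * ?\<tau> / ((1 - p) * (\<alpha> 0 - \<beta> 0) powr (1 - p)))
      + ?q * (2 * (\<Sum>\<^sub>\<infinity>k\<in>K. ?g k) * ?\<tau>)"
    by simp
  also have "\<dots> = LT_const p K \<alpha> \<beta> C * ?\<tau>"
  proof -
    have "q * (c * t / n) + q * (2 * S * t) = q * (c / n + 2 * S) * t" for q c t n S :: real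
      by (simp add: distrib_left distrib_right)
    then show ?thesis unfolding LT_const_def by this
  qed
  finally show ?thesis .
qed

end

lemma infdist_of_real: "infdist (complex_of_real x) (complex_of_real ` E) = infdist x E"
  by (simp add: infdist_def image_image dist_of_real)

lemma isolated_in_of_real_iff:
  "complex_of_real x isolated_in complex_of_real ` S
    \<longleftrightarrow> x \<in> S \<and> (\<exists>d>0. \<forall>l. 0 < \<bar>l - x\<bar> \<and> \<bar>l - x\<bar> < d \<longrightarrow> l \<notin> S)"
  unfolding isolated_in_dist_Ex_iff
  by (auto simp: dist_of_real dist_real_def abs_minus_commute)

section \<open>The Lieb-Thirring inequality\<close>

theorem theorem3p1:
  fixes a b a' b' :: "int \<Rightarrow> real"
    and E :: "real set" and K :: "nat set" and \<alpha> \<beta> C :: "nat \<Rightarrow> real"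
    and p :: real and \<rho> :: "int \<Rightarrow> real measure"
  assumes J: "jacobi_parameters a b" and J': "jacobi_parameters a' b'"
    and trace_class: "(\<lambda>n. \<bar>a n - a' n\<bar> + \<bar>b n - b' n\<bar>) summable_on UNIV"
    and E: "spectrum (jacobi a' b') = complex_of_real ` E"
    and gaps: "gap_enumeration E K \<alpha> \<beta>"
    and C_nonneg: "\<forall>k\<in>insert 0 K. C k \<ge> 0"
    and p: "1 / 2 < p" "p < 1"
    and C_summable: "(\<lambda>k. C k * (\<beta> k - \<alpha> k) powr (p - 1 / 2)) summable_on K"
    and rho: "\<forall>n. is_spectral_measure (jacobi a' b') (ell2_basis n) (\<rho> n)"
    and outer_gap: "\<forall>x. x < \<beta> 0 \<or> \<alpha> 0 < x \<longrightarrow>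
          (SUP n. \<integral>\<^sup>+t\<in>E. ennreal (1 / \<bar>t - x\<bar>) \<partial>\<rho> n)
            \<le> ennreal (C 0 / (\<bar>x - \<alpha> 0\<bar> powr (1 / 2) * \<bar>x - \<beta> 0\<bar> powr (1 / 2)))"
    and inner_gaps: "\<forall>k\<in>K. \<forall>x\<in>{\<alpha> k<..<\<beta> k}.
          (SUP n. \<integral>\<^sup>+t\<in>E. ennreal (1 / \<bar>t - x\<bar>) \<partial>\<rho> n)
            \<le> ennreal (C k / infdist x E powr (1 / 2))"
  shows "ess_spectrum (jacobi a b) = complex_of_real ` E
    \<and> (\<lambda>z. real (eigenvalue_multiplicity (jacobi a b) z) * infdist z (complex_of_real ` E) powr p)
         summable_on (spectrum (jacobi a b) - complex_of_real ` E)
    \<and> (\<Sum>\<^sub>\<infinity>z\<in>spectrum (jacobi a b) - complex_of_real ` E.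
         real (eigenvalue_multiplicity (jacobi a b) z) * infdist z (complex_of_real ` E) powr p)
       \<le> LT_const p K \<alpha> \<beta> C * (\<Sum>\<^sub>\<infinity>n. 4 * \<bar>a n - a' n\<bar> + \<bar>b n - b' n\<bar>)"
proof -
  have ab: "bounded (range a)" "bounded (range b)" and ab': "bounded (range a')" "bounded (range b')"
    using J J' by (auto simp: jacobi_parameters_def)
  let ?T = "jacobi_op a' b'" and ?A = "jacobi_op a b"
  interpret T: symmetric_l2_op ?T "jacobi a' b'" by (rule symmetric_l2_op_jacobi[OF ab'])
  interpret A: symmetric_l2_op ?A "jacobi a b" by (rule symmetric_l2_op_jacobi[OF ab])
  have E_eq: "real_spectrum ?T = E"
    using T.real_spectrum_eq unfolding E by (auto simp: image_iff)
  \<comment> \<open>\<open>\<delta>\<^sub>0\<close> is no eigenvector since \<open>a'\<^sub>0 > 0\<close>; hence \<open>E\<close> has more than one point and \<open>\<beta> 0 < \<alpha> 0\<close>.\<close>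
  have "coord (shift_op ?T l \<cdot> unit_vec 0) 1 = of_real (a' 0)" for l
    by (simp add: coord_jacobi_op[OF ab']) (simp add: jacobi_def coord_unit_vec)
  moreover have "a' 0 \<noteq> 0" using J' by (metis jacobi_parameters_def less_irrefl)
  ultimately have "shift_op ?T l \<cdot> unit_vec 0 \<noteq> 0" for l
    by (metis coord_simps(1) of_real_eq_0_iff)
  then have not_single: "\<not> E \<subseteq> {l}" for l
    using T.real_spectrum_not_subset_singleton[OF rho[rule_format, of 0]] by (simp add: E_eq)
  have cpt: "compact E" using compact_real_spectrum[of ?T] by (simp add: E_eq)
  have ne: "E \<noteq> {}" using not_single by blast
  have hull: "\<beta> 0 < \<alpha> 0"
  proof (rule ccontr)
    assume "\<not> ?thesis"
    then have "e = \<alpha> 0" if "e \<in> E" for e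
      using outer_gap_endpoints(3)[OF cpt ne gaps that] by linarith
    then show False using not_single[of "\<alpha> 0"] by blast
  qed
  have diag: "(abs_resolvent ?T x \<cdot> unit_vec n) \<bullet> unit_vec n \<le> c"
    if "x \<notin> E" "0 \<le> c" "(SUP n. \<integral>\<^sup>+t\<in>E. ennreal (1 / \<bar>t - x\<bar>) \<partial>\<rho> n) \<le> ennreal c" for x c n
  proof (rule T.abs_resolvent_diagonal_le[OF rho[rule_format, of n] _ that(2)])
    show "x \<notin> real_spectrum ?T" using that(1) by (simp add: E_eq)
    have "(\<integral>\<^sup>+t\<in>E. ennreal (1 / \<bar>t - x\<bar>) \<partial>\<rho> n) \<le> (SUP n. \<integral>\<^sup>+t\<in>E. ennreal (1 / \<bar>t - x\<bar>) \<partial>\<rho> n)"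
      by (rule SUP_upper) simp
    then show "(\<integral>\<^sup>+t\<in>real_spectrum ?T. ennreal (1 / \<bar>t - x\<bar>) \<partial>\<rho> n) \<le> ennreal c"
      using that(3) unfolding E_eq by (rule order_trans)
  qed
  interpret jacobi_gap_bounds a b a' b' E K \<alpha> \<beta> C
  proof
    show "(abs_resolvent ?T x \<cdot> unit_vec n) \<bullet> unit_vec n \<le> C 0 / (sqrt \<bar>x - \<alpha> 0\<bar> * sqrt \<bar>x - \<beta> 0\<bar>)"
      if "x < \<beta> 0 \<or> \<alpha> 0 < x" for x n
    proof (rule diag)
      show "x \<notin> E" using outer_gap_endpoints(3)[OF cpt ne gaps, of x] that by linarith
      show "0 \<le> C 0 / (sqrt \<bar>x - \<alpha> 0\<bar> * sqrt \<bar>x - \<beta> 0\<bar>)" using C_nonneg by simp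
      show "(SUP n. \<integral>\<^sup>+t\<in>E. ennreal (1 / \<bar>t - x\<bar>) \<partial>\<rho> n)
          \<le> ennreal (C 0 / (sqrt \<bar>x - \<alpha> 0\<bar> * sqrt \<bar>x - \<beta> 0\<bar>))"
        using outer_gap[rule_format, OF that] by (simp add: powr_half_sqrt)
    qed
    show "(abs_resolvent ?T x \<cdot> unit_vec n) \<bullet> unit_vec n \<le> C k / sqrt (infdist x E)"
      if "k \<in> K" "x \<in> {\<alpha> k<..<\<beta> k}" for k x n
    proof (rule diag)
      show "x \<notin> E" by (rule gap_disjoint[OF cpt ne gaps that])
      show "0 \<le> C k / sqrt (infdist x E)" using C_nonneg that by (simp add: infdist_nonneg)
      show "(SUP n. \<integral>\<^sup>+t\<in>E. ennreal (1 / \<bar>t - x\<bar>) \<partial>\<rho> n) \<le> ennreal (C k / sqrt (infdist x E))"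
        using inner_gaps[rule_format, OF that] by (simp add: powr_half_sqrt infdist_nonneg)
    qed
  qed (use ab ab' trace_class E_eq ne hull gaps C_nonneg in auto)
  let ?S = "real_spectrum ?A"
  have spec: "spectrum (jacobi a b) = complex_of_real ` ?S"
  proof (intro subset_antisym subsetI)
    fix z assume z: "z \<in> spectrum (jacobi a b)"
    then have "z = of_real (Re z)" by (rule A.spectrum_real)
    moreover have "Re z \<in> ?S"
      using z \<open>z = of_real (Re z)\<close> unfolding A.real_spectrum_eq[symmetric] by simp
    ultimately show "z \<in> complex_of_real ` ?S" by blast
  qed (auto simp: A.real_spectrum_eq[symmetric])
  have new: "spectrum (jacobi a b) - complex_of_real ` E = complex_of_real ` (?S - E)"
    unfolding spec by auto
  \<comment> \<open>An isolated point of the spectrum of \<open>A\<close> inside \<open>E\<close> would be isolated in \<open>E\<close>.\<close>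
  have discrete: "discrete_spectrum (jacobi a b) = complex_of_real ` (?S - E)"
  proof (intro set_eqI iffI)
    fix z assume "z \<in> discrete_spectrum (jacobi a b)"
    then have iso: "z isolated_in complex_of_real ` ?S" by (simp add: discrete_spectrum_def spec)
    then obtain x where x: "z = of_real x" "x \<in> ?S" by (auto simp: isolated_in_def)
    obtain d where "d > 0" "\<And>l. 0 < \<bar>l - x\<bar> \<Longrightarrow> \<bar>l - x\<bar> < d \<Longrightarrow> l \<notin> ?S"
      using iso unfolding x(1) isolated_in_of_real_iff by blast
    then have "x \<notin> E" using no_isolated_point[of x d] spectrum_subset_perturbed by blast
    then show "z \<in> complex_of_real ` (?S - E)" using x by blast
  next
    fix z assume "z \<in> complex_of_real ` (?S - E)"
    then obtain x where x: "z = of_real x" "x \<in> ?S" "x \<notin> E" by blast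
    have "z isolated_in spectrum (jacobi a b)"
      unfolding spec x(1) isolated_in_of_real_iff using x(2) new_spectrum_isolated[OF x(3)] by blast
    moreover have "eigenspace (jacobi a b) z \<noteq> {0}"
    proof -
      obtain u where u: "u \<noteq> 0" "?A \<cdot> u = x *\<^sub>R u"
        using new_spectrum_eigenvalue[OF x(2,3)] by (auto simp: eigenvalue_def)
      have "coord u \<in> eigenspace (jacobi a b) z"
        using coord[of u] A.acts[of u] unfolding eigenspace_def x(1) u(2)
        by (simp add: fun_eq_iff scaleR_conv_of_real)
      moreover have "coord u \<noteq> 0" using u(1) l2_eqI[of u 0] by (metis coord_simps(1) zero_fun_apply)
      ultimately show ?thesis by blast
    qed
    moreover have "\<exists>B. finite B \<and> eigenspace (jacobi a b) z \<subseteq> cseq_span B"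
      using jacobi_eigenspace_span[OF J, of z] by (metis finite.emptyI finite_insert)
    ultimately show "z \<in> discrete_spectrum (jacobi a b)" by (simp add: discrete_spectrum_def)
  qed
  have ess: "ess_spectrum (jacobi a b) = complex_of_real ` E"
    unfolding ess_spectrum_def discrete spec using spectrum_subset_perturbed by auto
  let ?f = "\<lambda>z. real (eigenvalue_multiplicity (jacobi a b) z) * infdist z (complex_of_real ` E) powr p"
  have bound: "sum ?f F \<le> LT_const p K \<alpha> \<beta> C * (\<Sum>\<^sub>\<infinity>n. 4 * \<bar>a n - a' n\<bar> + \<bar>b n - b' n\<bar>)"
    if F: "finite F" "F \<subseteq> complex_of_real ` (?S - E)" for F
  proof -
    obtain L where L: "L \<subseteq> ?S - E" "finite L" "F = complex_of_real ` L"
      using finite_subset_image[OF F] by blast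
    have "sum ?f F = (\<Sum>l\<in>L. ?f (of_real l))"
      unfolding L(3) by (subst sum.reindex) (auto simp: inj_on_def)
    also have "\<dots> \<le> (\<Sum>l\<in>L. infdist l E powr p)"
    proof (rule sum_mono)
      fix l
      have "real (eigenvalue_multiplicity (jacobi a b) (of_real l)) \<le> 1"
        using jacobi_eigenvalue_multiplicity_le_1[OF J, of "of_real l"] by simp
      from mult_right_mono[OF this, of "infdist l E powr p"]
      show "?f (of_real l) \<le> infdist l E powr p" by (simp add: infdist_of_real)
    qed
    also have "\<dots> \<le> LT_const p K \<alpha> \<beta> C * (trace_up + trace_down)"
      by (rule finite_eigenvalue_sum[OF p C_summable L(2,1)])
    also have "trace_up + trace_down = (\<Sum>\<^sub>\<infinity>n. 4 * \<bar>a n - a' n\<bar> + \<bar>b n - b' n\<bar>)"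
      by (rule trace_weight_total[OF trace_class ab ab'])
    finally show ?thesis .
  qed
  have summable: "?f summable_on complex_of_real ` (?S - E)"
    using bound by (intro nonneg_bdd_above_summable_on) (auto intro!: bdd_aboveI2)
  show ?thesis
    unfolding new using ess summable infsum_le_finite_sums[OF summable bound] by blast
qed

end
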